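(* Let $X$ be a locally compact space with a positive Radon measure, let $A$ be a $C^*$-algebra, and let $B=C_b(X,A)$. Let $f\in B^+$. Then $f$ is $P$-proper if and only if there is an $m\in M(A)^+$ such that for every positive $\omega\in A'$ the function $x\mapsto\omega(f(x))$ is integrable on $X$ and $\int_X\omega(f(x))\,dx=\omega(m)$ (where $\omega$ is extended canonically to $M(A)$).
   Context: $C_b(X,A)$ is the $C^*$-algebra of bounded norm-continuous functions $X\to A$. Let $\mathcal B=\mathcal B(X)$ be the set of $\lambda\in L^\infty(X)$ with compact support and $0\le\lambda\le1$, directed pointwise; for $\lambda\in\mathcal B$ define $p_\lambda:B\to A\subseteq M(A)$ by $p_\lambda(f)=\int_X f(x)\lambda(x)\,dx$, and $P=\{p_\lambda\}_{\lambda\in\mathcal B}$. An element $f\in B^+$ is $P$-proper if $(p_\lambda(f))_{\lambda\in\mathcal B}$ converges in the strict topology of $M(A)$. *)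

theory Defs
  imports "HOL-Analysis.Analysis"
begin

class cstar_algebra = real_normed_algebra + complete_space +
  fixes cscale :: "complex \<Rightarrow> 'a \<Rightarrow> 'a"
    and cstar :: "'a \<Rightarrow> 'a"
  assumes cscale_of_real: "cscale (complex_of_real r) a = scaleR r a"
    and cscale_add_left: "cscale (c + d) a = cscale c a + cscale d a"
    and cscale_add_right: "cscale c (a + b) = cscale c a + cscale c b"
    and cscale_assoc: "cscale c (cscale d a) = cscale (c * d) a"
    and norm_cscale: "norm (cscale c a) = cmod c * norm a"
    and mult_cscale_left: "cscale c a * b = cscale c (a * b)"
    and mult_cscale_right: "a * cscale c b = cscale c (a * b)"
    and cstar_cstar: "cstar (cstar a) = a"
    and cstar_add: "cstar (a + b) = cstar a + cstar b"
    and cstar_cscale: "cstar (cscale c a) = cscale (cnj c) (cstar a)"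
    and cstar_mult: "cstar (a * b) = cstar b * cstar a"
    and cstar_identity: "norm (cstar a * a) = norm a * norm a"

definition cpos :: "'a::cstar_algebra \<Rightarrow> bool" where
  "cpos a \<longleftrightarrow> (\<exists>b. a = cstar b * b)"

definition cle :: "'a::cstar_algebra \<Rightarrow> 'a \<Rightarrow> bool" where
  "cle a b \<longleftrightarrow> cpos (b - a)"

definition pos_functional :: "('a::cstar_algebra \<Rightarrow> complex) \<Rightarrow> bool" where
  "pos_functional \<omega> \<longleftrightarrow>
     (\<forall>a b. \<omega> (a + b) = \<omega> a + \<omega> b) \<and>
     (\<forall>c a. \<omega> (cscale c a) = c * \<omega> a) \<and>
     (\<exists>K. \<forall>a. cmod (\<omega> a) \<le> K * norm a) \<and>
     (\<forall>a. cpos a \<longrightarrow> Im (\<omega> a) = 0 \<and> Re (\<omega> a) \<ge> 0)"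

definition bounded_functional :: "('a::cstar_algebra \<Rightarrow> complex) \<Rightarrow> bool" where
  "bounded_functional \<phi> \<longleftrightarrow>
     (\<forall>a b. \<phi> (a + b) = \<phi> a + \<phi> b) \<and>
     (\<forall>c a. \<phi> (cscale c a) = c * \<phi> a) \<and>
     (\<exists>K. \<forall>a. cmod (\<phi> a) \<le> K * norm a)"

text \<open>A multiplier m is a pair (L,R): m a = fst m a, a m = snd m a.
  A embeds via a \<mapsto> ((*) a, \<lambda>b. b * a).\<close>
definition multipliers :: "(('a::cstar_algebra \<Rightarrow> 'a) \<times> ('a \<Rightarrow> 'a)) set" where
  "multipliers = {(L, R). \<forall>a b. a * L b = R a * b}"

definition mmult :: "('a \<Rightarrow> 'a) \<times> ('a \<Rightarrow> 'a) \<Rightarrow> ('a \<Rightarrow> 'a) \<times> ('a \<Rightarrow> 'a) \<Rightarrow> ('a \<Rightarrow> 'a) \<times> ('a \<Rightarrow> 'a)" where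
  "mmult m n = (fst m \<circ> fst n, snd n \<circ> snd m)"

definition mstar :: "('a::cstar_algebra \<Rightarrow> 'a) \<times> ('a \<Rightarrow> 'a) \<Rightarrow> ('a \<Rightarrow> 'a) \<times> ('a \<Rightarrow> 'a)" where
  "mstar m = (cstar \<circ> snd m \<circ> cstar, cstar \<circ> fst m \<circ> cstar)"

definition mpos :: "('a::cstar_algebra \<Rightarrow> 'a) \<times> ('a \<Rightarrow> 'a) \<Rightarrow> bool" where
  "mpos m \<longleftrightarrow> m \<in> multipliers \<and> (\<exists>n\<in>multipliers. m = mmult (mstar n) n)"

text \<open>Canonical extension of a positive functional to M(A):
  \<omega>~(m) = lim \<omega>(m e) along the canonical approximate unit
  {e \<in> A+ . norm e < 1}, directed by the order of A.
  \<open>ext_value \<omega> m c\<close> means \<omega>~(m) = c.\<close>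
definition approx_unit :: "'a::cstar_algebra set" where
  "approx_unit = {e. cpos e \<and> norm e < 1}"

definition ext_value :: "('a::cstar_algebra \<Rightarrow> complex) \<Rightarrow> ('a \<Rightarrow> 'a) \<times> ('a \<Rightarrow> 'a) \<Rightarrow> complex \<Rightarrow> bool" where
  "ext_value \<omega> m c \<longleftrightarrow>
     (\<forall>\<epsilon>>0. \<exists>e0\<in>approx_unit. \<forall>e\<in>approx_unit. cle e0 e \<longrightarrow> cmod (\<omega> (fst m e) - c) < \<epsilon>)"

definition radon :: "'x::t2_space measure \<Rightarrow> bool" where
  "radon M \<longleftrightarrow> sets M = sets borel \<and>
     (\<forall>K. compact K \<longrightarrow> emeasure M K < \<infinity>) \<and>
     (\<forall>S\<in>sets borel. emeasure M S = (INF U\<in>{U. open U \<and> S \<subseteq> U}. emeasure M U)) \<and>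
     (\<forall>U. open U \<longrightarrow> emeasure M U = (SUP K\<in>{K. compact K \<and> K \<subseteq> U}. emeasure M K))"

text \<open>The directed set \<B>(X): (representatives of) L^\<infinity> functions with compact support
  and values in [0,1], ordered pointwise.\<close>
definition Bset :: "'x::t2_space measure \<Rightarrow> ('x \<Rightarrow> real) set" where
  "Bset M = {l. l \<in> borel_measurable M \<and> (\<forall>x. 0 \<le> l x \<and> l x \<le> 1) \<and>
                 (\<exists>K. compact K \<and> (\<forall>x. x \<notin> K \<longrightarrow> l x = 0))}"

definition has_wintegral :: "'x measure \<Rightarrow> ('x \<Rightarrow> 'a::cstar_algebra) \<Rightarrow> 'a \<Rightarrow> bool" where
  "has_wintegral M g a \<longleftrightarrow>
     (\<forall>\<phi>. bounded_functional \<phi> \<longrightarrow>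
        integrable M (\<lambda>x. \<phi> (g x)) \<and> (LINT x|M. \<phi> (g x)) = \<phi> a)"

definition p_lam :: "'x measure \<Rightarrow> ('x \<Rightarrow> real) \<Rightarrow> ('x \<Rightarrow> 'a::cstar_algebra) \<Rightarrow> 'a" where
  "p_lam M l f = (THE a. has_wintegral M (\<lambda>x. scaleR (l x) (f x)) a)"

definition P_proper :: "'x::t2_space measure \<Rightarrow> ('x \<Rightarrow> 'a::cstar_algebra) \<Rightarrow> bool" where
  "P_proper M f \<longleftrightarrow>
     (\<exists>m\<in>multipliers. \<forall>a. \<forall>\<epsilon>>0. \<exists>l0\<in>Bset M. \<forall>l\<in>Bset M. (\<forall>x. l0 x \<le> l x) \<longrightarrow>
        norm (p_lam M l f * a - fst m a) < \<epsilon> \<and> norm (a * p_lam M l f - snd m a) < \<epsilon>)"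

definition Cb_pos :: "('x::topological_space \<Rightarrow> 'a::cstar_algebra) \<Rightarrow> bool" where
  "Cb_pos f \<longleftrightarrow> (\<exists>g. continuous_on UNIV g \<and> bounded (range g) \<and> (\<forall>x. f x = cstar (g x) * g x))"

end

theory Submission
  imports Defs
begin

text \<open>
  Write \<open>a\<^sub>\<lambda>\<close> for \<open>p_lam M \<lambda> f\<close>, an increasing net of positive elements. By inner regularity on open
  sets, \<open>\<omega> a\<^sub>\<lambda>\<close> increases to the integral of \<open>\<omega> f\<close> for every positive functional \<open>\<omega>\<close>.

  If the net converges strictly to \<open>m\<close>, the uniform boundedness principle, applied to the square roots
  of the \<open>a\<^sub>\<lambda>\<close>, makes it bounded. Hence \<open>\<omega> f\<close> is integrable, and since \<open>\<omega> (a e)\<close> tends to \<open>\<omega> a\<close>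
  along the approximate unit uniformly for bounded \<open>a\<close>, the limits in \<open>e\<close> and \<open>\<lambda>\<close> may be exchanged.
  The square roots converge strictly as well, and their limit is a square root of \<open>m\<close>.

  Conversely, the integral condition, applied to the functionals \<open>\<omega> (c\<^sup>* \<cdot> c)\<close>, says that the positive
  elements \<open>c\<^sup>* (m - a\<^sub>\<lambda>) c\<close> decrease to zero under all positive functionals. They form a convex set, so
  by Hahn--Banach separation they tend to zero in norm, and a Cauchy--Schwarz inequality for the form
  \<open>(x, y) \<mapsto> x\<^sup>* (m - a\<^sub>\<lambda>) y\<close> gives \<open>(m - a\<^sub>\<lambda>) c \<rightarrow> 0\<close>.

  The spectral theory of positive elements is replaced by the binomial series of the square root.
\<close>

text \<open>Positivity is defined by the form \<open>cstar b * b\<close>, so not even closure under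
  addition is immediate, and the algebra may have no unit with which to form \<open>t - a\<close>.
  Both obstacles are met in the unitization: there the condition
  \<open>norm (t *\<^sub>R 1 - a) \<le> t\<close> describes the same cone, and the multiplicativity
  of the scalar part certifies that roots and upper bounds constructed there lie in the original
  algebra. M(A) is never made into an algebra: in the converse direction, positivity of a multiplier
  enters through the Gram form \<open>cstar (L c) * L d\<close> and through self-adjointness. The
  index set of the net is in general not countable, so the monotone convergence theorem for
  sequences says nothing about it; this is where regularity of the measure enters. Finally,
  \<open>p_lam\<close> is a definite description, so existence of the weak integral comes first. It
  is obtained from Riemann sums whose error is uniform over functionals with a common bound, which
  makes the sums Cauchy in norm.\<close>

instance cstar_algebra \<subseteq> banach ..

section \<open>Elementary consequences of the C*-axioms\<close>

lemma cstar_zero [simp]: "cstar (0::'a::cstar_algebra) = 0"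
  using cstar_add [of "0::'a" 0] by simp

lemma cstar_minus [simp]: "cstar (- a) = - cstar (a::'a::cstar_algebra)"
  using cstar_add [of a "- a"] by (simp add: eq_neg_iff_add_eq_0 add.commute)

lemma cstar_diff: "cstar (a - b) = cstar a - cstar (b::'a::cstar_algebra)"
  using cstar_add [of a "- b"] by simp

lemma cstar_scaleR [simp]: "cstar (r *\<^sub>R a) = r *\<^sub>R cstar (a::'a::cstar_algebra)"
  by (metis complex_cnj_complex_of_real cscale_of_real cstar_cscale)

lemmas cstar_simps = cstar_add cstar_diff cstar_mult cstar_cscale cstar_cstar

declare cstar_cstar [simp]

text \<open>The C*-identity and submultiplicativity give \<open>norm a \<le> norm (cstar a)\<close>;
  applied to \<open>cstar a\<close> the same inequality is the reverse one.\<close>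

lemma norm_cstar [simp]: "norm (cstar a) = norm (a::'a::cstar_algebra)"
proof -
  have le: "norm a \<le> norm (cstar a)" for a :: 'a
  proof (cases "a = 0")
    case False
    have "norm a * norm a \<le> norm (cstar a) * norm a"
      by (metis cstar_identity norm_mult_ineq)
    with False show ?thesis by simp
  qed simp
  show ?thesis using le [of a] le [of "cstar a"] by simp
qed

lemma bounded_linear_cstar: "bounded_linear (cstar :: 'a::cstar_algebra \<Rightarrow> 'a)"
  by (rule bounded_linear_intro [where K = 1]) (simp_all add: cstar_add)

lemmas tendsto_cstar = bounded_linear.tendsto [OF bounded_linear_cstar]

lemma cscale_one [simp]: "cscale 1 (a::'a::cstar_algebra) = a"
  using cscale_of_real [of 1 a] by simp

lemma cscale_zero_left [simp]: "cscale 0 (a::'a::cstar_algebra) = 0"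
  using cscale_of_real [of 0 a] by simp

lemma cscale_zero_right [simp]: "cscale c (0::'a::cstar_algebra) = 0"
  using norm_cscale [of c "0::'a"] by simp

lemma cscale_minus_left: "cscale (- c) (a::'a::cstar_algebra) = - cscale c a"
  using cscale_add_left [of c "- c" a] by (simp add: eq_neg_iff_add_eq_0 add.commute)

lemma cscale_minus_right: "cscale c (- a::'a::cstar_algebra) = - cscale c a"
  using cscale_add_right [of c a "- a"] by (simp add: eq_neg_iff_add_eq_0 add.commute)

lemma cscale_diff_right: "cscale c (a - b::'a::cstar_algebra) = cscale c a - cscale c b"
  using cscale_add_right [of c a "- b"] by (simp add: cscale_minus_right)

lemma cscale_scaleR: "cscale c (r *\<^sub>R a) = r *\<^sub>R cscale c (a::'a::cstar_algebra)"
  by (metis cscale_assoc cscale_of_real mult.commute)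

lemma bounded_linear_cscale: "bounded_linear (cscale c :: 'a::cstar_algebra \<Rightarrow> 'a)"
  by (rule bounded_linear_intro [where K = "cmod c"])
     (simp_all add: cscale_add_right cscale_scaleR norm_cscale)

lemma cstar_self_mult: "norm (a * a) = norm a * norm a" if "cstar a = a" for a :: "'a::cstar_algebra"
  using cstar_identity [of a] that by simp

lemma cstar_mult_self_eq_0: "cstar a * a = 0 \<longleftrightarrow> a = (0::'a::cstar_algebra)"
  using cstar_identity [of a] by auto

class unital_cstar_algebra = cstar_algebra + real_normed_algebra_1

lemma cstar_one [simp]: "cstar (1::'a::unital_cstar_algebra) = 1"
  by (metis cstar_cstar cstar_mult mult.right_neutral)

lemma cstar_power [simp]: "cstar (a ^ n) = cstar a ^ n" for a :: "'a::unital_cstar_algebra"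
  by (induction n) (simp_all add: cstar_mult power_commutes)

subsection \<open>The binomial square root\<close>

text \<open>The Taylor coefficients of the square root of \<open>1 - x\<close>. With this sign all
  of them except the zeroth are nonpositive.\<close>

definition sqrt_coeff :: "nat \<Rightarrow> real" where
  "sqrt_coeff k = (1/2 gchoose k) * (- 1) ^ k"

lemma sqrt_coeff_0 [simp]: "sqrt_coeff 0 = 1"
  by (simp add: sqrt_coeff_def)

lemma gbinomial_Suc_real: "(a gchoose Suc k) = (a gchoose k) * (a - real k) / (real k + 1)" for a :: real
  using gbinomial_mult_1 [of a k] by (simp add: field_simps)

lemma sqrt_coeff_Suc: "sqrt_coeff (Suc k) = sqrt_coeff k * (real k - 1/2) / (real k + 1)"
  by (simp add: sqrt_coeff_def gbinomial_Suc_real field_simps)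

lemma sqrt_coeff_neg: "sqrt_coeff (Suc k) \<le> 0"
proof (induction k)
  case 0 then show ?case by (simp add: sqrt_coeff_Suc)
next
  case (Suc k)
  then show ?case
    by (subst sqrt_coeff_Suc) (auto intro!: divide_nonpos_nonneg mult_nonpos_nonneg)
qed

text \<open>The alternating partial sums of \<open>1/2 gchoose k\<close> have the closed form
  \<open>(- 1) ^ n * (- 1/2 gchoose n)\<close>, which is nonnegative. As all terms after the first
  have one sign, their absolute values add up to at most \<open>sqrt_coeff 0\<close>. The series
  therefore converges on the closed unit ball, boundary included.\<close>

lemma sqrt_coeff_abs_sum: "(\<Sum>k<n. \<bar>sqrt_coeff (Suc k)\<bar>) \<le> 1"
proof -
  have nn: "0 \<le> ((- 1) ^ n * (- 1/2 gchoose n) :: real)" for n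
  proof (induction n)
    case (Suc n)
    have "((- 1) ^ Suc n * (- 1/2 gchoose Suc n) :: real) =
      ((- 1) ^ n * (- 1/2 gchoose n)) * ((1/2 + real n) / (real n + 1))"
      by (simp only: gbinomial_Suc_real) (simp add: field_simps)
    then show ?case using Suc by (simp del: power_Suc)
  qed simp
  have "0 \<le> (\<Sum>k\<le>n. sqrt_coeff k)"
    using nn [of n] gbinomial_sum_lower_neg [of "1/2::real" n] by (simp add: sqrt_coeff_def)
  also have "\<dots> = 1 + (\<Sum>k<n. sqrt_coeff (Suc k))"
    by (simp add: sum.atMost_shift)
  finally show ?thesis using sqrt_coeff_neg by (simp add: abs_of_nonpos sum_negf)
qed

lemma summable_sqrt_coeff: "summable (\<lambda>k. \<bar>sqrt_coeff k\<bar>)"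
  using sqrt_coeff_abs_sum by (subst summable_Suc_iff [symmetric]) (rule bounded_imp_summable [where B = 1],
    auto simp: lessThan_Suc_atMost [symmetric] simp del: sum.lessThan_Suc)

text \<open>Vandermonde's identity for \<open>1/2 + 1/2\<close>: the formal series squares to
  \<open>1 - x\<close>.\<close>

lemma sqrt_coeff_square:
  "(\<Sum>i\<le>n. sqrt_coeff i * sqrt_coeff (n - i)) = (if n = 0 then 1 else if n = 1 then -1 else 0)"
proof -
  have "(\<Sum>i\<le>n. sqrt_coeff i * sqrt_coeff (n - i)) =
    (- 1) ^ n * (\<Sum>k\<in>{0..n}. (1/2 gchoose k) * (1/2 gchoose (n - k)))"
    unfolding sum_distrib_left atMost_atLeast0
    by (rule sum.cong) (auto simp: sqrt_coeff_def power_add [symmetric] mult_ac)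
  also have "\<dots> = (- 1) ^ n * (of_nat 1 gchoose n)"
    by (subst gbinomial_Vandermonde) simp
  also have "\<dots> = (if n = 0 then 1 else if n = 1 then -1 else 0)"
    by (subst binomial_gbinomial [symmetric]) auto
  finally show ?thesis .
qed

text \<open>A square root of \<open>1 - x\<close>, not of \<open>x\<close>.\<close>

definition bsqrt :: "'a::unital_cstar_algebra \<Rightarrow> 'a" where
  "bsqrt x = (\<Sum>k. sqrt_coeff k *\<^sub>R x ^ k)"

lemma bsqrt_norm_summable:
  assumes "norm (x::'a::unital_cstar_algebra) \<le> 1"
  shows "summable (\<lambda>k. norm (sqrt_coeff k *\<^sub>R x ^ k))"
proof (rule summable_comparison_test' [OF summable_sqrt_coeff, of 0])
  fix n show "norm (norm (sqrt_coeff n *\<^sub>R x ^ n)) \<le> \<bar>sqrt_coeff n\<bar>"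
    using power_mono [OF assms norm_ge_zero, of n] norm_power_ineq [of x n]
    by (auto intro!: mult_left_le)
qed

lemma bsqrt_summable:
  "norm (x::'a::unital_cstar_algebra) \<le> 1 \<Longrightarrow> summable (\<lambda>k. sqrt_coeff k *\<^sub>R x ^ k)"
  by (rule summable_norm_cancel [OF bsqrt_norm_summable])

lemma bsqrt_square:
  assumes "norm (x::'a::unital_cstar_algebra) \<le> 1"
  shows "bsqrt x * bsqrt x = 1 - x"
proof -
  have "(\<lambda>n. \<Sum>i\<le>n. (sqrt_coeff i *\<^sub>R x ^ i) * (sqrt_coeff (n - i) *\<^sub>R x ^ (n - i))) sums (bsqrt x * bsqrt x)"
    unfolding bsqrt_def by (intro Cauchy_product_sums bsqrt_norm_summable assms)
  also have "(\<lambda>n. \<Sum>i\<le>n. (sqrt_coeff i *\<^sub>R x ^ i) * (sqrt_coeff (n - i) *\<^sub>R x ^ (n - i))) =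
     (\<lambda>n. (if n = 0 then 1 else if n = 1 then -1 else 0) *\<^sub>R x ^ n)"
  proof
    fix n
    have "(\<Sum>i\<le>n. (sqrt_coeff i *\<^sub>R x ^ i) * (sqrt_coeff (n - i) *\<^sub>R x ^ (n - i))) =
       (\<Sum>i\<le>n. (sqrt_coeff i * sqrt_coeff (n - i)) *\<^sub>R x ^ n)"
      by (rule sum.cong) (simp_all add: power_add [symmetric])
    then show "(\<Sum>i\<le>n. (sqrt_coeff i *\<^sub>R x ^ i) * (sqrt_coeff (n - i) *\<^sub>R x ^ (n - i))) =
       (if n = 0 then 1 else if n = 1 then -1 else 0) *\<^sub>R x ^ n"
      by (simp only: scaleR_left.sum [symmetric] sqrt_coeff_square)
  qed
  finally have "(\<lambda>n. (if n = 0 then 1 else if n = 1 then -1 else 0) *\<^sub>R x ^ n) sums (bsqrt x * bsqrt x)" .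
  moreover have "(\<lambda>n. (if n = 0 then 1 else if n = 1 then -1 else 0) *\<^sub>R x ^ n) sums
      (\<Sum>n\<in>{0,1}. (if n = 0 then 1 else if n = 1 then -1 else 0) *\<^sub>R x ^ n)"
    by (rule sums_finite) auto
  ultimately show ?thesis by (auto dest: sums_unique2)
qed

text \<open>Intertwining rather than commutation, because \<open>spos_neg_cstar_mult\<close> carries
  a root across a factor that commutes with neither side.\<close>

lemma bsqrt_intertwine:
  assumes "norm (x::'a::unital_cstar_algebra) \<le> 1" "norm z \<le> 1" "x * y = y * z"
  shows "bsqrt x * y = y * bsqrt z"
proof -
  have "x ^ k * y = y * z ^ k" for k
    by (induction k) (simp_all add: mult.assoc assms(3), metis assms(3) mult.assoc)
  then show ?thesis unfolding bsqrt_def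
    by (simp add: suminf_mult2 [OF bsqrt_summable [OF assms(1)]]
        suminf_mult [OF bsqrt_summable [OF assms(2)], symmetric])
qed

lemma cstar_bsqrt:
  assumes "norm (x::'a::unital_cstar_algebra) \<le> 1"
  shows "cstar (bsqrt x) = bsqrt (cstar x)"
  unfolding bsqrt_def
  by (subst bounded_linear.suminf [OF bounded_linear_cstar bsqrt_summable [OF assms]]) simp

text \<open>The coefficients after the zeroth have absolute sum at most 1. This is what makes the
  root itself satisfy \<open>spos\<close>.\<close>

lemma norm_one_minus_bsqrt:
  assumes "norm (x::'a::unital_cstar_algebra) \<le> 1"
  shows "norm (1 - bsqrt x) \<le> 1"
proof -
  have "bsqrt x - 1 = (\<Sum>k. sqrt_coeff (Suc k) *\<^sub>R x ^ Suc k)"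
    unfolding bsqrt_def using suminf_split_head [OF bsqrt_summable [OF assms]] by simp
  also have "norm \<dots> \<le> (\<Sum>k. norm (sqrt_coeff (Suc k) *\<^sub>R x ^ Suc k))"
    by (intro summable_norm summable_Suc_iff [THEN iffD2] bsqrt_norm_summable assms)
  also have "\<dots> \<le> (\<Sum>k. \<bar>sqrt_coeff (Suc k)\<bar>)"
  proof (rule suminf_le)
    fix n show "norm (sqrt_coeff (Suc n) *\<^sub>R x ^ Suc n) \<le> \<bar>sqrt_coeff (Suc n)\<bar>"
      using power_mono [OF assms norm_ge_zero, of "Suc n"] norm_power_ineq [of x "Suc n"]
      by (auto intro!: mult_left_le)
  next
    show "summable (\<lambda>k. norm (sqrt_coeff (Suc k) *\<^sub>R x ^ Suc k))"
      by (intro summable_Suc_iff [THEN iffD2] bsqrt_norm_summable assms)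
    show "summable (\<lambda>k. \<bar>sqrt_coeff (Suc k)\<bar>)"
      by (rule summable_Suc_iff [THEN iffD2, OF summable_sqrt_coeff])
  qed
  also have "\<dots> \<le> 1"
    by (intro suminf_le_const sqrt_coeff_abs_sum summable_Suc_iff [THEN iffD2, OF summable_sqrt_coeff])
  finally show ?thesis by (simp add: norm_minus_commute)
qed

subsection \<open>Positivity in unital C*-algebras\<close>

text \<open>A norm characterisation of positivity, under which closure under sums is the triangle
  inequality. That elements \<open>cstar x * x\<close> satisfy it is Kaplansky's theorem below.\<close>

definition spos :: "'a::unital_cstar_algebra \<Rightarrow> bool" where
  "spos a \<longleftrightarrow> cstar a = a \<and> (\<exists>t. norm (t *\<^sub>R 1 - a) \<le> t)"

lemma norm_scaleR_one_diff_mono: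
  fixes a :: "'a::unital_cstar_algebra"
  assumes "norm (t *\<^sub>R 1 - a) \<le> t" "t \<le> s"
  shows "norm (s *\<^sub>R 1 - a) \<le> s"
proof -
  have "s *\<^sub>R 1 - a = (s - t) *\<^sub>R 1 + (t *\<^sub>R 1 - a)"
    by (simp add: scaleR_diff_left)
  then have "norm (s *\<^sub>R 1 - a) \<le> norm ((s - t) *\<^sub>R (1::'a)) + norm (t *\<^sub>R 1 - a)"
    by (metis norm_triangle_ineq)
  then show ?thesis using assms by simp
qed

lemma spos_bound:
  assumes "spos a" obtains t where "0 < t" "t0 \<le> t" "norm (t *\<^sub>R 1 - a) \<le> t"
proof -
  obtain t where "norm (t *\<^sub>R 1 - a) \<le> t" using assms by (auto simp: spos_def)
  then have "norm (max t (max t0 1) *\<^sub>R 1 - a) \<le> max t (max t0 1)"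
    by (rule norm_scaleR_one_diff_mono) simp
  then show ?thesis by (rule that [rotated 2]) auto
qed

lemma spos_add:
  assumes "spos a" "spos b" shows "spos (a + b)"
proof -
  obtain t s where "norm (t *\<^sub>R 1 - a) \<le> t" "norm (s *\<^sub>R 1 - b) \<le> s"
    using assms by (auto simp: spos_def)
  moreover have "(t + s) *\<^sub>R 1 - (a + b) = (t *\<^sub>R 1 - a) + (s *\<^sub>R 1 - b)"
    by (simp add: scaleR_add_left)
  ultimately have "norm ((t + s) *\<^sub>R 1 - (a + b)) \<le> t + s"
    by (metis norm_triangle_mono)
  then show ?thesis using assms by (auto simp: spos_def cstar_add)
qed

lemma spos_scaleR:
  assumes "spos a" "0 \<le> s" shows "spos (s *\<^sub>R a)"
proof -
  obtain t where t: "norm (t *\<^sub>R 1 - a) \<le> t"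
    using assms by (auto simp: spos_def)
  have "norm ((s * t) *\<^sub>R 1 - s *\<^sub>R a) = s * norm (t *\<^sub>R 1 - a)"
    using assms(2) by (simp flip: scaleR_scaleR scaleR_diff_right)
  also have "\<dots> \<le> s * t" using t assms(2) by (simp add: mult_left_mono)
  finally show ?thesis using assms by (auto simp: spos_def)
qed

lemma cartesian_mult:
  fixes r s :: "'a::cstar_algebra"
  assumes "cstar r = r" "cstar s = s"
  shows "cstar (r + cscale \<i> s) * (r + cscale \<i> s) = r * r + s * s + cscale \<i> (r * s - s * r)"
  using assms
  by (simp add: cstar_simps cscale_minus_left cscale_diff_right ring_distribs mult_cscale_left mult_cscale_right cscale_assoc)

text \<open>A norm version of \<open>r\<^sup>2 \<le> r\<^sup>2 + s\<^sup>2\<close>: \<open>r\<close>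
  is the real part of the element \<open>u = r + is\<close>, hence
  \<open>norm r \<le> norm u\<close>, and \<open>cstar u * u\<close> is the sum of squares because
  \<open>r\<close> and \<open>s\<close> commute.\<close>

lemma norm_le_norm_cartesian:
  fixes r s :: "'a::cstar_algebra"
  assumes "cstar r = r" "cstar s = s" "r * s = s * r"
  shows "norm r * norm r \<le> norm (r * r + s * s)"
proof -
  let ?u = "r + cscale \<i> s"
  have "2 *\<^sub>R r = ?u + cstar ?u"
    using assms by (simp add: cstar_simps cscale_minus_left scaleR_2)
  then have "norm (2 *\<^sub>R r) \<le> norm ?u + norm (cstar ?u)"
    by (metis norm_triangle_ineq)
  then have "norm r \<le> norm ?u" by simp
  then have "norm r * norm r \<le> norm ?u * norm ?u" by (simp add: mult_mono)
  also have "\<dots> = norm (r * r + s * s)"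
    using cartesian_mult [OF assms(1,2)] assms(3) by (simp flip: cstar_identity)
  finally show ?thesis .
qed

text \<open>With \<open>c = sqrt (1 - b\<^sup>2)\<close> the element \<open>c + ib\<close> is unitary, whence \<open>norm c \<le> 1\<close>.\<close>

lemma norm_scaleR_one_diff_square:
  fixes b :: "'a::unital_cstar_algebra"
  assumes b: "cstar b = b" and t: "norm (b * b) \<le> t"
  shows "norm (t *\<^sub>R 1 - b * b) \<le> t"
proof (cases "t = 0")
  case True
  then show ?thesis using t by simp
next
  case False
  have "0 < t" using t norm_ge_zero [of "b * b"] False by linarith
  define x where "x = (1 / t) *\<^sub>R (b * b)"
  define b' where "b' = (1 / sqrt t) *\<^sub>R b"
  have b': "b' * b' = x" "cstar b' = b'"
    using \<open>0 < t\<close> b by (simp_all add: b'_def x_def)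
  have x: "norm x \<le> 1" using t \<open>0 < t\<close> by (simp add: x_def)
  have xs: "cstar x = x" using b by (simp add: x_def cstar_mult)
  have "norm (bsqrt x) * norm (bsqrt x) \<le> norm (bsqrt x * bsqrt x + b' * b')"
  proof (rule norm_le_norm_cartesian)
    show "cstar (bsqrt x) = bsqrt x" using xs by (simp add: cstar_bsqrt [OF x])
    show "bsqrt x * b' = b' * bsqrt x"
      by (rule bsqrt_intertwine [OF x x]) (simp flip: b'(1) add: mult.assoc)
  qed fact
  also have "\<dots> = 1" using bsqrt_square [OF x] b' by simp
  finally have "norm (1 - x) \<le> 1"
    using norm_mult_ineq [of "bsqrt x" "bsqrt x"] bsqrt_square [OF x] by simp
  then have "t * norm (1 - x) \<le> t" using \<open>0 < t\<close> by simp
  moreover have "t *\<^sub>R 1 - b * b = t *\<^sub>R (1 - x)"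
    using \<open>0 < t\<close> by (simp add: x_def scaleR_diff_right)
  ultimately show ?thesis using \<open>0 < t\<close> by simp
qed

lemma spos_square: "cstar b = b \<Longrightarrow> spos (b * b)"
  using norm_scaleR_one_diff_square [of b "norm (b * b)"] by (auto simp: spos_def cstar_mult)

text \<open>A root of \<open>a = t (1 - (1 - a / t))\<close>. The scale \<open>t\<close> stays a
  parameter so that two elements can be given the same power series and compared by
  intertwining.\<close>

definition scaled_sqrt :: "real \<Rightarrow> 'a::unital_cstar_algebra \<Rightarrow> 'a" where
  "scaled_sqrt t a = sqrt t *\<^sub>R bsqrt (1 - (1 / t) *\<^sub>R a)"

lemma scaled_sqrt_arg:
  fixes a :: "'a::unital_cstar_algebra"
  assumes "0 < t" "norm (t *\<^sub>R 1 - a) \<le> t"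
  shows "norm (1 - (1 / t) *\<^sub>R a) \<le> 1"
proof -
  have "1 - (1 / t) *\<^sub>R a = (1 / t) *\<^sub>R (t *\<^sub>R 1 - a)"
    using assms(1) by (simp add: scaleR_diff_right)
  then have "norm (1 - (1 / t) *\<^sub>R a) = (1 / t) * norm (t *\<^sub>R 1 - a)"
    using assms(1) by (simp only:) simp
  then show ?thesis using assms by simp
qed

lemma scaled_sqrt_square:
  assumes "0 < t" "norm (t *\<^sub>R 1 - a) \<le> t"
  shows "scaled_sqrt t a * scaled_sqrt t a = a"
  using assms(1) by (simp add: scaled_sqrt_def bsqrt_square [OF scaled_sqrt_arg [OF assms]])

lemma scaled_sqrt_intertwine:
  assumes "0 < t" "norm (t *\<^sub>R 1 - a) \<le> t" "norm (t *\<^sub>R 1 - b) \<le> t" "a * y = y * b"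
  shows "scaled_sqrt t a * y = y * scaled_sqrt t b"
proof -
  have "(1 - (1 / t) *\<^sub>R a) * y = y * (1 - (1 / t) *\<^sub>R b)"
    using assms(4) by (simp add: ring_distribs)
  from bsqrt_intertwine [OF scaled_sqrt_arg [OF assms(1,2)] scaled_sqrt_arg [OF assms(1,3)] this]
  show ?thesis by (simp add: scaled_sqrt_def)
qed

lemma scaled_sqrt_spos:
  assumes "0 < t" "norm (t *\<^sub>R 1 - a) \<le> t" "cstar a = a"
  shows "spos (scaled_sqrt t a)" "cstar (scaled_sqrt t a) = scaled_sqrt t a"
proof -
  show 1: "cstar (scaled_sqrt t a) = scaled_sqrt t a"
    by (simp add: scaled_sqrt_def cstar_bsqrt [OF scaled_sqrt_arg [OF assms(1,2)]] cstar_diff assms(3))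
  have "norm (sqrt t *\<^sub>R 1 - scaled_sqrt t a) \<le> sqrt t"
  proof -
    have "sqrt t *\<^sub>R 1 - scaled_sqrt t a = sqrt t *\<^sub>R (1 - bsqrt (1 - (1 / t) *\<^sub>R a))"
      by (simp add: scaled_sqrt_def scaleR_diff_right)
    then show ?thesis
      using norm_one_minus_bsqrt [OF scaled_sqrt_arg [OF assms(1,2)]] assms(1)
      by (simp add: mult_left_le)
  qed
  with 1 show "spos (scaled_sqrt t a)" by (auto simp: spos_def)
qed

lemma spos_sqrt:
  assumes "spos a"
  obtains r where "cstar r = r" "spos r" "r * r = a" "\<And>y. a * y = y * a \<Longrightarrow> r * y = y * r"
proof -
  obtain t where t: "0 < t" "norm (t *\<^sub>R 1 - a) \<le> t" by (rule spos_bound [OF assms])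
  moreover have "cstar a = a" using assms by (simp add: spos_def)
  ultimately show ?thesis
    by (intro that [of "scaled_sqrt t a"] scaled_sqrt_spos scaled_sqrt_square scaled_sqrt_intertwine)
qed

text \<open>The existential \<open>t\<close> in \<open>spos\<close> is upgraded to every
  \<open>t \<ge> norm a\<close>: now that \<open>a\<close> is known to be a square,
  \<open>norm_scaleR_one_diff_square\<close> applies with its sharp constant.\<close>

lemma spos_norm_diff:
  assumes "spos a" "norm a \<le> t" shows "norm (t *\<^sub>R 1 - a) \<le> t"
proof -
  obtain r where r: "cstar r = r" "r * r = a" using spos_sqrt [OF assms(1)] by blast
  show ?thesis using norm_scaleR_one_diff_square [OF r(1), of t] assms(2) by (simp add: r(2))
qed

lemma norm_le_sum_commuting:
  assumes "spos a" "spos b" "a * b = b * a"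
  shows "norm a \<le> norm (a + b)"
proof -
  obtain r where r: "cstar r = r" "r * r = a" "\<And>y. a * y = y * a \<Longrightarrow> r * y = y * r"
    using spos_sqrt [OF assms(1)] by blast
  obtain s where s: "cstar s = s" "s * s = b" "\<And>y. b * y = y * b \<Longrightarrow> s * y = y * s"
    using spos_sqrt [OF assms(2)] by blast
  \<comment> \<open>Each root commutes with whatever its square commutes with: first
    \<open>r\<close> with \<open>b\<close>, then \<open>s\<close> with \<open>r\<close>.\<close>
  have "r * s = s * r"
    using r(3) s(3) assms(3) by metis
  from norm_le_norm_cartesian [OF r(1) s(1) this] have "norm r * norm r \<le> norm (a + b)"
    by (simp add: r s)
  moreover have "norm a \<le> norm r * norm r" using norm_mult_ineq [of r r] r(2) by simp
  ultimately show ?thesis by simp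
qed

text \<open>The cone contains no line: \<open>b = - a\<close> commutes with \<open>a\<close>, so
  \<open>norm a\<close> is at most the norm of the sum.\<close>

lemma spos_add_eq_0:
  assumes "spos a" "spos b" "a + b = 0" shows "a = 0"
proof -
  have "b = - a" using assms(3) by (simp add: eq_neg_iff_add_eq_0 add.commute)
  then show ?thesis using norm_le_sum_commuting [OF assms(1,2)] assms(3) by simp
qed

lemma cube_eq_0:
  fixes d :: "'a::cstar_algebra"
  assumes "cstar d = d" "d * d * d = 0" shows "d = 0"
proof -
  have "norm ((d * d) * (d * d)) = norm (d * d) * norm (d * d)"
    by (rule cstar_self_mult) (simp add: cstar_mult assms)
  moreover have "(d * d) * (d * d) = 0"
    using assms(2) by (simp flip: mult.assoc)
  ultimately show ?thesis using cstar_self_mult [OF assms(1)] by simp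
qed

text \<open>For \<open>d = a - b\<close> the elements \<open>d * a * d\<close> and
  \<open>d * b * d\<close> are positive and add up to
  \<open>d * (a\<^sup>2 - b\<^sup>2) = 0\<close>. Hence both vanish, and so does their difference,
  the cube of \<open>d\<close>.\<close>

lemma spos_square_unique:
  assumes "spos a" "spos b" "a * b = b * a" "a * a = b * b" shows "a = b"
proof -
  define d where "d = a - b"
  have d: "cstar d = d" using assms by (simp add: spos_def d_def cstar_diff)
  have cd: "a * d = d * a" "b * d = d * b" using assms by (simp_all add: d_def algebra_simps)
  have *: "spos (d * c * d)" if c: "spos c" "c * d = d * c" for c
  proof -
    obtain r where r: "cstar r = r" "r * r = c" "\<And>y. c * y = y * c \<Longrightarrow> r * y = y * r"
      using spos_sqrt [OF c(1)] by blast
    have "spos ((r * d) * (r * d))"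
      by (rule spos_square) (simp add: cstar_mult r d r(3) c)
    also have "(r * d) * (r * d) = d * c * d"
      using r(3) [OF c(2)] r(2) by (metis mult.assoc)
    finally show ?thesis .
  qed
  have sum: "d * a * d + d * b * d = 0"
  proof -
    have "d * a * d + d * b * d = d * ((a + b) * (a - b))"
      by (simp add: d_def algebra_simps)
    also have "(a + b) * (a - b) = 0" using assms by (simp add: algebra_simps)
    finally show ?thesis by simp
  qed
  have "d * a * d = 0" by (rule spos_add_eq_0 [OF *[OF assms(1) cd(1)] *[OF assms(2) cd(2)] sum])
  moreover from this have "d * b * d = 0" using sum by simp
  moreover have "d * d * d = d * a * d - d * b * d" by (simp add: d_def algebra_simps)
  ultimately have "d = 0" using cube_eq_0 [OF d] by simp
  then show ?thesis by (simp add: d_def)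
qed

text \<open>With the self-adjoint elements \<open>u = y + cstar y\<close> and
  \<open>v = i (y - cstar y)\<close> the sum is half of \<open>u\<^sup>2 + v\<^sup>2\<close>.
  Positivity of the sum is thus available before that of either summand.\<close>

lemma spos_cstar_mult_add: "spos (cstar y * y + y * cstar y)"
proof -
  let ?u = "y + cstar y" and ?v = "cscale \<i> (y - cstar y)"
  have "cstar ?u = ?u" "cstar ?v = ?v"
    by (simp_all add: cstar_simps add.commute cscale_diff_right cscale_minus_left)
  then have "spos ((1/2) *\<^sub>R (?u * ?u + ?v * ?v))"
    by (intro spos_scaleR spos_add spos_square) auto
  also have "?v * ?v = - ((y - cstar y) * (y - cstar y))"
    using cscale_of_real [of "-1" "(y - cstar y) * (y - cstar y)"]
    by (simp add: mult_cscale_left mult_cscale_right cscale_assoc)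
  also have "?u * ?u + - ((y - cstar y) * (y - cstar y)) = 2 *\<^sub>R (cstar y * y + y * cstar y)"
    by (simp add: scaleR_2 algebra_simps)
  finally show ?thesis by simp
qed

text \<open>Usually derived from the common nonzero spectrum of \<open>cstar y * y\<close> and
  \<open>y * cstar y\<close>. Here \<open>a = y * cstar y\<close> is positive, as the positive sum
  of both products plus the positive \<open>b = - (cstar y * y)\<close>. From
  \<open>a * y = - (y * b)\<close> follows \<open>a\<^sup>2 * y = y * b\<^sup>2\<close>; intertwined
  roots give \<open>a * y = y * b\<close>, so \<open>y * b = 0\<close>.\<close>

lemma spos_neg_cstar_mult:
  assumes "spos (- (cstar y * y))" shows "y = 0"
proof -
  define a b where "a = y * cstar y" and "b = - (cstar y * y)"
  have b: "spos b" using assms by (simp add: b_def)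
  have "spos ((cstar y * y + y * cstar y) + b)" by (intro spos_add b spos_cstar_mult_add)
  then have a: "spos a" by (simp add: a_def b_def)
  have ay: "a * y = - (y * b)" by (simp add: a_def b_def mult.assoc)
  \<comment> \<open>A common scale for both squares, positive because of the added 1.\<close>
  define t where "t = max (norm (a * a)) (norm (b * b)) + 1"
  have "0 < t" using norm_ge_zero [of "a * a"] by (simp add: t_def max_def del: norm_ge_zero)
  then have t: "0 < t" "norm (t *\<^sub>R 1 - a * a) \<le> t" "norm (t *\<^sub>R 1 - b * b) \<le> t"
    using a b by (auto intro!: norm_scaleR_one_diff_square simp: t_def spos_def)
  have sq: "scaled_sqrt t (c * c) = c" if c: "spos c" "norm (t *\<^sub>R 1 - c * c) \<le> t" for c
  proof (rule spos_square_unique)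
    show "spos (scaled_sqrt t (c * c))"
      using c by (intro scaled_sqrt_spos t) (auto simp: spos_def cstar_mult)
    show "scaled_sqrt t (c * c) * c = c * scaled_sqrt t (c * c)"
      by (intro scaled_sqrt_intertwine t c) (simp add: mult.assoc)
  qed (use c t scaled_sqrt_square in auto)
  have "a * a * y = y * (b * b)" using ay by (simp add: mult.assoc) (simp flip: mult.assoc add: ay)
  from scaled_sqrt_intertwine [OF t this] have "a * y = y * b"
    by (simp add: sq a b t)
  with ay have "2 *\<^sub>R (y * b) = 0" by (simp add: scaleR_2 eq_neg_iff_add_eq_0)
  then have "cstar y * (y * b) = 0" by simp
  then have "cstar (cstar y * y) * (cstar y * y) = 0" by (simp add: b_def cstar_mult mult.assoc)
  then show ?thesis by (simp only: cstar_mult_self_eq_0)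
qed

text \<open>Kaplansky's theorem: if \<open>h = cstar x * x\<close> and \<open>p\<close> is the positive square root of
  \<open>h\<^sup>2\<close>, then \<open>y = x * (p - h)\<close> satisfies \<open>cstar y * y \<le> 0\<close>, so \<open>y = 0\<close> and \<open>(p - h)\<^sup>3 = 0\<close>.\<close>

theorem spos_cstar_mult: "spos (cstar x * x)"
proof -
  define h where "h = cstar x * x"
  have h: "cstar h = h" by (simp add: h_def cstar_mult)
  obtain p where p: "cstar p = p" "spos p" "p * p = h * h" "\<And>y. h * h * y = y * (h * h) \<Longrightarrow> p * y = y * p"
    using spos_sqrt [OF spos_square [OF h]] by blast
  have ph: "p * h = h * p" by (rule p(4)) (simp add: mult.assoc)
  define k where "k = p - h"
  have k: "cstar k = k" by (simp add: k_def cstar_diff p h)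
  obtain r where r: "cstar r = r" "r * r = p" "\<And>y. p * y = y * p \<Longrightarrow> r * y = y * r"
    using spos_sqrt [OF p(2)] by blast
  have rk: "r * k = k * r" by (rule r(3)) (simp add: k_def algebra_simps ph)
  \<comment> \<open>Since \<open>p\<close> and \<open>h\<close> commute and have equal squares,
    \<open>h * (p - h) = h * p - p * p\<close>.\<close>
  have hk: "h * k = - (p * k)" by (simp add: k_def algebra_simps ph p(3))
  have rkrk: "(r * k) * (r * k) = k * p * k" using rk r(2) by (metis mult.assoc)
  have yy: "cstar (x * k) * (x * k) = - (k * p * k)"
  proof -
    have "cstar (x * k) * (x * k) = k * (h * k)" by (simp add: cstar_mult k h_def mult.assoc)
    then show ?thesis by (simp add: hk mult.assoc)
  qed
  have "spos (- (cstar (x * k) * (x * k)))"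
  proof -
    have "cstar (r * k) = r * k" by (simp add: cstar_mult r k rk)
    from spos_square [OF this] show ?thesis by (simp only: yy rkrk minus_minus)
  qed
  then have "x * k = 0" by (rule spos_neg_cstar_mult)
  then have "h * k = 0" by (simp add: h_def mult.assoc)
  then have "k * k * k = 0" using hk by (simp add: k_def mult.assoc left_diff_distrib)
  then have "k = 0" by (rule cube_eq_0 [OF k])
  then show ?thesis using p(2) by (simp add: k_def h_def)
qed

text \<open>From here on the algebraic and the norm description of positivity are interchangeable;
  sums and limits use the latter.\<close>

lemma cpos_iff_spos: "cpos a \<longleftrightarrow> spos a"
  unfolding cpos_def using spos_cstar_mult spos_sqrt by metis

lemma cpos_cstar: "cpos (a::'a::cstar_algebra) \<Longrightarrow> cstar a = a"
  by (auto simp: cpos_def cstar_mult)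

lemma cpos_cstar_mult: "cpos (cstar a * (a::'a::cstar_algebra))"
  by (auto simp: cpos_def)

lemma cpos_zero [simp]: "cpos (0::'a::cstar_algebra)"
  using cpos_cstar_mult [of "0::'a"] by simp

lemma cpos_conj: "cpos (a::'a::cstar_algebra) \<Longrightarrow> cpos (cstar c * a * c)"
  unfolding cpos_def by (metis cstar_mult mult.assoc)

lemma unital_cpos_le:
  fixes a :: "'a::unital_cstar_algebra"
  assumes "cpos a" "norm a \<le> t" shows "cpos (t *\<^sub>R 1 - a)"
proof -
  have "norm (t *\<^sub>R 1 - (t *\<^sub>R 1 - a)) \<le> t" using assms by simp
  moreover have "cstar (t *\<^sub>R 1 - a) = t *\<^sub>R 1 - a"
    by (simp add: cstar_diff cpos_cstar [OF assms(1)])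
  ultimately show ?thesis unfolding cpos_iff_spos spos_def by blast
qed

lemma unital_norm_le:
  fixes a :: "'a::unital_cstar_algebra"
  assumes "cpos a" "cpos (t *\<^sub>R 1 - a)" "0 \<le> t" shows "norm a \<le> t"
  using norm_le_sum_commuting [of a "t *\<^sub>R 1 - a"] assms by (simp add: cpos_iff_spos algebra_simps)

lemma unital_cpos_add: "cpos a \<Longrightarrow> cpos b \<Longrightarrow> cpos (a + b)" for a :: "'a::unital_cstar_algebra"
  by (simp add: cpos_iff_spos spos_add)

lemma unital_cpos_closed:
  fixes a :: "nat \<Rightarrow> 'a::unital_cstar_algebra"
  assumes "a \<longlonglongrightarrow> l" "\<And>n. cpos (a n)" shows "cpos l"
proof -
  have "bounded (range a)" using assms(1) convergent_imp_bounded convergentI by blast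
  then obtain t where t: "\<And>n. norm (a n) \<le> t" by (auto simp: bounded_iff)
  have "(\<lambda>n. norm (t *\<^sub>R 1 - a n)) \<longlonglongrightarrow> norm (t *\<^sub>R 1 - l)" by (intro tendsto_intros assms)
  then have "norm (t *\<^sub>R 1 - l) \<le> t"
  proof (rule LIMSEQ_le_const2)
    have "norm (t *\<^sub>R 1 - a n) \<le> t" for n
      by (rule spos_norm_diff) (use assms(2) t in \<open>simp_all add: cpos_iff_spos\<close>)
    then show "\<exists>N. \<forall>n\<ge>N. norm (t *\<^sub>R 1 - a n) \<le> t" by blast
  qed
  moreover have "cstar l = l"
  proof (rule LIMSEQ_unique [OF _ assms(1)])
    show "a \<longlonglongrightarrow> cstar l"
      using tendsto_cstar [OF assms(1)] by (simp add: cpos_cstar assms(2))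
  qed
  ultimately show ?thesis by (auto simp: cpos_iff_spos spos_def)
qed

text \<open>\<open>norm_le_sum_commuting\<close> does not apply to \<open>a\<close> and
  \<open>b - a\<close> directly, so the comparison passes through \<open>norm b *\<^sub>R 1\<close>,
  which commutes with everything.\<close>

lemma unital_norm_mono:
  fixes a :: "'a::unital_cstar_algebra"
  assumes "cpos a" "cpos (b - a)" shows "norm a \<le> norm b"
proof (rule unital_norm_le [OF assms(1)])
  have "cpos b" using unital_cpos_add [OF assms] by simp
  then have "cpos ((norm b *\<^sub>R 1 - b) + (b - a))"
    by (intro unital_cpos_add unital_cpos_le assms order_refl)
  then show "cpos (norm b *\<^sub>R 1 - a)" by simp
qed simp

lemma unital_sqrt:
  fixes a :: "'a::unital_cstar_algebra"
  assumes "cpos a"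
  obtains r where "cstar r = r" "cpos r" "r * r = a" "\<And>y. a * y = y * a \<Longrightarrow> r * y = y * r"
  using spos_sqrt assms unfolding cpos_iff_spos by blast

lemma cpos_mult_commuting:
  fixes a :: "'a::unital_cstar_algebra"
  assumes "cpos a" "cpos b" "a * b = b * a" shows "cpos (a * b)"
proof -
  obtain r where r: "cstar r = r" "r * r = a" "\<And>y. a * y = y * a \<Longrightarrow> r * y = y * r"
    using unital_sqrt [OF assms(1)] by blast
  have "a * b = cstar r * b * r" using r(1,2) r(3) [OF assms(3)] by (metis mult.assoc)
  then show ?thesis using cpos_conj [OF assms(2)] by simp
qed

section \<open>Inverses of positive elements and the order on the unit ball\<close>

lemma neumann_inverse:
  fixes y :: "'a::unital_cstar_algebra"
  assumes "norm y < 1"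
  obtains w where "(1 - y) * w = 1" "w * (1 - y) = 1"
proof -
  note s = complete_algebra_summable_geometric [OF assms]
  define w where "w = (\<Sum>k. y ^ k)"
  have "w = (\<Sum>k. y ^ Suc k) + 1" unfolding w_def using suminf_split_head [OF s] by simp
  moreover have "(\<Sum>k. y ^ Suc k) = y * w" by (simp add: w_def suminf_mult [OF s])
  moreover have "(\<Sum>k. y ^ Suc k) = w * y" unfolding w_def suminf_mult2 [OF s] by (simp add: power_commutes)
  ultimately show ?thesis using that [of w] by (simp add: algebra_simps)
qed

lemma inverse_selfadjoint:
  fixes x :: "'a::unital_cstar_algebra"
  assumes "cstar x = x" "x * v = 1" "v * x = 1" shows "cstar v = v"
proof -
  have "x * cstar v = 1" using assms(1,3) by (metis cstar_mult cstar_one)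
  then have "v * (x * cstar v) = v" by simp
  then show ?thesis using assms(3) by (simp flip: mult.assoc)
qed

lemma cpos_inverse:
  fixes x :: "'a::unital_cstar_algebra"
  assumes "cpos x" "x * v = 1" "v * x = 1" shows "cpos v"
proof -
  have "cstar v * x * v = v"
    using inverse_selfadjoint [OF cpos_cstar [OF assms(1)] assms(2,3)] assms(3) by simp
  then show ?thesis using cpos_conj [OF assms(1)] by metis
qed

lemma cpos_one [simp]: "cpos (1::'a::unital_cstar_algebra)"
  using cpos_cstar_mult [of "1::'a"] by simp

lemma cpos_scaleR: "cpos (a::'a::cstar_algebra) \<Longrightarrow> 0 \<le> s \<Longrightarrow> cpos (s *\<^sub>R a)"
  unfolding cpos_def by (metis cstar_scaleR mult_scaleR_left mult_scaleR_right real_sqrt_mult_self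
      abs_of_nonneg scaleR_scaleR)

lemma one_plus_cpos_inverse:
  fixes x :: "'a::unital_cstar_algebra"
  assumes x: "cpos x"
  obtains v where "(1 + x) * v = 1" "v * (1 + x) = 1" "cpos v" "cpos (1 - v)" "norm (1 - v) < 1"
proof -
  obtain t where t: "0 < t" "norm (t *\<^sub>R 1 - x) \<le> t"
    using x spos_bound unfolding cpos_iff_spos by blast
  \<comment> \<open>Chosen so that \<open>1 + x = (1 + t) (1 - y)\<close>, while
    \<open>norm (t *\<^sub>R 1 - x) \<le> t\<close> keeps \<open>norm y\<close> below 1.\<close>
  define y where "y = (1 / (1 + t)) *\<^sub>R (t *\<^sub>R 1 - x)"
  have "norm y \<le> t / (1 + t)" using t by (simp add: y_def divide_right_mono)
  also have "\<dots> < 1" using t by simp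
  finally obtain w where w: "(1 - y) * w = 1" "w * (1 - y) = 1" using neumann_inverse by blast
  have y: "1 + x = (1 + t) *\<^sub>R (1 - y)" 
    using t by (simp add: y_def scaleR_diff_right) (simp add: scaleR_add_left)
  define v where "v = (1 / (1 + t)) *\<^sub>R w"
  have v: "(1 + x) * v = 1" "v * (1 + x) = 1"
    unfolding y v_def using w t by simp_all
  have 1: "cpos (1 + x)" by (intro unital_cpos_add x cpos_one)
  have pv: "cpos v" by (rule cpos_inverse [OF 1 v])
  have "v + x * v = v + v * x" using v by (simp add: algebra_simps)
  then have xv: "x * v = v * x" by simp
  have v1: "1 - v = x * v" using v(1) by (simp add: algebra_simps)
  have pv1: "cpos (1 - v)" unfolding v1 by (rule cpos_mult_commuting [OF x pv xv])
  define N where "N = norm x"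
  have "0 \<le> N" by (simp add: N_def)
  \<comment> \<open>This is the scalar inequality \<open>x / (1 + x) \<le> N / (1 + N)\<close> in
    the algebra. Positivity of \<open>v\<close> alone would give only
    \<open>norm (1 - v) \<le> 1\<close>; the strict bound is needed for membership in the open
    ball.\<close>
  have "cpos ((1 / (1 + N)) *\<^sub>R ((N *\<^sub>R 1 - x) * v))"
    using \<open>0 \<le> N\<close>
    by (intro cpos_scaleR cpos_mult_commuting unital_cpos_le x pv) (auto simp: N_def xv algebra_simps)
  also have "(N *\<^sub>R 1 - x) * v = (1 + N) *\<^sub>R v - 1"
    using v(1) by (simp add: algebra_simps)
  also have "(1 / (1 + N)) *\<^sub>R ((1 + N) *\<^sub>R v - 1) = (N / (1 + N)) *\<^sub>R 1 - (1 - v)"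
  proof -
    have "N / (1 + N) = 1 - 1 / (1 + N)" using \<open>0 \<le> N\<close> by (simp add: field_simps)
    then show ?thesis using \<open>0 \<le> N\<close> by (simp add: scaleR_diff_right scaleR_diff_left)
  qed
  finally have "norm (1 - v) \<le> N / (1 + N)" using \<open>0 \<le> N\<close> pv1 by (intro unital_norm_le) auto
  also have "\<dots> < 1" using \<open>0 \<le> N\<close> by simp
  finally show ?thesis using that v pv pv1 by blast
qed

text \<open>Here \<open>g\<close> is the root of the inverse \<open>v\<close> of \<open>p\<close>,
  and \<open>s\<close> the root of \<open>q\<close>. Conjugating \<open>q \<le> p\<close> by
  \<open>g\<close> gives \<open>norm (s * g) \<le> 1\<close>; passing to the adjoint,
  \<open>s * v * s \<le> 1\<close>; conjugating by \<open>s * w\<close>, which is inverse to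
  \<open>s\<close>, gives \<open>v \<le> w\<close>.\<close>

lemma inverse_antitone:
  fixes p q :: "'a::unital_cstar_algebra"
  assumes p: "cpos p" "p * v = 1" "v * p = 1" and q: "cpos q" "q * w = 1" "w * q = 1"
    and le: "cpos (p - q)"
  shows "cpos (w - v)"
proof -
  have "cpos v" by (rule cpos_inverse [OF p])
  then obtain g where g: "cstar g = g" "g * g = v" "\<And>y. v * y = y * v \<Longrightarrow> g * y = y * g"
    using unital_sqrt by blast
  obtain s where s: "cstar s = s" "s * s = q" "\<And>y. q * y = y * q \<Longrightarrow> s * y = y * s"
    using unital_sqrt [OF q(1)] by blast
  have "g * p = p * g" using p by (intro g(3)) simp
  then have gpg: "cstar g * p * g = 1" using g(1,2) p(2) by (simp add: mult.assoc)
  have gqg: "cstar (s * g) * (s * g) = cstar g * q * g"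
    using s(1,2) by (metis cstar_mult mult.assoc)
  have "norm (cstar (s * g) * (s * g)) \<le> norm (1::'a)"
  proof (rule unital_norm_mono [OF cpos_cstar_mult])
    show "cpos (1 - cstar (s * g) * (s * g))"
      unfolding gqg gpg [symmetric] using cpos_conj [OF le, of g] by (simp add: algebra_simps)
  qed
  then have sg: "norm (s * g) * norm (s * g) \<le> 1" by (simp add: cstar_identity)
  have eq: "cstar (cstar (s * g)) * cstar (s * g) = s * v * s"
    using s(1) g(1,2) by (simp add: cstar_mult) (metis mult.assoc)
  have "norm (s * v * s) \<le> 1" using sg cstar_identity [of "cstar (s * g)"] by (simp only: eq norm_cstar)
  then have "cpos (1 *\<^sub>R 1 - s * v * s)"
    using cpos_cstar_mult [of "cstar (s * g)"] unfolding eq by (intro unital_cpos_le)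
  then have "cpos (cstar (s * w) * (1 - s * v * s) * (s * w))" by (intro cpos_conj) simp
  moreover have "cstar (s * w) = w * s"
    using s(1) inverse_selfadjoint [OF cpos_cstar [OF q(1)] q(2,3)] by (simp add: cstar_mult)
  moreover have "w * s * (1 - s * v * s) * (s * w) = w * (s * s) * w - (w * (s * s)) * v * ((s * s) * w)"
    by (simp add: algebra_simps)
  ultimately show ?thesis using s(2) q by simp
qed

text \<open>A device for tracking scalar parts: \<open>uscal\<close> on the unitization is a
  character, and elements on which it vanishes come from the original algebra.\<close>

definition character :: "('a::unital_cstar_algebra \<Rightarrow> complex) \<Rightarrow> bool" where
  "character \<tau> \<longleftrightarrow> \<tau> 1 = 1 \<and> (\<forall>x y. \<tau> (x + y) = \<tau> x + \<tau> y) \<and> (\<forall>x y. \<tau> (x * y) = \<tau> x * \<tau> y)"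

lemma character_diff: "character \<tau> \<Longrightarrow> \<tau> (x - y) = \<tau> x - \<tau> y"
  unfolding character_def by (metis add_diff_cancel diff_add_cancel)

text \<open>The map \<open>a \<mapsto> a (1 - a)\<^sup>-\<^sup>1\<close> is an order isomorphism from the positive part of the
  open unit ball onto the positive cone, where upper bounds are sums.\<close>

lemma unital_directed:
  fixes a b :: "'a::unital_cstar_algebra"
  assumes a: "cpos a" "norm a < 1" and b: "cpos b" "norm b < 1"
  obtains e where "cpos e" "norm e < 1" "cpos (e - a)" "cpos (e - b)"
    "\<And>\<tau>. character \<tau> \<Longrightarrow> \<tau> a = 0 \<Longrightarrow> \<tau> b = 0 \<Longrightarrow> \<tau> e = 0"
proof -
  have *: "\<exists>u. (1 - c) * u = 1 \<and> u * (1 - c) = 1 \<and> cpos (1 - c) \<and> cpos u \<and> cpos (u - 1)"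
    if c: "cpos c" "norm c < 1" for c :: 'a
  proof -
    obtain u where u: "(1 - c) * u = 1" "u * (1 - c) = 1" using neumann_inverse [OF c(2)] by blast
    have c1: "cpos (1 - c)" using unital_cpos_le [OF c(1), of 1] c by simp
    have pu: "cpos u" by (rule cpos_inverse [OF c1 u])
    have "u - c * u = u - u * c"
      using trans [OF u(1) u(2) [symmetric]]
      by (simp only: left_diff_distrib right_diff_distrib mult_1_left mult_1_right)
    then have "c * u = u * c" by simp
    from cpos_mult_commuting [OF c(1) pu this] have "cpos (c * u)" .
    moreover have "c * u = u - 1" using u(1) by (simp only: left_diff_distrib mult_1_left) (metis diff_diff_eq2 add_diff_cancel_left')
    ultimately have "cpos (u - 1)" by simp
    with u c1 pu show ?thesis by blast
  qed
  obtain u where u: "(1 - a) * u = 1" "u * (1 - a) = 1" "cpos (1 - a)" "cpos u" "cpos (u - 1)"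
    using * [OF a] by blast
  obtain w where w: "(1 - b) * w = 1" "w * (1 - b) = 1" "cpos (1 - b)" "cpos w" "cpos (w - 1)"
    using * [OF b] by blast
  \<comment> \<open>\<open>u - 1\<close> is \<open>a (1 - a)\<^sup>-\<^sup>1\<close>, the image of
    \<open>a\<close>, and \<open>w - 1\<close> that of \<open>b\<close>; the element
    \<open>1 - v\<close> below is the preimage of their sum.\<close>
  define x where "x = (u - 1) + (w - 1)"
  have x: "cpos x" by (simp add: x_def unital_cpos_add u w)
  obtain v where v: "(1 + x) * v = 1" "v * (1 + x) = 1" "cpos v" "cpos (1 - v)" "norm (1 - v) < 1"
    using one_plus_cpos_inverse [OF x] by blast
  have x1: "cpos (1 + x)" by (simp add: unital_cpos_add x)
  have "cpos ((1 - a) - v)"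
    by (rule inverse_antitone [OF x1 v(1,2) u(4,2,1)]) (simp add: x_def w)
  moreover have "cpos ((1 - b) - v)"
    by (rule inverse_antitone [OF x1 v(1,2) w(4,2,1)]) (simp add: x_def u)
  moreover have "\<tau> (1 - v) = 0" if chi: "character \<tau>" "\<tau> a = 0" "\<tau> b = 0" for \<tau>
  proof -
    note ch = chi(1) [unfolded character_def] character_diff [OF chi(1)]
    have "\<tau> u = 1" using arg_cong [OF u(1), of \<tau>] ch chi(2) by simp
    moreover have "\<tau> w = 1" using arg_cong [OF w(1), of \<tau>] ch chi(3) by simp
    ultimately have "\<tau> (1 + x) = 1" using ch by (simp add: x_def)
    then have "\<tau> v = 1" using arg_cong [OF v(1), of \<tau>] ch by simp
    then show ?thesis using ch by simp
  qed
  ultimately show ?thesis using that [of "1 - v"] v by (simp add: algebra_simps)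
qed

text \<open>With \<open>x = c * cstar c\<close> and \<open>v\<close> the inverse of
  \<open>1 + k x\<close>, take \<open>e0 = 1 - v\<close>. For \<open>e \<ge> e0\<close> the element
  \<open>d = 1 - e\<close> satisfies \<open>d\<^sup>2 \<le> d \<le> v\<close>, so the square of
  \<open>norm (d * c)\<close> is at most the norm of \<open>cstar c * v * c\<close>. That is the
  norm of \<open>x * v = (1 - v) / k\<close>, which is less than \<open>1 / k\<close>, the square of
  \<open>\<epsilon>\<close>.\<close>

lemma unital_approx_unit:
  fixes c :: "'a::unital_cstar_algebra"
  assumes "0 < \<epsilon>"
  obtains e0 where "cpos e0" "norm e0 < 1" "\<And>\<tau>. character \<tau> \<Longrightarrow> \<tau> c = 0 \<Longrightarrow> \<tau> e0 = 0"
    "\<And>e. cpos e \<Longrightarrow> norm e \<le> 1 \<Longrightarrow> cpos (e - e0) \<Longrightarrow> norm (c - e * c) < \<epsilon>"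
proof -
  define k where "k = 1 / (\<epsilon> * \<epsilon>)"
  have "0 < k" using assms by (simp add: k_def)
  define x where "x = c * cstar c"
  have x: "cpos x" unfolding x_def using cpos_cstar_mult [of "cstar c"] by simp
  have kx: "cpos (k *\<^sub>R x)" using x \<open>0 < k\<close> by (simp add: cpos_scaleR)
  obtain v where v: "(1 + k *\<^sub>R x) * v = 1" "v * (1 + k *\<^sub>R x) = 1" "cpos v" "cpos (1 - v)" "norm (1 - v) < 1"
    using one_plus_cpos_inverse [OF kx] by blast
  obtain g where g: "cstar g = g" "g * g = v" "\<And>y. v * y = y * v \<Longrightarrow> g * y = y * g"
    using unital_sqrt [OF v(3)] by blast
  have "v + k *\<^sub>R (v * x) = v + k *\<^sub>R (x * v)" using v by (simp add: algebra_simps)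
  then have "v * x = x * v" using \<open>0 < k\<close> by simp
  then have gx: "g * x = x * g" by (rule g(3))
  have cvc: "norm (cstar c * v * c) < \<epsilon> * \<epsilon>"
  proof -
    have "cstar (g * c) * (g * c) = cstar c * v * c"
      using g(1,2) by (metis cstar_mult mult.assoc)
    then have "norm (cstar c * v * c) = norm (cstar (cstar (g * c)) * cstar (g * c))"
      by (metis cstar_identity norm_cstar)
    also have "cstar (cstar (g * c)) * cstar (g * c) = x * v"
      using gx g(1,2) by (simp add: x_def cstar_mult) (metis mult.assoc)
    also have "x * v = (1 / k) *\<^sub>R (1 - v)"
    proof -
      have "k *\<^sub>R (x * v) = 1 - v" using v(1) by (simp add: algebra_simps)
      then show ?thesis using \<open>0 < k\<close> by (metis less_irrefl scaleR_one scaleR_scaleR nonzero_eq_divide_eq)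
    qed
    also have "norm \<dots> < 1 / k" using v(5) \<open>0 < k\<close> by (simp add: divide_simps)
    finally show ?thesis by (simp add: k_def)
  qed
  show ?thesis
  proof (rule that [of "1 - v"])
    fix \<tau> :: "'a \<Rightarrow> complex" assume tau: "character \<tau>" "\<tau> c = 0"
    \<comment> \<open>Compatibility with real scalars is not part of \<open>character\<close>; the
      factor \<open>k\<close> is moved onto \<open>cstar c\<close>, leaving the factor
      \<open>c\<close> on which \<open>\<tau>\<close> vanishes.\<close>
    have "\<tau> (k *\<^sub>R x) = 0"
      using tau unfolding x_def character_def by (metis mult_scaleR_right mult_zero_left)
    then have "\<tau> v = 1"
      using arg_cong [OF v(1), of \<tau>] tau(1) [unfolded character_def] by simp
    then show "\<tau> (1 - v) = 0" using tau(1) by (simp add: character_diff) (simp add: character_def)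
  next
    fix e :: 'a assume e: "cpos e" "norm e \<le> 1" "cpos (e - (1 - v))"
    define d where "d = 1 - e"
    have d: "cpos d" using unital_cpos_le [OF e(1,2)] by (simp add: d_def)
    have "norm d \<le> norm (1::'a)" by (rule unital_norm_mono [OF d]) (simp add: d_def e)
    then have d1: "cpos (1 - d)" using unital_cpos_le [OF d, of 1] by simp
    have dd: "cpos (d - d * d)"
      using cpos_mult_commuting [OF d d1] by (simp add: algebra_simps)
    have "cpos (v - d)" using e(3) by (simp add: d_def algebra_simps)
    from unital_cpos_add [OF this dd] have "cpos (cstar c * (v - d * d) * c)"
      by (intro cpos_conj) simp
    moreover have "cstar c * (v - d * d) * c = cstar c * v * c - cstar (d * c) * (d * c)"
      by (simp add: algebra_simps cstar_mult cpos_cstar [OF d])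
    ultimately have "norm (cstar (d * c) * (d * c)) \<le> norm (cstar c * v * c)"
      by (intro unital_norm_mono cpos_cstar_mult) simp
    with cvc have "norm (d * c) * norm (d * c) < \<epsilon> * \<epsilon>" by (simp add: cstar_identity)
    then have "norm (d * c) < \<epsilon>" using assms
      by (meson mult_mono less_imp_le norm_ge_zero not_le)
    then show "norm (c - e * c) < \<epsilon>" by (simp add: d_def algebra_simps)
  qed (use v in auto)
qed

subsection \<open>The unitization\<close>

lemma cscale_scaleR_left: "cscale (r *\<^sub>R z) b = r *\<^sub>R cscale z (b::'a::cstar_algebra)"
  by (simp add: scaleR_conv_of_real flip: cscale_of_real cscale_assoc)

text \<open>The operator seminorm of \<open>(a, z)\<close> acting on the algebra degenerates when the algebra already
  has a unit; the maximum with \<open>cmod z\<close> is a C*-norm in all cases.\<close>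

datatype 'a unitization = Unitz (upart: 'a) (uscal: complex)

definition uop :: "'a::cstar_algebra unitization \<Rightarrow> 'a \<Rightarrow> 'a" where
  "uop p b = upart p * b + cscale (uscal p) b"

lemma bounded_linear_uop: "bounded_linear (uop p)"
proof -
  have "bounded_linear (\<lambda>b. upart p * b + cscale (uscal p) b)"
    by (intro bounded_linear_add bounded_linear_mult_right bounded_linear_cscale)
  then show ?thesis by (simp add: uop_def [abs_def])
qed

instantiation unitization :: (cstar_algebra) real_normed_algebra_1
begin

definition "0 = Unitz 0 0"
definition "1 = Unitz 0 1"
definition "p + q = Unitz (upart p + upart q) (uscal p + uscal q)"
definition "p - q = Unitz (upart p - upart q) (uscal p - uscal q)"
definition "- p = Unitz (- upart p) (- uscal p)"
definition "p * q = Unitz (upart p * upart q + cscale (uscal p) (upart q) + cscale (uscal q) (upart p))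
  (uscal p * uscal q)"
definition "r *\<^sub>R p = Unitz (r *\<^sub>R upart p) (r *\<^sub>R uscal p)"
definition "norm p = max (onorm (uop p)) (cmod (uscal p))"
definition "sgn (p :: 'a unitization) = inverse (norm p) *\<^sub>R p"
definition "dist p q = norm (p - q :: 'a unitization)"
definition "(uniformity :: ('a unitization \<times> 'a unitization) filter) = (INF e\<in>{0<..}. principal {(x, y). dist x y < e})"
definition "open (U :: 'a unitization set) \<longleftrightarrow> (\<forall>x\<in>U. eventually (\<lambda>(x', y). x' = x \<longrightarrow> y \<in> U) uniformity)"

lemmas unitization_ops = zero_unitization_def one_unitization_def plus_unitization_def
  minus_unitization_def uminus_unitization_def times_unitization_def scaleR_unitization_def

lemma uop_times: "uop (p * q) = uop p \<circ> uop (q :: 'a unitization)"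
  by (auto simp: uop_def unitization_ops algebra_simps cscale_add_right mult_cscale_left
      mult_cscale_right cscale_assoc)

lemma uop_plus: "uop (p + q) = (\<lambda>b. uop p b + uop (q :: 'a unitization) b)"
  by (auto simp: uop_def unitization_ops algebra_simps cscale_add_left)

lemma uop_scaleR: "uop (r *\<^sub>R p) = (\<lambda>b. r *\<^sub>R uop (p :: 'a unitization) b)"
  by (auto simp: uop_def unitization_ops scaleR_add_right cscale_scaleR_left)

lemma onorm_uop_times: "onorm (uop (p * q)) \<le> onorm (uop p) * onorm (uop (q :: 'a unitization))"
  unfolding uop_times by (rule onorm_compose) (rule bounded_linear_uop)+

text \<open>For \<open>p = (a, z)\<close> one has
  \<open>a * cstar a = uop p (cstar a) - z (cstar a)\<close>, and the C*-identity turns this into a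
  bound on \<open>norm a\<close>. It yields definiteness of the norm and, later,
  completeness.\<close>

lemma norm_upart: "norm (upart p) \<le> 2 * norm (p :: 'a unitization)"
proof (cases "upart p = 0")
  case True
  then show ?thesis
    by (simp add: norm_unitization_def onorm_pos_le bounded_linear_uop le_max_iff_disj)
next
  case False
  let ?a = "upart p"
  have "norm ?a * norm ?a = norm (?a * cstar ?a)"
    using cstar_identity [of "cstar ?a"] by simp
  also have "?a * cstar ?a = uop p (cstar ?a) - cscale (uscal p) (cstar ?a)"
    by (simp add: uop_def)
  also have "norm \<dots> \<le> norm (uop p (cstar ?a)) + norm (cscale (uscal p) (cstar ?a))"
    by (rule norm_triangle_ineq4)
  also have "\<dots> \<le> onorm (uop p) * norm ?a + cmod (uscal p) * norm ?a"
    using onorm [OF bounded_linear_uop, of p "cstar ?a"] by (simp add: norm_cscale)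
  also have "\<dots> \<le> (2 * norm p) * norm ?a"
    by (simp add: norm_unitization_def mult_right_mono flip: distrib_right)
  finally show ?thesis using False by simp
qed

lemma norm_uscal: "cmod (uscal p) \<le> norm (p :: 'a unitization)"
  by (simp add: norm_unitization_def)

lemma norm_unitization_le: "norm (p :: 'a unitization) \<le> norm (upart p) + cmod (uscal p)"
proof -
  have "onorm (uop p) \<le> norm (upart p) + cmod (uscal p)"
  proof (rule onorm_bound)
    fix x
    have "norm (uop p x) \<le> norm (upart p) * norm x + cmod (uscal p) * norm x"
      unfolding uop_def
      by (rule order_trans [OF norm_triangle_ineq add_mono]) (simp_all add: norm_mult_ineq norm_cscale)
    then show "norm (uop p x) \<le> (norm (upart p) + cmod (uscal p)) * norm x"
      by (simp add: distrib_right)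
  qed simp
  then show ?thesis by (simp add: norm_unitization_def)
qed

instance
proof
  fix a b c :: "'a unitization" and r s :: real
  show "a + b + c = a + (b + c)" "a + b = b + a" "0 + a = a" "- a + a = 0" "a - b = a + - b"
    "a * b * c = a * (b * c)" "(a + b) * c = a * c + b * c" "a * (b + c) = a * b + a * c"
    "1 * a = a" "a * 1 = a" "(0 :: 'a unitization) \<noteq> 1"
    "r *\<^sub>R (a + b) = r *\<^sub>R a + r *\<^sub>R b" "(r + s) *\<^sub>R a = r *\<^sub>R a + s *\<^sub>R a"
    "r *\<^sub>R s *\<^sub>R a = (r * s) *\<^sub>R a" "1 *\<^sub>R a = a"
    by (simp_all add: unitization_ops algebra_simps cscale_add_right cscale_add_left mult_cscale_left
      mult_cscale_right cscale_assoc)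
  show "r *\<^sub>R a * b = r *\<^sub>R (a * b)" "a * r *\<^sub>R b = r *\<^sub>R (a * b)"
    by (simp_all add: unitization_ops algebra_simps cscale_scaleR cscale_scaleR_left)
  show "dist a b = norm (a - b)" by (rule dist_unitization_def)
  show "sgn a = inverse (norm a) *\<^sub>R a" by (rule sgn_unitization_def)
  show "uniformity = (INF e\<in>{0<..}. principal {(x, y :: 'a unitization). dist x y < e})"
    by (rule uniformity_unitization_def)
  show "open U \<longleftrightarrow> (\<forall>x\<in>U. \<forall>\<^sub>F (x', y) in uniformity. x' = x \<longrightarrow> y \<in> U)" for U :: "'a unitization set"
    by (rule open_unitization_def)
  show "norm a = 0 \<longleftrightarrow> a = 0"
  proof
    assume "norm a = 0"
    then have "upart a = 0" "uscal a = 0" using norm_upart [of a] norm_uscal [of a] by auto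
    then show "a = 0" by (simp add: unitization_ops unitization.expand)
  next
    assume "a = 0"
    then show "norm a = 0" using norm_unitization_le [of a] norm_uscal [of a] by (simp add: unitization_ops)
  qed
  show "norm (a + b) \<le> norm a + norm b"
    using onorm_triangle [OF bounded_linear_uop bounded_linear_uop, of a b] norm_triangle_ineq [of "uscal a" "uscal b"]
    by (simp add: norm_unitization_def flip: uop_plus) (simp add: plus_unitization_def, linarith)
  show "norm (r *\<^sub>R a) = \<bar>r\<bar> * norm a"
    by (simp add: norm_unitization_def uop_scaleR onorm_scaleR bounded_linear_uop)
       (simp add: scaleR_unitization_def max_mult_distrib_left)
  show "norm (a * b) \<le> norm a * norm b"
  proof -
    have "onorm (uop (a * b)) \<le> norm a * norm b"
      by (rule order_trans [OF onorm_uop_times])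
         (auto intro!: mult_mono simp: norm_unitization_def onorm_pos_le bounded_linear_uop le_max_iff_disj)
    moreover have "cmod (uscal (a * b)) \<le> norm a * norm b"
      using mult_mono [OF norm_uscal [of a] norm_uscal [of b]]
      by (simp add: times_unitization_def norm_mult norm_unitization_def le_max_iff_disj)
    ultimately show ?thesis by (simp add: norm_unitization_def)
  qed
  show "norm (1 :: 'a unitization) = 1"
  proof -
    have "uop (1 :: 'a unitization) = (\<lambda>b. b)" by (auto simp: uop_def one_unitization_def)
    then show ?thesis using onorm_id_le [where 'a = 'a]
      by (simp add: norm_unitization_def) (simp add: one_unitization_def max_def)
  qed
qed

end

instantiation unitization :: (cstar_algebra) unital_cstar_algebra
begin

definition "cscale c p = Unitz (cscale c (upart p)) (c * uscal p)"
definition "cstar p = Unitz (cstar (upart p)) (cnj (uscal p))"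

lemmas unitization_star_ops = unitization_ops cscale_unitization_def cstar_unitization_def

lemma uop_cscale: "uop (cscale c p) = (\<lambda>b. cscale c (uop (p :: 'a unitization) b))"
  by (auto simp: uop_def unitization_star_ops cscale_add_right mult_cscale_left cscale_assoc)

text \<open>The link between the operator norm on the unitization and the C*-identity of the
  original algebra.\<close>

lemma cstar_uop: "cstar (uop p b) * uop p b = cstar b * uop (cstar p * p) (b :: 'a)"
  by (simp add: uop_def unitization_star_ops algebra_simps cscale_add_right mult_cscale_left
      mult_cscale_right cscale_assoc cstar_simps cscale_add_left)

lemma onorm_cscale: "onorm (uop (cscale c p)) = cmod c * onorm (uop (p :: 'a unitization))"
proof -
  have le: "onorm (uop (cscale c q)) \<le> cmod c * onorm (uop q)" for c and q :: "'a unitization"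
  proof (rule onorm_bound)
    show "0 \<le> cmod c * onorm (uop q)" by (simp add: onorm_pos_le bounded_linear_uop)
    fix x show "norm (uop (cscale c q) x) \<le> cmod c * onorm (uop q) * norm x"
      using onorm [OF bounded_linear_uop, of q x]
      by (simp add: uop_cscale norm_cscale mult.assoc mult_left_mono)
  qed
  show ?thesis
  proof (cases "c = 0")
    case True
    then show ?thesis using le [of c p] onorm_pos_le [OF bounded_linear_uop, of "cscale c p"] by simp
  next
    case False
    have "cscale (inverse c) (cscale c p) = p"
      using False by (simp add: unitization_star_ops cscale_assoc flip: mult.assoc)
    with le [of "inverse c" "cscale c p"]
    have "onorm (uop p) \<le> inverse (cmod c) * onorm (uop (cscale c p))" by (simp add: norm_inverse)
    then have "cmod c * onorm (uop p) \<le> cmod c * (inverse (cmod c) * onorm (uop (cscale c p)))"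
      by (rule mult_left_mono) simp
    then have "cmod c * onorm (uop p) \<le> onorm (uop (cscale c p))"
      using False by (simp flip: mult.assoc)
    with le [of c p] show ?thesis by simp
  qed
qed

text \<open>By \<open>cstar_uop\<close>, the square of \<open>norm (uop p b)\<close> is at most
  \<open>K\<close> times the square of \<open>norm b\<close>, which is one inequality. It also
  forces \<open>p\<close> and \<open>cstar p\<close> to have equal operator norms, whence the
  other.\<close>

lemma onorm_uop_cstar_mult:
  "onorm (uop (cstar p * p)) = onorm (uop p) * onorm (uop (p :: 'a unitization))"
proof -
  have sq: "onorm (uop p) * onorm (uop p) \<le> onorm (uop (cstar p * p))" for p :: "'a unitization"
  proof -
    define K where "K = onorm (uop (cstar p * p))"
    have K: "0 \<le> K" by (simp add: K_def onorm_pos_le bounded_linear_uop)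
    have "onorm (uop p) \<le> sqrt K"
    proof (rule onorm_bound)
      fix b
      have "norm (uop p b) * norm (uop p b) = norm (cstar b * uop (cstar p * p) b)"
        using cstar_identity [of "uop p b"] by (simp only: cstar_uop)
      also have "\<dots> \<le> norm b * (K * norm b)"
        by (rule order_trans [OF norm_mult_ineq])
           (simp add: K_def mult_left_mono onorm [OF bounded_linear_uop])
      also have "\<dots> = (sqrt K * norm b)\<^sup>2"
        using K by (simp add: power_mult_distrib) (simp add: power2_eq_square)
      finally have "(norm (uop p b))\<^sup>2 \<le> (sqrt K * norm b)\<^sup>2"
        by (simp add: power2_eq_square)
      then show "norm (uop p b) \<le> sqrt K * norm b" by (rule power2_le_imp_le) (simp add: K)
    qed (use K in simp)
    then have "onorm (uop p) * onorm (uop p) \<le> sqrt K * sqrt K"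
      by (intro mult_mono) (simp_all add: onorm_pos_le bounded_linear_uop K)
    then show ?thesis using K by (simp add: K_def)
  qed
  have le: "onorm (uop p) \<le> onorm (uop (cstar p))" for p :: "'a unitization"
  proof (cases "onorm (uop p) = 0")
    case True
    then show ?thesis by (simp add: onorm_pos_le bounded_linear_uop)
  next
    case False
    then have "0 < onorm (uop p)" using onorm_pos_le [OF bounded_linear_uop, of p] by simp
    then show ?thesis
      using order_trans [OF sq [of p] onorm_uop_times [of "cstar p" p]] by (rule mult_right_le_imp_le [rotated])
  qed
  have 1: "onorm (uop (cstar p)) = onorm (uop p)"
    using le [of p] le [of "cstar p"] by (simp add: cstar_unitization_def)
  show "onorm (uop (cstar p * p)) = onorm (uop p) * onorm (uop p)"
    using sq [of p] onorm_uop_times [of "cstar p" p] unfolding 1 by (rule antisym [rotated])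
qed

instance
proof
  fix a b c :: "'a unitization" and r :: real and z w :: complex
  show "cscale (complex_of_real r) a = r *\<^sub>R a"
    "cscale (z + w) a = cscale z a + cscale w a" "cscale z (a + b) = cscale z a + cscale z b"
    "cscale z (cscale w a) = cscale (z * w) a" "cscale z a * b = cscale z (a * b)"
    "a * cscale z b = cscale z (a * b)" "cstar (cstar a) = a" "cstar (a + b) = cstar a + cstar b"
    "cstar (cscale z a) = cscale (cnj z) (cstar a)" "cstar (a * b) = cstar b * cstar a"
    by (simp_all add: unitization_star_ops algebra_simps cscale_add_right cscale_add_left mult_cscale_left
      mult_cscale_right cscale_assoc cstar_simps cscale_of_real scaleR_conv_of_real)
  show "norm (cscale z a) = cmod z * norm a"
    by (simp add: norm_unitization_def onorm_cscale max_mult_distrib_left)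
       (simp add: cscale_unitization_def norm_mult max_mult_distrib_left)
  show "norm (cstar a * a) = norm a * norm a"
  proof -
    have "cmod (uscal (cstar a * a)) = cmod (uscal a) * cmod (uscal a)"
      by (simp add: unitization_star_ops norm_mult)
    moreover have "max (x * x) (y * y) = max x y * max x y" if "0 \<le> x" "0 \<le> y" for x y :: real
      using that mult_mono [of x y x y] mult_mono [of y x y x] by (auto simp: max_def)
    ultimately show ?thesis
      by (simp add: norm_unitization_def onorm_uop_cstar_mult onorm_pos_le bounded_linear_uop)
  qed
next
  fix X :: "nat \<Rightarrow> 'a unitization" assume X: "Cauchy X"
  have "Cauchy (\<lambda>n. upart (X n))"
  proof (rule metric_CauchyI)
    fix e :: real assume "0 < e"
    then obtain N where N: "\<And>m n. N \<le> m \<Longrightarrow> N \<le> n \<Longrightarrow> dist (X m) (X n) < e / 2"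
      using metric_CauchyD [OF X, of "e / 2"] by auto
    have "dist (upart (X m)) (upart (X n)) < e" if "N \<le> m" "N \<le> n" for m n
      using norm_upart [of "X m - X n"] N [OF that]
      by (simp add: dist_unitization_def dist_norm) (simp add: minus_unitization_def)
    then show "\<exists>N. \<forall>m\<ge>N. \<forall>n\<ge>N. dist (upart (X m)) (upart (X n)) < e" by blast
  qed
  then obtain a where a: "(\<lambda>n. upart (X n)) \<longlonglongrightarrow> a" using Cauchy_convergent convergent_def by blast
  have "Cauchy (\<lambda>n. uscal (X n))"
  proof (rule metric_CauchyI)
    fix e :: real assume "0 < e"
    then obtain N where N: "\<And>m n. N \<le> m \<Longrightarrow> N \<le> n \<Longrightarrow> dist (X m) (X n) < e"
      using metric_CauchyD [OF X, of e] by auto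
    have "dist (uscal (X m)) (uscal (X n)) < e" if "N \<le> m" "N \<le> n" for m n
      using norm_uscal [of "X m - X n"] N [OF that]
      by (simp add: dist_unitization_def dist_norm) (simp add: minus_unitization_def)
    then show "\<exists>N. \<forall>m\<ge>N. \<forall>n\<ge>N. dist (uscal (X m)) (uscal (X n)) < e" by blast
  qed
  then obtain z where z: "(\<lambda>n. uscal (X n)) \<longlonglongrightarrow> z" using Cauchy_convergent convergent_def by blast
  have lim: "(\<lambda>n. norm (upart (X n) - a) + cmod (uscal (X n) - z)) \<longlonglongrightarrow> 0"
    using tendsto_add [OF tendsto_norm_zero [OF LIM_zero [OF a]] tendsto_norm_zero [OF LIM_zero [OF z]]] by simp
  have "(\<lambda>n. X n - Unitz a z) \<longlonglongrightarrow> 0"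
  proof (rule tendsto_norm_zero_cancel, rule tendsto_sandwich [OF _ _ tendsto_const lim])
    show "\<forall>\<^sub>F n in sequentially. norm (X n - Unitz a z) \<le> norm (upart (X n) - a) + cmod (uscal (X n) - z)"
      using norm_unitization_le [of "X _ - Unitz a z"] by (simp add: minus_unitization_def)
  qed simp
  then show "convergent X" unfolding convergent_def by (blast intro: LIM_zero_cancel)
qed

end

definition embed :: "'a::cstar_algebra \<Rightarrow> 'a unitization" where
  "embed a = Unitz a 0"

lemma embed_simps:
  "embed (a + b) = embed a + embed b" "embed (a - b) = embed a - embed b"
  "embed (a * b) = embed a * embed b" "embed (r *\<^sub>R a) = r *\<^sub>R embed a"
  "embed (cstar a) = cstar (embed a)"
  by (simp_all add: embed_def unitization_star_ops)

lemma uscal_embed [simp]: "uscal (embed a) = 0"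
  by (simp add: embed_def)

lemma embed_inject [simp]: "embed a = embed b \<longleftrightarrow> a = b"
  by (simp add: embed_def)

lemma embed_upart: "uscal p = 0 \<Longrightarrow> embed (upart p) = p"
  by (cases p) (simp add: embed_def)

lemma uscal_mult: "uscal (p * q) = uscal p * uscal q"
  by (simp add: times_unitization_def)

lemma character_uscal: "character uscal"
  by (simp add: character_def unitization_star_ops)

text \<open>Multiplication by \<open>a\<close> attains the norm of \<open>a\<close> at
  \<open>cstar a\<close>, by the C*-identity.\<close>

lemma norm_embed [simp]: "norm (embed a) = norm a"
proof -
  have uop: "uop (embed a) = (\<lambda>b. a * b)" by (auto simp: uop_def embed_def)
  have "onorm (\<lambda>b. a * b) \<le> norm a" by (rule onorm_bound) (auto simp: norm_mult_ineq)
  moreover have "norm a \<le> onorm (\<lambda>b. a * b)"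
  proof (cases "a = 0")
    case False
    have "norm a * norm a = norm (a * cstar a)" using cstar_identity [of "cstar a"] by simp
    also have "\<dots> \<le> onorm (\<lambda>b. a * b) * norm (cstar a)" by (rule onorm [OF bounded_linear_mult_right])
    finally show ?thesis using False by simp
  qed (simp add: onorm_zero)
  ultimately have "onorm (uop (embed a)) = norm a" unfolding uop by (rule antisym)
  then show ?thesis by (simp add: norm_unitization_def)
qed

text \<open>A root of an embedded element has a scalar part whose square is 0, hence is itself
  embedded.\<close>

lemma cpos_embed [simp]: "cpos (embed a) \<longleftrightarrow> cpos a"
proof
  assume "cpos (embed a)"
  then obtain r where r: "cstar r = r" "r * r = embed a" using unital_sqrt by blast
  have "uscal (r * r) = uscal r * uscal r" by (rule uscal_mult)
  then have "uscal r = 0" by (simp add: r(2))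
  then have "r = embed (upart r)" by (simp add: embed_upart)
  with r have "embed a = embed (cstar (upart r) * upart r)" by (metis embed_simps(3,5))
  then show "cpos a" by (simp add: cpos_cstar_mult)
next
  assume "cpos a" then show "cpos (embed a)" by (auto simp: cpos_def embed_simps)
qed

subsection \<open>Positivity and approximate units\<close>

context
  fixes a b :: "'a::cstar_algebra"
begin

lemma cpos_add: "cpos a \<Longrightarrow> cpos b \<Longrightarrow> cpos (a + b)"
  using unital_cpos_add [of "embed a" "embed b"] by (simp flip: embed_simps)

lemma norm_mono: "cpos a \<Longrightarrow> cpos (b - a) \<Longrightarrow> norm a \<le> norm b"
  using unital_norm_mono [of "embed a" "embed b"] by (simp flip: embed_simps)

lemma cpos_diff_square:
  assumes "cpos a" "norm a \<le> 1" shows "cpos (a - a * a)"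
proof -
  have "cpos (1 *\<^sub>R 1 - embed a)" by (rule unital_cpos_le) (use assms in auto)
  then have "cpos (embed a * (1 - embed a))"
    using assms by (intro cpos_mult_commuting) (auto simp: algebra_simps)
  then have "cpos (embed (a - a * a))" by (simp add: embed_simps algebra_simps)
  then show ?thesis by simp
qed

text \<open>\<open>t - a\<close> lives only in the unitization, but its compression by
  \<open>b\<close> lies in the algebra.\<close>

lemma cpos_conj_le:
  assumes "cpos a" "norm a \<le> t" shows "cpos (t *\<^sub>R (cstar b * b) - cstar b * a * b)"
proof -
  have "cpos (cstar (embed b) * (t *\<^sub>R 1 - embed a) * embed b)"
    using assms by (intro cpos_conj unital_cpos_le) auto
  also have "cstar (embed b) * (t *\<^sub>R 1 - embed a) * embed b = embed (t *\<^sub>R (cstar b * b) - cstar b * a * b)"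
    by (simp add: embed_simps algebra_simps)
  finally show ?thesis by simp
qed

text \<open>The binomial series rewritten without a unit: powers of \<open>1 - a / t\<close> acting
  on \<open>c\<close> become iterates of a map that involves \<open>a\<close> only through left
  multiplication. In this form the series passes to strict limits.\<close>

lemma cpos_sqrt_sums:
  assumes a: "cpos a" and t: "norm a \<le> t" "0 < t"
  obtains r where "cstar r = r" "r * r = a"
    "\<And>c. (\<lambda>k. sqrt t *\<^sub>R sqrt_coeff k *\<^sub>R ((\<lambda>c. c - (1 / t) *\<^sub>R (a * c)) ^^ k) c) sums (r * c)"
proof -
  let ?s = "scaled_sqrt t (embed a)"
  define z where "z = 1 - (1 / t) *\<^sub>R embed a"
  have bd: "norm (t *\<^sub>R 1 - embed a) \<le> t"
    using a t spos_norm_diff [of "embed a" t] by (simp flip: cpos_iff_spos)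
  have z: "norm z \<le> 1" unfolding z_def by (rule scaled_sqrt_arg [OF t(2) bd])
  have s: "cstar ?s = ?s" "?s * ?s = embed a"
    using scaled_sqrt_spos(2) [OF t(2) bd] scaled_sqrt_square [OF t(2) bd] cpos_cstar [OF a]
    by (auto simp flip: embed_simps)
  have "uscal (?s * ?s) = uscal ?s * uscal ?s" by (rule uscal_mult)
  then have "uscal ?s = 0" by (simp add: s(2))
  then obtain r where r: "?s = embed r" by (metis embed_upart)
  have zk: "z ^ k * embed c = embed (((\<lambda>c. c - (1 / t) *\<^sub>R (a * c)) ^^ k) c)" for k c
    by (induction k) (simp_all add: mult.assoc, simp add: z_def embed_simps algebra_simps)
  have "(\<lambda>k. sqrt t *\<^sub>R sqrt_coeff k *\<^sub>R ((\<lambda>c. c - (1 / t) *\<^sub>R (a * c)) ^^ k) c) sums (r * c)" for c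
  proof -
    have "(\<lambda>k. sqrt t *\<^sub>R (sqrt_coeff k *\<^sub>R z ^ k * embed c)) sums (sqrt t *\<^sub>R (bsqrt z * embed c))"
      unfolding bsqrt_def by (intro sums_scaleR_right sums_mult2 summable_sums bsqrt_summable z)
    then have "(\<lambda>k. embed (sqrt t *\<^sub>R sqrt_coeff k *\<^sub>R ((\<lambda>c. c - (1 / t) *\<^sub>R (a * c)) ^^ k) c)) sums embed (r * c)"
      by (simp add: zk embed_simps flip: r) (simp add: scaled_sqrt_def z_def)
    then have "(\<lambda>n. embed ((\<Sum>k<n. sqrt t *\<^sub>R sqrt_coeff k *\<^sub>R ((\<lambda>c. c - (1 / t) *\<^sub>R (a * c)) ^^ k) c))) \<longlonglongrightarrow> embed (r * c)"
    proof -
      have "embed (\<Sum>k<n. g k) = (\<Sum>k<n. embed (g k))" for g :: "nat \<Rightarrow> 'a" and n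
        by (induction n) (simp_all add: embed_simps, simp add: embed_def zero_unitization_def)
      with \<open>_ sums embed (r * c)\<close> show ?thesis by (simp add: sums_def)
    qed
    then show ?thesis
      unfolding sums_def tendsto_iff dist_norm by (simp flip: embed_simps)
  qed
  moreover have "cstar r = r" "r * r = a"
    using s by (simp_all add: r flip: embed_simps)
  ultimately show ?thesis using that by blast
qed

end

lemma cpos_closed:
  fixes X :: "nat \<Rightarrow> 'a::cstar_algebra"
  assumes "X \<longlonglongrightarrow> l" "\<And>n. cpos (X n)" shows "cpos l"
proof -
  have "(\<lambda>n. embed (X n)) \<longlonglongrightarrow> embed l"
    using assms(1) by (simp add: tendsto_iff dist_norm flip: embed_simps)
  then have "cpos (embed l)" by (rule unital_cpos_closed) (simp add: assms)
  then show ?thesis by simp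
qed

lemma cle_trans: "cle a b \<Longrightarrow> cle b c \<Longrightarrow> cle a c"
  unfolding cle_def using cpos_add [of "b - a" "c - b"] by simp

lemma cle_refl [simp]: "cle a a"
  by (simp add: cle_def)

text \<open>The upper bound found in the unitization is embedded, because \<open>uscal\<close> is a
  character that vanishes on both given elements.\<close>

lemma approx_unit_directed:
  assumes "e1 \<in> approx_unit" "e2 \<in> approx_unit"
  obtains e where "e \<in> approx_unit" "cle e1 e" "cle e2 e"
proof -
  from assms obtain e where e: "cpos e" "norm e < 1" "cpos (e - embed e1)" "cpos (e - embed e2)"
    "\<And>\<tau>. character \<tau> \<Longrightarrow> \<tau> (embed e1) = 0 \<Longrightarrow> \<tau> (embed e2) = 0 \<Longrightarrow> \<tau> e = 0"
    by (auto simp: approx_unit_def intro: unital_directed [of "embed e1" "embed e2"])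
  have "uscal e = 0" by (rule e(5)) (simp_all add: character_uscal)
  then obtain e' where "e = embed e'" by (metis embed_upart)
  with e that [of e'] show ?thesis by (simp add: approx_unit_def cle_def flip: embed_simps)
qed

lemma approx_unit_left:
  fixes c :: "'a::cstar_algebra"
  assumes "0 < \<epsilon>"
  obtains e0 where "e0 \<in> approx_unit"
    "\<And>e. e \<in> approx_unit \<Longrightarrow> cle e0 e \<Longrightarrow> norm (c - e * c) < \<epsilon>"
proof -
  obtain e0 where e0: "cpos e0" "norm e0 < 1" "\<And>\<tau>. character \<tau> \<Longrightarrow> \<tau> (embed c) = 0 \<Longrightarrow> \<tau> e0 = 0"
    "\<And>e. cpos e \<Longrightarrow> norm e \<le> 1 \<Longrightarrow> cpos (e - e0) \<Longrightarrow> norm (embed c - e * embed c) < \<epsilon>"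
    using unital_approx_unit [OF assms, of "embed c"] by blast
  have "uscal e0 = 0" by (rule e0(3)) (simp_all add: character_uscal)
  then obtain e' where e': "e0 = embed e'" by (metis embed_upart)
  show ?thesis
  proof (rule that [of e'])
    show "e' \<in> approx_unit" using e0 by (simp add: e' approx_unit_def)
    fix e assume "e \<in> approx_unit" "cle e' e"
    then show "norm (c - e * c) < \<epsilon>"
      using e0(4) [of "embed e"] by (simp add: e' approx_unit_def cle_def flip: embed_simps)
  qed
qed

lemma approx_unit_right:
  fixes c :: "'a::cstar_algebra"
  assumes "0 < \<epsilon>"
  obtains e0 where "e0 \<in> approx_unit"
    "\<And>e. e \<in> approx_unit \<Longrightarrow> cle e0 e \<Longrightarrow> norm (c - c * e) < \<epsilon>"
proof -
  obtain e0 where e0: "e0 \<in> approx_unit"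
    "\<And>e. e \<in> approx_unit \<Longrightarrow> cle e0 e \<Longrightarrow> norm (cstar c - e * cstar c) < \<epsilon>"
    using approx_unit_left [OF assms, of "cstar c"] by blast
  have "norm (cstar c - e * cstar c) = norm (c - c * e)" if "e \<in> approx_unit" for e
  proof -
    have "cstar c - e * cstar c = cstar (c - c * e)"
      using that by (simp add: cstar_diff cstar_mult approx_unit_def cpos_cstar)
    then show ?thesis by simp
  qed
  with e0 that show ?thesis by metis
qed

subsection \<open>The Hahn--Banach theorem and positive functionals\<close>

text \<open>Homogeneity is required only as an inequality, since that form is inherited by infima;
  equality follows in \<open>sublinear_scaleR\<close>.\<close>

definition sublinear :: "('v::real_vector \<Rightarrow> real) \<Rightarrow> bool" where
  "sublinear q \<longleftrightarrow> (\<forall>x y. q (x + y) \<le> q x + q y) \<and> (\<forall>r\<ge>0. \<forall>x. q (r *\<^sub>R x) \<le> r * q x)"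

lemma sublinear_add: "sublinear q \<Longrightarrow> q (x + y) \<le> q x + q y"
  and sublinear_scaleR_le: "sublinear q \<Longrightarrow> 0 \<le> r \<Longrightarrow> q (r *\<^sub>R x) \<le> r * q x"
  by (auto simp: sublinear_def)

lemma sublinear_zero: "sublinear q \<Longrightarrow> q 0 = 0"
  using sublinear_add [of q 0 0] sublinear_scaleR_le [of q 0 0] by simp

lemma sublinear_scaleR:
  assumes "sublinear q" "0 \<le> r" shows "q (r *\<^sub>R x) = r * q x"
proof (cases "r = 0")
  case False
  have "q (inverse r *\<^sub>R r *\<^sub>R x) \<le> inverse r * q (r *\<^sub>R x)"
    using assms by (intro sublinear_scaleR_le) auto
  then have "q x \<le> inverse r * q (r *\<^sub>R x)" using False by simp
  then have "r * q x \<le> r * (inverse r * q (r *\<^sub>R x))" using assms(2) by (rule mult_left_mono)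
  also have "\<dots> = q (r *\<^sub>R x)" using False by (simp flip: mult.assoc)
  finally show ?thesis using sublinear_scaleR_le [OF assms, of x] by simp
qed (simp add: sublinear_zero assms)

lemma sublinear_lower: "sublinear q \<Longrightarrow> - q (- x) \<le> q x"
  using sublinear_add [of q x "- x"] sublinear_zero [of q] by simp

text \<open>Serves three infima: over a chain, over the shifts that make a minimal functional
  linear, and over a convex set to be separated from zero. The index \<open>k\<close> may depend on
  the points, and \<open>B\<close> keeps the infimum finite.\<close>

lemma sublinear_infimum:
  fixes p :: "'i \<Rightarrow> 'v::real_vector \<Rightarrow> real"
  assumes ne: "I \<noteq> {}" and bd: "\<And>i x. i \<in> I \<Longrightarrow> B x \<le> p i x"
    and add: "\<And>i j x y. i \<in> I \<Longrightarrow> j \<in> I \<Longrightarrow> \<exists>k\<in>I. p k (x + y) \<le> p i x + p j y"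
    and scale: "\<And>i r x. i \<in> I \<Longrightarrow> 0 \<le> r \<Longrightarrow> \<exists>k\<in>I. p k (r *\<^sub>R x) \<le> r * p i x"
  shows "sublinear (\<lambda>x. INF i\<in>I. p i x)"
proof -
  have bdd: "bdd_below ((\<lambda>i. p i x) ` I)" for x using bd by (auto simp: bdd_below_def)
  have low: "(INF i\<in>I. p i x) \<le> p i x" if "i \<in> I" for i x by (rule cINF_lower [OF bdd that])
  have "(INF i\<in>I. p i (x + y)) \<le> (INF i\<in>I. p i x) + (INF i\<in>I. p i y)" for x y
  proof -
    have 1: "(INF i\<in>I. p i (x + y)) \<le> p i x + p j y" if "i \<in> I" "j \<in> I" for i j
      using add [OF that, of x y] low by (meson order_trans)
    have "(INF i\<in>I. p i (x + y)) - p i x \<le> (INF i\<in>I. p i y)" if "i \<in> I" for i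
    proof (rule cINF_greatest [OF ne])
      fix j assume "j \<in> I"
      from 1 [OF that this] show "(INF i\<in>I. p i (x + y)) - p i x \<le> p j y" by simp
    qed
    then have "(INF i\<in>I. p i (x + y)) - (INF i\<in>I. p i y) \<le> (INF i\<in>I. p i x)"
      by (intro cINF_greatest [OF ne]) (auto simp: algebra_simps)
    then show ?thesis by simp
  qed
  moreover have "(INF i\<in>I. p i (r *\<^sub>R x)) \<le> r * (INF i\<in>I. p i x)" if "0 \<le> r" for r x
  proof -
    have 1: "(INF i\<in>I. p i (r *\<^sub>R x)) \<le> r * p i x" if "i \<in> I" for i
      using scale [OF that \<open>0 \<le> r\<close>, of x] low by (meson order_trans)
    show ?thesis
    proof (cases "r = 0")
      case True
      then show ?thesis using 1 ne by force
    next
      case False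
      then have "(INF i\<in>I. p i (r *\<^sub>R x)) / r \<le> (INF i\<in>I. p i x)"
        using that 1 by (intro cINF_greatest [OF ne]) (auto simp: field_simps)
      then show ?thesis using that False by (simp add: field_simps)
    qed
  qed
  ultimately show ?thesis by (simp add: sublinear_def)
qed

text \<open>A minimal sublinear functional \<open>p\<close> is linear: it agrees with
  \<open>x \<mapsto> inf {p (x + t y) - t p y | t \<ge> 0}\<close>.\<close>

theorem hahn_banach_dominated:
  fixes q :: "'v::real_vector \<Rightarrow> real"
  assumes q: "sublinear q"
  obtains \<phi> where "linear \<phi>" "\<And>x. \<phi> x \<le> q x"
proof -
  define S where "S = {s. sublinear s \<and> (\<forall>x. s x \<le> q x)}"
  \<comment> \<open>The reversed pointwise order, so that a maximal element is a minimal sublinear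
    functional.\<close>
  define P :: "('v \<Rightarrow> real) \<Rightarrow> ('v \<Rightarrow> real) \<Rightarrow> bool" where "P = (\<lambda>s t. \<forall>x. t x \<le> s x)"
  have "\<exists>m\<in>S. \<forall>s\<in>S. P m s \<longrightarrow> s = m"
  proof (rule predicate_Zorn)
    show "partial_order_on S (relation_of P S)"
      by (rule partial_order_on_relation_ofI) (auto simp: P_def fun_eq_iff intro: order_trans antisym)
    fix C assume C: "C \<in> Chains (relation_of P S)"
    then have CS: "C \<subseteq> S" by (auto simp: Chains_def relation_of_def)
    show "\<exists>u\<in>S. \<forall>a\<in>C. P a u"
    proof (cases "C = {}")
      case True
      then show ?thesis using q by (auto simp: S_def)
    next
      case False
      \<comment> \<open>A lower bound in terms of \<open>q\<close> alone, so the infimum over the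
        chain is finite.\<close>
      have low: "- q (- x) \<le> s x" if "s \<in> C" for s x
      proof -
        have "sublinear s" "s (- x) \<le> q (- x)" using that CS by (auto simp: S_def)
        then show ?thesis using sublinear_lower [of s x] by linarith
      qed
      have min: "\<exists>w\<in>C. w (x + y) \<le> s x + t y" if "s \<in> C" "t \<in> C" for s t x y
      proof -
        have "P s t \<or> P t s" using C that by (auto simp: Chains_def relation_of_def)
        moreover have "s (x + y) \<le> s x + s y" "t (x + y) \<le> t x + t y"
          using that CS by (auto simp: S_def sublinear_def)
        ultimately show ?thesis using that unfolding P_def by (meson add_left_mono add_right_mono order_trans)
      qed
      have sub: "sublinear (\<lambda>x. INF s\<in>C. s x)"
      proof (rule sublinear_infimum [OF False, of "\<lambda>x. - q (- x)"])
        fix s x and r :: real assume "s \<in> C" "0 \<le> r"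
        then have "s (r *\<^sub>R x) \<le> r * s x" using CS by (auto simp: S_def intro: sublinear_scaleR_le)
        with \<open>s \<in> C\<close> show "\<exists>k\<in>C. k (r *\<^sub>R x) \<le> r * s x" by blast
      qed (use low min in auto)
      have le: "(INF s\<in>C. s x) \<le> s x" if "s \<in> C" for s x
        using low that by (intro cINF_lower) (auto simp: bdd_below_def)
      obtain s0 where "s0 \<in> C" using False by blast
      then have "s0 x \<le> q x" for x using CS by (auto simp: S_def)
      then have "(INF s\<in>C. s x) \<le> q x" for x
        using le [OF \<open>s0 \<in> C\<close>, of x] order_trans by blast
      with sub le show ?thesis
        by (intro bexI [of _ "\<lambda>x. INF s\<in>C. s x"]) (auto simp: S_def P_def)
    qed
  qed
  then obtain m where mS: "m \<in> S" and minS: "\<And>s. s \<in> S \<Longrightarrow> P m s \<Longrightarrow> s = m" by blast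
  then have m: "sublinear m" "\<And>x. m x \<le> q x" by (auto simp: S_def)
  have min: "s = m" if "sublinear s" "\<And>x. s x \<le> m x" for s
  proof (rule minS)
    show "s \<in> S" using that m(2) by (auto simp: S_def intro: order_trans)
  qed (use that in \<open>simp add: P_def\<close>)
  have super: "m x + m y \<le> m (x + y)" for x y
  proof -
    define p where "p t z = m (z + t *\<^sub>R y) - t * m y" for t z
    have low: "- m (- z) \<le> p t z" if "t \<in> {0..}" for t z
      using sublinear_add [OF m(1), of "z + t *\<^sub>R y" "- z"] sublinear_scaleR [OF m(1), of t y] that
      by (simp add: p_def)
    have "sublinear (\<lambda>z. INF t\<in>{0..}. p t z)"
    proof (rule sublinear_infimum [OF _ low])
      fix t s :: real and z w assume ts: "t \<in> {0..}" "s \<in> {0..}"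
      have "p (t + s) (z + w) \<le> p t z + p s w"
        using sublinear_add [OF m(1), of "z + t *\<^sub>R y" "w + s *\<^sub>R y"]
        by (simp add: p_def algebra_simps)
      then show "\<exists>k\<in>{0..}. p k (z + w) \<le> p t z + p s w"
        using ts by (intro bexI [of _ "t + s"]) auto
    next
      fix t r :: real and z assume tr: "t \<in> {0..}" "0 \<le> r"
      have "p (r * t) (r *\<^sub>R z) = r * p t z"
        using sublinear_scaleR [OF m(1) tr(2), of "z + t *\<^sub>R y"]
        by (simp add: p_def algebra_simps)
      then show "\<exists>k\<in>{0..}. p k (r *\<^sub>R z) \<le> r * p t z"
        using tr by (intro bexI [of _ "r * t"]) auto
    qed auto
    moreover have le: "(INF t\<in>{0..}. p t z) \<le> p t z" if "0 \<le> t" for t z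
      using low that by (intro cINF_lower) (auto simp: bdd_below_def)
    moreover have "p 0 z = m z" for z by (simp add: p_def)
    \<comment> \<open>The value \<open>t = 0\<close> puts the infimum below \<open>m\<close>,
      minimality makes them equal, and \<open>t = 1\<close> then gives superadditivity.\<close>
    ultimately have "(\<lambda>z. INF t\<in>{0..}. p t z) = m" by (intro min) (metis order_refl)+
    then have "m x \<le> p 1 x" using le [of 1 x] by (metis zero_le_one)
    then show ?thesis by (simp add: p_def)
  qed
  have add: "m (x + y) = m x + m y" for x y
    using super [of x y] sublinear_add [OF m(1), of x y] by simp
  have neg: "m (- x) = - m x" for x using add [of x "- x"] sublinear_zero [OF m(1)] by simp
  have "linear m"
  proof (rule linearI)
    fix r x show "m (r *\<^sub>R x) = r *\<^sub>R m x"
      using sublinear_scaleR [OF m(1), of r x] sublinear_scaleR [OF m(1), of "- r" x] neg [of "r *\<^sub>R x"]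
      by (cases "0 \<le> r") auto
  qed (rule add)
  with m(2) that show ?thesis by blast
qed

text \<open>The infimum of \<open>norm (x + t *\<^sub>R c) - t * \<epsilon>\<close> over
  \<open>t \<ge> 0\<close> and \<open>c \<in> C\<close> is sublinear, at most \<open>norm x\<close>,
  and at most \<open>- \<epsilon>\<close> at each \<open>- c\<close>. Every linear functional below
  it separates.\<close>

lemma separate_convex_from_zero:
  fixes C :: "'v::real_normed_vector set"
  assumes C: "convex C" "C \<noteq> {}" "\<And>c. c \<in> C \<Longrightarrow> \<epsilon> \<le> norm c"
  obtains \<phi> where "linear \<phi>" "\<And>x. \<phi> x \<le> norm x" "\<And>c. c \<in> C \<Longrightarrow> \<epsilon> \<le> \<phi> c"
proof -
  define p :: "real \<times> 'v \<Rightarrow> 'v \<Rightarrow> real"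
    where "p = (\<lambda>(t, c) x. norm (x + t *\<^sub>R c) - t * \<epsilon>)"
  let ?I = "{0::real..} \<times> C"
  let ?q = "\<lambda>x. INF i\<in>?I. p i x"
  have low: "- norm x \<le> p i x" if iI: "i \<in> ?I" for i x
  proof -
    obtain t c where i: "i = (t, c)" "0 \<le> t" "c \<in> C" using iI by (cases i) auto
    have "t * \<epsilon> \<le> norm (t *\<^sub>R c)" using i C(3) by (simp add: mult_left_mono)
    also have "\<dots> \<le> norm (x + t *\<^sub>R c) + norm x"
      using norm_triangle_ineq4 [of "x + t *\<^sub>R c" x] by simp
    finally show ?thesis by (simp add: p_def i)
  qed
  have sub: "sublinear ?q"
  proof (rule sublinear_infimum [OF _ low])
    fix i j x y assume "i \<in> ?I" "j \<in> ?I"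
    then obtain t c s d where i: "i = (t, c)" "0 \<le> t" "c \<in> C" and j: "j = (s, d)" "0 \<le> s" "d \<in> C" by (cases i, cases j) auto
    have "\<exists>e\<in>C. (t + s) *\<^sub>R e = t *\<^sub>R c + s *\<^sub>R d"
    proof (cases "t + s = 0")
      case True
      then have "t = 0" "s = 0" using i j by linarith+
      then show ?thesis using i(3) by auto
    next
      case False
      then have "(t / (t + s)) *\<^sub>R c + (s / (t + s)) *\<^sub>R d \<in> C"
        using C(1) i j by (intro convexD) (auto simp flip: add_divide_distrib)
      with False show ?thesis by (intro bexI) (auto simp: scaleR_add_right)
    qed
    then obtain e where e: "e \<in> C" "(t + s) *\<^sub>R e = t *\<^sub>R c + s *\<^sub>R d" by blast
    have "(x + y) + (t + s) *\<^sub>R e = (x + t *\<^sub>R c) + (y + s *\<^sub>R d)"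
      by (simp only: e(2)) (simp add: algebra_simps)
    then have "norm ((x + y) + (t + s) *\<^sub>R e) \<le> norm (x + t *\<^sub>R c) + norm (y + s *\<^sub>R d)"
      by (simp only: norm_triangle_ineq)
    then have "p (t + s, e) (x + y) \<le> p i x + p j y"
      by (simp add: p_def i j distrib_right)
    with e i j show "\<exists>k\<in>?I. p k (x + y) \<le> p i x + p j y" by (intro bexI [of _ "(t + s, e)"]) auto
  next
    fix i x and r :: real assume "i \<in> ?I" "0 \<le> r"
    then obtain t c where i: "i = (t, c)" "0 \<le> t" "c \<in> C" by (cases i) auto
    have "norm (r *\<^sub>R x + (r * t) *\<^sub>R c) = r * norm (x + t *\<^sub>R c)"
      using \<open>0 \<le> r\<close> norm_scaleR [of r "x + t *\<^sub>R c"] by (simp add: scaleR_add_right)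
    then have "p (r * t, c) (r *\<^sub>R x) = r * p i x"
      by (simp add: p_def i algebra_simps)
    with i \<open>0 \<le> r\<close> show "\<exists>k\<in>?I. p k (r *\<^sub>R x) \<le> r * p i x" by (intro bexI [of _ "(r * t, c)"]) auto
  next
    show "?I \<noteq> {}" using C(2) by auto
  qed
  obtain \<phi> where phi: "linear \<phi>" "\<And>x. \<phi> x \<le> ?q x" using hahn_banach_dominated [OF sub] by blast
  have le: "\<phi> x \<le> norm (x + t *\<^sub>R c) - t * \<epsilon>" if "0 \<le> t" "c \<in> C" for x t c
  proof -
    have "?q x \<le> p (t, c) x" using low that by (intro cINF_lower) (auto simp: bdd_below_def)
    then show ?thesis using phi(2) [of x] by (simp add: p_def)
  qed
  show ?thesis
  proof (rule that [OF phi(1)])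
    show "\<phi> x \<le> norm x" for x using le [of 0 _ x] C(2) by auto
    show "\<epsilon> \<le> \<phi> c" if "c \<in> C" for c
      using le [of 1 c "- c"] that linear_neg [OF phi(1), of c] by simp
  qed
qed

section \<open>Complex and positive functionals from real ones\<close>

text \<open>The constant 2 is the crude sum of the bounds for the real and the imaginary
  part.\<close>

lemma complexify_functional:
  fixes \<phi> :: "'a::cstar_algebra \<Rightarrow> real"
  assumes lin: "linear \<phi>" and bd: "\<And>x. \<phi> x \<le> norm x"
  defines "\<omega> \<equiv> \<lambda>x. Complex (\<phi> x) (- \<phi> (cscale \<i> x))"
  shows "bounded_functional \<omega>" "cmod (\<omega> x) \<le> 2 * norm x"
proof -
  have bd': "cmod (\<omega> x) \<le> 2 * norm x" for x
  proof -
    have abs: "\<bar>\<phi> x\<bar> \<le> norm x" for x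
      using bd [of x] bd [of "- x"] by (simp add: linear_neg [OF lin] abs_if)
    have "cmod (\<omega> x) \<le> \<bar>\<phi> x\<bar> + \<bar>\<phi> (cscale \<i> x)\<bar>"
      using cmod_le [of "\<omega> x"] by (simp add: \<omega>_def)
    then show ?thesis using abs [of x] abs [of "cscale \<i> x"] by (simp add: norm_cscale)
  qed
  then show "cmod (\<omega> x) \<le> 2 * norm x" .
  have "\<omega> (cscale c x) = c * \<omega> x" for c x
  proof -
    have c: "cscale d x = Re d *\<^sub>R x + Im d *\<^sub>R cscale \<i> x" for d x
    proof -
      have "d = complex_of_real (Re d) + complex_of_real (Im d) * \<i>" by (simp add: complex_eq_iff)
      then show ?thesis by (metis cscale_add_left cscale_assoc cscale_of_real)
    qed
    have "cscale \<i> (cscale c x) = Re c *\<^sub>R cscale \<i> x - Im c *\<^sub>R x"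
      by (subst c) (simp add: cscale_add_right cscale_scaleR cscale_assoc cscale_minus_left)
    then show ?thesis
      by (simp add: \<omega>_def c [of c x] linear_add [OF lin] linear_diff [OF lin] linear_scale [OF lin] complex_eq_iff)
  qed
  moreover have "\<omega> (x + y) = \<omega> x + \<omega> y" for x y
    by (simp add: \<omega>_def cscale_add_right linear_add [OF lin] complex_eq_iff)
  ultimately show "bounded_functional \<omega>" unfolding bounded_functional_def using bd' by blast
qed

lemma norming_functional:
  fixes x :: "'a::cstar_algebra"
  obtains \<omega> where "bounded_functional \<omega>" "\<And>y. cmod (\<omega> y) \<le> 2 * norm y" "norm x \<le> cmod (\<omega> x)"
proof -
  obtain \<phi> where phi: "linear \<phi>" "\<And>y. \<phi> y \<le> norm y" "norm x \<le> \<phi> x"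
    using separate_convex_from_zero [of "{x}" "norm x"] by auto
  let ?w = "\<lambda>x. Complex (\<phi> x) (- \<phi> (cscale \<i> x))"
  have "\<phi> x \<le> cmod (?w x)" using abs_Re_le_cmod [of "?w x"] by simp
  with phi that [of ?w] complexify_functional [OF phi(1,2)] show ?thesis by simp
qed

lemma bounded_functional_eqI:
  assumes "\<And>\<phi>. bounded_functional \<phi> \<Longrightarrow> \<phi> x = \<phi> y" shows "x = y"
proof -
  obtain \<omega> where w: "bounded_functional \<omega>" "norm (x - y) \<le> cmod (\<omega> (x - y))"
    using norming_functional by blast
  have "\<omega> (x - y) + \<omega> y = \<omega> x" using w(1) unfolding bounded_functional_def by (metis diff_add_cancel)
  then show ?thesis using assms [OF w(1)] w(2) by simp
qed

text \<open>Complexifying \<open>\<phi>\<close> directly need not give real values on self-adjoint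
  elements. Averaging over \<open>x\<close> and \<open>cstar x\<close> first annihilates
  \<open>i x\<close> for self-adjoint \<open>x\<close> and keeps \<open>\<phi> x\<close>.\<close>

lemma positive_functional_from_real:
  fixes \<phi> :: "'a::cstar_algebra \<Rightarrow> real"
  assumes lin: "linear \<phi>" and bd: "\<And>x. \<phi> x \<le> norm x" and pos: "\<And>p. cpos p \<Longrightarrow> 0 \<le> \<phi> p"
  obtains \<omega> where "pos_functional \<omega>" "\<And>x. cstar x = x \<Longrightarrow> Re (\<omega> x) = \<phi> x"
proof -
  define \<psi> where "\<psi> x = \<phi> ((1/2) *\<^sub>R (x + cstar x))" for x
  define \<omega> where "\<omega> = (\<lambda>x. Complex (\<psi> x) (- \<psi> (cscale \<i> x)))"
  have lin': "linear \<psi>" unfolding \<psi>_def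
    by (rule linearI) (simp_all add: cstar_add linear_add [OF lin] linear_scale [OF lin] algebra_simps)
  have bd': "\<psi> x \<le> norm x" for x
  proof -
    have "norm (x + cstar x) \<le> 2 * norm x" using norm_triangle_ineq [of x "cstar x"] by simp
    then show ?thesis using bd [of "(1/2) *\<^sub>R (x + cstar x)"] by (simp add: \<psi>_def)
  qed
  have sa: "\<psi> x = \<phi> x" "\<psi> (cscale \<i> x) = 0" if "cstar x = x" for x
  proof -
    have "(1/2) *\<^sub>R (x + x) = x" by (simp flip: scaleR_2)
    then show "\<psi> x = \<phi> x" by (simp add: \<psi>_def that)
    show "\<psi> (cscale \<i> x) = 0"
      by (simp add: \<psi>_def that cstar_cscale cscale_minus_left linear_0 [OF lin])
  qed
  have "Im (\<omega> p) = 0 \<and> 0 \<le> Re (\<omega> p)" if "cpos p" for p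
    using sa [OF cpos_cstar [OF that]] pos [OF that] by (simp add: \<omega>_def)
  moreover have "bounded_functional \<omega>"
    unfolding \<omega>_def by (rule complexify_functional(1) [OF lin' bd'])
  ultimately have "pos_functional \<omega>" unfolding pos_functional_def bounded_functional_def by blast
  moreover have "Re (\<omega> x) = \<phi> x" if "cstar x = x" for x using sa(1) [OF that] by (simp add: \<omega>_def)
  ultimately show ?thesis using that by blast
qed

text \<open>Separate \<open>S\<close> plus the positive cone from zero. The cone is unbounded, so a
  functional bounded below on the sum must be nonnegative on the cone.\<close>

lemma separate_positive:
  fixes S :: "'a::cstar_algebra set"
  assumes S: "convex S" "S \<noteq> {}" "\<And>s. s \<in> S \<Longrightarrow> cstar s = s"
    and dist: "\<And>s p. s \<in> S \<Longrightarrow> cpos p \<Longrightarrow> \<epsilon> \<le> norm (s + p)"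
  obtains \<omega> where "pos_functional \<omega>" "\<And>s. s \<in> S \<Longrightarrow> \<epsilon> \<le> Re (\<omega> s)"
proof -
  have "convex {p :: 'a. cpos p}" by (rule convexI) (simp add: cpos_add cpos_scaleR)
  moreover define C where "C = (\<Union>x\<in>S. \<Union>y\<in>{p. cpos p}. {x + y})"
  ultimately have "convex C" using S(1) by (simp only: convex_sums)
  have C: "s + p \<in> C" if "s \<in> S" "cpos p" for s p using that by (auto simp: C_def)
  then have "C \<noteq> {}" using S(2) cpos_zero by blast
  have "\<epsilon> \<le> norm c" if "c \<in> C" for c
    using that dist unfolding C_def by (elim UN_E) simp
  from separate_convex_from_zero [OF \<open>convex C\<close> \<open>C \<noteq> {}\<close> this] obtain \<phi> where phi: "linear \<phi>" "\<And>x. \<phi> x \<le> norm x" "\<And>c. c \<in> C \<Longrightarrow> \<epsilon> \<le> \<phi> c"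
    by blast
  have sp: "\<epsilon> \<le> \<phi> s + \<phi> p" if "s \<in> S" "cpos p" for s p
    using phi(3) [OF C [OF that]] by (simp add: linear_add [OF phi(1)])
  have pos: "0 \<le> \<phi> p" if "cpos p" for p
  proof (rule ccontr)
    assume neg: "\<not> 0 \<le> \<phi> p"
    obtain s where s: "s \<in> S" using S(2) by blast
    \<comment> \<open>Large enough to push \<open>\<phi> s + t * \<phi> p\<close> below
      \<open>\<epsilon>\<close>.\<close>
    define t where "t = (\<bar>\<phi> s\<bar> + \<bar>\<epsilon>\<bar> + 1) / - \<phi> p"
    have "0 \<le> t" unfolding t_def using neg by (intro divide_nonneg_nonneg) auto
    then have "\<epsilon> \<le> \<phi> s + t * \<phi> p"
      using sp [OF s cpos_scaleR [OF that]] by (simp add: linear_scale [OF phi(1)])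
    moreover have "t * \<phi> p = - (\<bar>\<phi> s\<bar> + \<bar>\<epsilon>\<bar> + 1)" using neg by (simp add: t_def)
    ultimately show False by linarith
  qed
  obtain \<omega> where w: "pos_functional \<omega>" "\<And>x. cstar x = x \<Longrightarrow> Re (\<omega> x) = \<phi> x"
    using positive_functional_from_real [OF phi(1,2) pos] by blast
  have "\<epsilon> \<le> Re (\<omega> s)" if "s \<in> S" for s
    using sp [OF that cpos_zero] w(2) [OF S(3) [OF that]] by (simp add: linear_0 [OF phi(1)])
  with w(1) that show ?thesis by blast
qed

text \<open>The cone is norm closed, so a non-positive \<open>x\<close> has positive distance
  \<open>\<delta>\<close> from it; separating \<open>- x\<close> plus the cone from zero gives a
  positive functional that is negative at \<open>x\<close>.\<close>

lemma cpos_by_functionals: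
  fixes x :: "'a::cstar_algebra"
  assumes x: "cstar x = x" and pos: "\<And>\<omega>. pos_functional \<omega> \<Longrightarrow> 0 \<le> Re (\<omega> x)"
  shows "cpos x"
proof (rule ccontr)
  assume notpos: "\<not> cpos x"
  have "\<exists>\<delta>>0. \<forall>p. cpos p \<longrightarrow> \<delta> \<le> norm (p - x)"
  proof (rule ccontr)
    assume "\<not> ?thesis"
    then have "\<forall>n. \<exists>p. cpos p \<and> norm (p - x) < inverse (real (Suc n))"
      by (meson inverse_positive_iff_positive not_le of_nat_0_less_iff zero_less_Suc)
    then obtain p where p: "\<And>n. cpos (p n)" "\<And>n. norm (p n - x) < inverse (real (Suc n))" by metis
    have "(\<lambda>n. p n - x) \<longlonglongrightarrow> 0"
      by (rule Lim_null_comparison [OF always_eventually LIMSEQ_inverse_real_of_nat])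
         (intro allI less_imp_le p(2))
    then have "p \<longlonglongrightarrow> x" by (rule LIM_zero_cancel)
    with p(1) notpos show False using cpos_closed by blast
  qed
  then obtain \<delta> where d: "0 < \<delta>" "\<And>p. cpos p \<Longrightarrow> \<delta> \<le> norm (p - x)" by blast
  obtain \<omega> where w: "pos_functional \<omega>" "\<delta> \<le> Re (\<omega> (- x))"
    using separate_positive [of "{- x}" \<delta>] d x by (auto simp: add.commute)
  have "\<omega> (- x + x) = \<omega> (- x) + \<omega> x" "\<omega> (cscale 0 x) = 0 * \<omega> x"
    using w(1) unfolding pos_functional_def by blast+
  then have "\<omega> (- x) = - \<omega> x" by (simp add: eq_neg_iff_add_eq_0)
  then show False using w(2) pos [OF w(1)] d(1) by simp
qed

subsection \<open>Uniform boundedness and multipliers\<close>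

lemma uniform_boundedness:
  fixes T :: "'i \<Rightarrow> 'a::banach \<Rightarrow> 'b::real_normed_vector"
  assumes lin: "\<And>i. i \<in> I \<Longrightarrow> bounded_linear (T i)"
    and bd: "\<And>x. \<exists>K. \<forall>i\<in>I. norm (T i x) \<le> K"
  shows "\<exists>K\<ge>0. \<forall>i\<in>I. \<forall>x. norm (T i x) \<le> K * norm x"
proof -
  define E where "E n = {x. \<forall>i\<in>I. norm (T i x) \<le> real n}" for n
  have clo: "closed (E n)" for n
  proof -
    have "E n = (\<Inter>i\<in>I. {x. norm (T i x) \<le> real n})" by (auto simp: E_def)
    moreover have "closed {x. norm (T i x) \<le> real n}" if "i \<in> I" for i
      by (intro closed_Collect_le continuous_intros bounded_linear.continuous_on [OF lin [OF that]])
    ultimately show ?thesis by (simp add: closed_INT)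
  qed
  have "\<exists>n. interior (E n) \<noteq> {}"
  proof (rule ccontr)
    assume "\<nexists>n. interior (E n) \<noteq> {}"
    then have "euclidean interior_of \<Union>(range E) = {}"
      by (intro Baire_category_alt) (auto simp: completely_metrizable_space_euclidean clo)
    moreover have "\<Union>(range E) = UNIV"
    proof -
      have "\<exists>n. x \<in> E n" for x
      proof -
        obtain K where "\<forall>i\<in>I. norm (T i x) \<le> K" using bd by blast
        moreover obtain n where "K \<le> real n" using real_arch_simple by blast
        ultimately show ?thesis by (auto simp: E_def intro: order_trans)
      qed
      then show ?thesis by blast
    qed
    ultimately show False by simp
  qed
  then obtain n x where "x \<in> interior (E n)" by blast
  then obtain r where r: "0 < r" "ball x r \<subseteq> E n" unfolding mem_interior by blast
  \<comment> \<open>Rescaling \<open>y\<close> to \<open>z\<close> of norm \<open>r / 2\<close> puts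
    \<open>x + z\<close> and \<open>x\<close> into \<open>E n\<close>, so
    \<open>norm (T i z) \<le> 2 n\<close>; undoing the scaling gives the factor
    \<open>4 n / r\<close>.\<close>
  have K: "norm (T i y) \<le> (4 * real n / r) * norm y" if i: "i \<in> I" for i y
  proof (cases "y = 0")
    case True
    then show ?thesis by (simp add: linear_0 [OF bounded_linear.linear [OF lin [OF i]]])
  next
    case False
    interpret bounded_linear "T i" by (rule lin [OF i])
    define z where "z = (r / (2 * norm y)) *\<^sub>R y"
    have "norm z < r" using r(1) False by (simp add: z_def)
    then have "x + z \<in> E n" "x \<in> E n" using r by (auto simp: dist_norm)
    then have "norm (T i (x + z)) \<le> n" "norm (T i x) \<le> n" using i by (auto simp: E_def)
    moreover have "norm (T i z) \<le> norm (T i (x + z)) + norm (T i x)"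
      using norm_triangle_ineq4 [of "T i (x + z)" "T i x"] by (simp add: add)
    ultimately have "norm (T i z) \<le> 2 * real n" by simp
    moreover have "norm (T i z) = (r / (2 * norm y)) * norm (T i y)"
      using r(1) by (simp add: z_def scaleR)
    ultimately show ?thesis using r(1) False by (simp add: field_simps)
  qed
  show ?thesis by (rule exI [of _ "4 * real n / r"]) (use K r(1) in auto)
qed

text \<open>Left multiplication is faithful, as the test element \<open>cstar (x - y)\<close> shows.
  Through this lemma the single identity defining multipliers yields linearity and the module
  property.\<close>

lemma eq_by_left_mult:
  fixes x y :: "'a::cstar_algebra"
  assumes "\<And>a. a * x = a * y" shows "x = y"
proof -
  have "cstar (x - y) * (x - y) = 0"
    using assms [of "cstar (x - y)"] by (simp only: right_diff_distrib diff_self)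
  then show ?thesis by (simp add: cstar_mult_self_eq_0)
qed

lemma multiplier_eq: "n \<in> multipliers \<Longrightarrow> a * fst n b = snd n a * b"
  by (auto simp: multipliers_def)

context
  fixes n :: "('a::cstar_algebra \<Rightarrow> 'a) \<times> ('a \<Rightarrow> 'a)"
  assumes n: "n \<in> multipliers"
begin

lemma multiplier_mult: "fst n (b * c) = fst n b * c"
  by (rule eq_by_left_mult) (simp add: multiplier_eq [OF n] flip: mult.assoc)

lemma multiplier_add: "fst n (b + c) = fst n b + fst n c"
  by (rule eq_by_left_mult) (simp add: multiplier_eq [OF n] distrib_left)

lemma multiplier_scaleR: "fst n (r *\<^sub>R b) = r *\<^sub>R fst n b"
  by (rule eq_by_left_mult) (simp add: multiplier_eq [OF n])

lemma multiplier_bounded: "bounded_linear (fst n)"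
proof -
  \<comment> \<open>Linear and continuous in \<open>b\<close> through \<open>snd n a\<close>, and
    bounded over all \<open>a\<close> through \<open>a * fst n b\<close>; the two agree by the
    multiplier identity. Since \<open>inverse 0 = 0\<close>, the index \<open>a = 0\<close> gives
    zero.\<close>
  define T where "T a b = (inverse (norm a)) *\<^sub>R (snd n a * b)" for a b
  have "\<exists>K. \<forall>a\<in>UNIV. norm (T a b) \<le> K" for b
  proof (intro exI ballI)
    fix a
    have "norm (T a b) = inverse (norm a) * norm (a * fst n b)"
      by (simp add: T_def multiplier_eq [OF n])
    also have "\<dots> \<le> inverse (norm a) * (norm a * norm (fst n b))"
      by (intro mult_left_mono norm_mult_ineq) simp
    also have "\<dots> \<le> norm (fst n b)" by (cases "a = 0") (simp_all flip: mult.assoc)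
    finally show "norm (T a b) \<le> norm (fst n b)" .
  qed
  moreover have "bounded_linear (T a)" for a
    unfolding T_def by (intro bounded_linear_const_scaleR bounded_linear_mult_right)
  ultimately have "\<exists>K\<ge>0. \<forall>a\<in>UNIV. \<forall>b. norm (T a b) \<le> K * norm b"
    by (intro uniform_boundedness)
  then obtain K where K: "0 \<le> K" "\<And>a b. norm (T a b) \<le> K * norm b" by blast
  have "norm (fst n b) \<le> norm b * K" for b
  proof (cases "fst n b = 0")
    case False
    let ?c = "cstar (fst n b)"
    have "norm (fst n b) * norm (fst n b) = norm (snd n ?c * b)"
      using cstar_identity [of "fst n b"] by (simp add: multiplier_eq [OF n])
    also have "\<dots> = norm (fst n b) * norm (T ?c b)" using False by (simp add: T_def)
    also have "\<dots> \<le> norm (fst n b) * (K * norm b)" by (simp add: K mult_left_mono)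
    finally show ?thesis using False by (simp add: mult.commute)
  qed (simp add: K)
  then show ?thesis by (rule bounded_linear_intro [OF multiplier_add multiplier_scaleR])
qed

end

subsection \<open>Weak integrals\<close>

lemma bounded_functional_linear:
  assumes "bounded_functional \<phi>" shows "bounded_linear \<phi>"
proof -
  have add: "\<phi> (a + b) = \<phi> a + \<phi> b" and scale: "\<phi> (cscale c a) = c * \<phi> a" for a b c
    using assms by (auto simp: bounded_functional_def)
  obtain K where K: "cmod (\<phi> a) \<le> norm a * K" for a
    using assms by (auto simp: bounded_functional_def mult.commute)
  have "\<phi> (r *\<^sub>R a) = r *\<^sub>R \<phi> a" for r a
    by (simp add: scale scaleR_conv_of_real flip: cscale_of_real)
  with add K show ?thesis by (intro bounded_linear_intro)
qed

lemma pos_functional_bounded: "pos_functional \<omega> \<Longrightarrow> bounded_functional \<omega>"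
  unfolding pos_functional_def bounded_functional_def by (elim conjE) (intro conjI)

lemmas pos_functional_linear = bounded_functional_linear [OF pos_functional_bounded]

lemma radon_sets: "radon M \<Longrightarrow> sets M = sets borel"
  unfolding radon_def by (elim conjE)

lemma radon_compact: "radon M \<Longrightarrow> compact K \<Longrightarrow> emeasure M K < \<infinity>"
  unfolding radon_def by (elim conjE) simp

lemma radon_inner:
  "radon M \<Longrightarrow> open U \<Longrightarrow> emeasure M U = (SUP K\<in>{K. compact K \<and> K \<subseteq> U}. emeasure M K)"
  unfolding radon_def by (elim conjE) (erule allE [of _ U], erule impE)

lemma radon_compact_sets: "radon M \<Longrightarrow> compact K \<Longrightarrow> K \<in> sets M"
  by (simp add: radon_sets compact_imp_closed)

lemma BsetD:
  assumes "l \<in> Bset M"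
  shows "l \<in> borel_measurable M" "0 \<le> l x" "l x \<le> 1"
  using assms unfolding Bset_def by blast+

lemma Bset_support:
  assumes "radon M" "l \<in> Bset M"
  obtains K where "compact K" "K \<in> sets M" "emeasure M K < \<infinity>" "\<And>x. x \<notin> K \<Longrightarrow> l x = 0"
proof -
  obtain K where "compact K" "\<forall>x. x \<notin> K \<longrightarrow> l x = 0" using assms(2) unfolding Bset_def by blast
  with that show ?thesis using radon_compact [OF assms(1)] radon_compact_sets [OF assms(1)] by blast
qed

lemma radon_continuous_measurable:
  fixes g :: "'x::t2_space \<Rightarrow> 'b::topological_space"
  assumes "radon M" "continuous_on UNIV g" shows "g \<in> borel_measurable M"
proof -
  have "borel_measurable M = (borel_measurable borel :: ('x \<Rightarrow> 'b) set)"
    by (rule measurable_cong_sets [OF radon_sets [OF assms(1)] refl])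
  then show ?thesis using borel_measurable_continuous_onI [OF assms(2)] by simp
qed

lemma Bset_integrable:
  fixes g :: "'x::t2_space \<Rightarrow> complex"
  assumes M: "radon M" and l: "l \<in> Bset M" and g: "continuous_on UNIV g"
  shows "integrable M (\<lambda>x. l x *\<^sub>R g x)"
proof -
  obtain K where K: "compact K" "K \<in> sets M" "emeasure M K < \<infinity>" "\<And>x. x \<notin> K \<Longrightarrow> l x = 0"
    using Bset_support [OF M l] by blast
  have "bounded (g ` K)" 
    by (intro compact_imp_bounded compact_continuous_image continuous_on_subset [OF g] K) simp
  then obtain B where B: "\<And>x. x \<in> K \<Longrightarrow> norm (g x) \<le> B" by (auto simp: bounded_iff)
  have gm: "g \<in> borel_measurable M" by (rule radon_continuous_measurable [OF M g])
  note lm = BsetD [OF l]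
  show ?thesis
  proof (rule integrableI_bounded_set [OF K(2) _ K(3), where B = B])
    show "(\<lambda>x. l x *\<^sub>R g x) \<in> borel_measurable M" using gm lm(1) by measurable
    show "AE x in M. x \<in> K \<longrightarrow> norm (l x *\<^sub>R g x) \<le> B"
    proof (intro AE_I2 impI)
      fix x assume "x \<in> K"
      have "norm (l x *\<^sub>R g x) \<le> norm (g x)" using lm(2,3) [of x] by (simp add: mult_left_le_one_le)
      then show "norm (l x *\<^sub>R g x) \<le> B" using B [OF \<open>x \<in> K\<close>] by simp
    qed
  qed (simp add: K(4))
qed

lemma wintegral_approx:
  fixes f :: "'x::t2_space \<Rightarrow> 'a::cstar_algebra"
  assumes M: "radon M" and f: "continuous_on UNIV f" and l: "l \<in> Bset M"
    and K: "compact K" "K \<in> sets M" "emeasure M K < \<infinity>" "\<And>x. x \<notin> K \<Longrightarrow> l x = 0" and e: "0 < e"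
  shows "\<exists>a. \<forall>\<phi> B. bounded_functional \<phi> \<longrightarrow> 0 \<le> B \<longrightarrow> (\<forall>x. cmod (\<phi> x) \<le> B * norm x) \<longrightarrow>
     cmod (\<phi> a - (LINT x|M. l x *\<^sub>R \<phi> (f x))) \<le> B * e * measure M K"
proof -
  have "compact (f ` K)" 
    by (intro compact_continuous_image continuous_on_subset [OF f] K) simp
  then obtain Y where Y: "finite Y" "f ` K \<subseteq> (\<Union>y\<in>Y. ball y e)"
    by (rule compactE_image [of _ "f ` K" "\<lambda>y. ball y e"]) (use e in auto)
  obtain y :: "nat \<Rightarrow> 'a" and N where yN: "Y = y ` {..<N}"
    using finite_imp_nat_seg_image_inj_on [OF Y(1)] by (metis lessThan_def)
  define G where "G i = {x. dist (y i) (f x) < e}" for i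
  define A where "A i = K \<inter> (G i - (\<Union>j<i. G j))" for i
  have "open (G i)" for i unfolding G_def by (intro open_Collect_less continuous_intros f)
  then have Gs: "G i \<in> sets M" for i by (simp add: radon_sets [OF M])
  have As: "A i \<in> sets M" for i using K(2) Gs unfolding A_def by auto
  have disj: "x \<notin> A j" if "x \<in> A i" "i \<noteq> j" for x i j
    using that by (cases "i < j") (auto simp: A_def)
  have cover: "\<exists>i<N. x \<in> A i" if "x \<in> K" for x
  proof -
    have "\<exists>i. i < N \<and> x \<in> G i" using Y(2) that by (force simp: yN G_def)
    then obtain i where "i < N \<and> x \<in> G i" "\<And>j. j < i \<Longrightarrow> \<not> (j < N \<and> x \<in> G j)"
      using exists_least_iff [of "\<lambda>i. i < N \<and> x \<in> G i"] by blast
    then show ?thesis using that by (auto simp: A_def intro!: exI [of _ i])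
  qed
  have lA: "(\<lambda>x. indicator (A i) x * l x) \<in> Bset M" for i
    using l As by (auto simp: Bset_def indicator_def)
  define c where "c i = (LINT x|M. indicator (A i) x * l x)" for i
  show ?thesis
  proof (intro exI [of _ "\<Sum>i<N. c i *\<^sub>R y i"] allI impI)
    fix \<phi> and B assume phi: "bounded_functional \<phi>" and "0 \<le> B" and B: "\<forall>x :: 'a. cmod (\<phi> x) \<le> B * norm x"
    interpret bounded_linear \<phi> by (rule bounded_functional_linear [OF phi])
    have cont: "continuous_on UNIV (\<lambda>x. \<phi> (f x))" by (intro continuous_on f)
    have int1: "integrable M (\<lambda>x. (indicator (A i) x * l x) *\<^sub>R \<phi> (y i))" for i
      by (rule Bset_integrable [OF M lA]) simp
    have int2: "integrable M (\<lambda>x. (indicator (A i) x * l x) *\<^sub>R \<phi> (f x))" for i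
      by (rule Bset_integrable [OF M lA cont])
    have part: "l x *\<^sub>R \<phi> (f x) = (\<Sum>i<N. (indicator (A i) x * l x) *\<^sub>R \<phi> (f x))" for x
    proof (cases "x \<in> K")
      case True
      then obtain i where i: "i < N" "x \<in> A i" using cover by blast
      have "(\<Sum>j<N. (indicator (A j) x * l x) *\<^sub>R \<phi> (f x)) = (\<Sum>j<N. if j = i then l x *\<^sub>R \<phi> (f x) else 0)"
        by (rule sum.cong) (use i disj in \<open>auto simp: indicator_def\<close>)
      then show ?thesis using i by simp
    qed (simp add: K(4))
    have sumA: "(\<Sum>i<N. indicator (A i) x :: real) \<le> indicator K x" for x
    proof (cases "\<exists>i<N. x \<in> A i")
      case True
      then obtain i where i: "i < N" "x \<in> A i" by blast
      have "(\<Sum>j<N. indicator (A j) x :: real) = (\<Sum>j<N. if j = i then 1 else 0)"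
        by (rule sum.cong) (use i disj in \<open>auto simp: indicator_def\<close>)
      then show ?thesis using i by (simp add: A_def)
    qed (auto simp: indicator_def)
    have sc: "(LINT x|M. (indicator (A i) x * l x) *\<^sub>R \<phi> (y i)) = c i *\<^sub>R \<phi> (y i)" for i
    proof -
      have "integrable M (\<lambda>x. Re ((indicator (A i) x * l x) *\<^sub>R (1::complex)))"
        by (intro integrable_Re Bset_integrable [OF M lA]) simp
      then show ?thesis unfolding c_def by (intro integral_scaleR_left) simp
    qed
    have "\<phi> (\<Sum>i<N. c i *\<^sub>R y i) - (LINT x|M. l x *\<^sub>R \<phi> (f x)) =
       (\<Sum>i<N. LINT x|M. (indicator (A i) x * l x) *\<^sub>R \<phi> (y i)) -
       (\<Sum>i<N. LINT x|M. (indicator (A i) x * l x) *\<^sub>R \<phi> (f x))"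
      unfolding part by (simp add: Bochner_Integration.integral_sum int2 sum scaleR sc)
    also have "\<dots> = (LINT x|M. (\<Sum>i<N. (indicator (A i) x * l x) *\<^sub>R (\<phi> (y i) - \<phi> (f x))))"
      by (simp add: int1 int2 scaleR_diff_right sum_subtractf)
    also have "cmod \<dots> \<le> (LINT x|M. B * e * indicator K x)"
    proof (rule order_trans [OF integral_norm_bound integral_mono])
      show "integrable M (\<lambda>x. norm (\<Sum>i<N. (indicator (A i) x * l x) *\<^sub>R (\<phi> (y i) - \<phi> (f x))))"
        using int1 int2 by (intro integrable_norm) (simp add: scaleR_diff_right)
      show "integrable M (\<lambda>x. B * e * indicator K x)" using K(2,3) by simp
      fix x
      have "norm (\<Sum>i<N. (indicator (A i) x * l x) *\<^sub>R (\<phi> (y i) - \<phi> (f x))) \<le>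
         (\<Sum>i<N. norm ((indicator (A i) x * l x) *\<^sub>R (\<phi> (y i) - \<phi> (f x))))" by (rule norm_sum)
      also have "\<dots> \<le> (\<Sum>i<N. indicator (A i) x * (B * e))"
      proof (rule sum_mono)
        fix i
        have "l x * cmod (\<phi> (y i) - \<phi> (f x)) \<le> 1 * (B * e)" if "x \<in> A i"
        proof (rule mult_mono)
          have "norm (y i - f x) \<le> e" using that by (auto simp: A_def G_def dist_norm)
          then show "cmod (\<phi> (y i) - \<phi> (f x)) \<le> B * e"
            using B [rule_format, of "y i - f x"] mult_left_mono [OF _ \<open>0 \<le> B\<close>] by (fastforce simp: diff)
        qed (use l in \<open>auto simp: Bset_def\<close>)
        then show "norm ((indicator (A i) x * l x) *\<^sub>R (\<phi> (y i) - \<phi> (f x))) \<le> indicator (A i) x * (B * e)"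
          using l by (auto simp: indicator_def Bset_def)
      qed
      also have "\<dots> = (\<Sum>i<N. indicator (A i) x) * (B * e)" by (simp add: sum_distrib_right)
      also have "\<dots> \<le> indicator K x * (B * e)"
        using sumA \<open>0 \<le> B\<close> e by (intro mult_right_mono) auto
      finally show "norm (\<Sum>i<N. (indicator (A i) x * l x) *\<^sub>R (\<phi> (y i) - \<phi> (f x))) \<le> B * e * indicator K x"
        by (simp add: mult_ac)
    qed
    also have "\<dots> = B * e * measure M K" using K(2,3) by simp
    finally show "cmod (\<phi> (\<Sum>i<N. c i *\<^sub>R y i) - (LINT x|M. l x *\<^sub>R \<phi> (f x))) \<le> B * e * measure M K" .
  qed
qed

lemma wintegral_exists:
  fixes f :: "'x::t2_space \<Rightarrow> 'a::cstar_algebra"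
  assumes M: "radon M" and f: "continuous_on UNIV f" and l: "l \<in> Bset M"
  shows "\<exists>a. has_wintegral M (\<lambda>x. l x *\<^sub>R f x) a"
proof -
  obtain K where K: "compact K" "K \<in> sets M" "emeasure M K < \<infinity>" "\<And>x. x \<notin> K \<Longrightarrow> l x = 0"
    using Bset_support [OF M l] by blast
  define I where "I \<phi> = (LINT x|M. l x *\<^sub>R \<phi> (f x))" for \<phi> :: "'a \<Rightarrow> complex"
  define \<mu> where "\<mu> = measure M K"
  define e where "e n = inverse (real (Suc n))" for n
  have e: "0 < e n" for n by (simp add: e_def)
  have "0 \<le> \<mu>" by (simp add: \<mu>_def)
  have "\<forall>n. \<exists>a. \<forall>\<phi> B. bounded_functional \<phi> \<longrightarrow> 0 \<le> B \<longrightarrow> (\<forall>x. cmod (\<phi> x) \<le> B * norm x) \<longrightarrow>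
     cmod (\<phi> a - I \<phi>) \<le> B * e n * \<mu>"
    unfolding I_def \<mu>_def by (rule allI, rule wintegral_approx [OF M f l K e])
  from choice [OF this] obtain a where "\<forall>n \<phi> B. bounded_functional \<phi> \<longrightarrow> 0 \<le> B \<longrightarrow>
     (\<forall>x. cmod (\<phi> x) \<le> B * norm x) \<longrightarrow> cmod (\<phi> (a n) - I \<phi>) \<le> B * e n * \<mu>" ..
  then have a: "cmod (\<phi> (a n) - I \<phi>) \<le> B * e n * \<mu>"
    if "bounded_functional \<phi>" "0 \<le> B" "\<And>x. cmod (\<phi> x) \<le> B * norm x" for n \<phi> B
    using that by simp
  have e0: "e \<longlonglongrightarrow> 0" unfolding e_def by (rule LIMSEQ_inverse_real_of_nat)
  \<comment> \<open>A functional norming the difference has bound 2; both Riemann sums approximate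
    the same integral of it.\<close>
  have dist: "norm (a m - a n) \<le> 2 * \<mu> * (e m + e n)" for m n
  proof -
    obtain \<omega> where w: "bounded_functional \<omega>" "\<And>y. cmod (\<omega> y) \<le> 2 * norm y" "norm (a m - a n) \<le> cmod (\<omega> (a m - a n))"
      using norming_functional [of "a m - a n"] by blast
    have "\<omega> (a m - a n) = (\<omega> (a m) - I \<omega>) - (\<omega> (a n) - I \<omega>)"
      by (simp add: linear_diff [OF bounded_linear.linear [OF bounded_functional_linear [OF w(1)]]])
    then have "cmod (\<omega> (a m - a n)) \<le> cmod (\<omega> (a m) - I \<omega>) + cmod (\<omega> (a n) - I \<omega>)"
      by (simp only: norm_triangle_ineq4)
    also have "\<dots> \<le> 2 * e m * \<mu> + 2 * e n * \<mu>"
      by (rule add_mono; rule a [OF w(1) _ w(2)]) simp_all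
    finally show ?thesis using w(3) by (simp add: algebra_simps)
  qed
  have "Cauchy a"
  proof (rule metric_CauchyI)
    fix \<epsilon> :: real assume "0 < \<epsilon>"
    have "(\<lambda>n. 4 * \<mu> * e n) \<longlonglongrightarrow> 4 * \<mu> * 0" by (intro tendsto_intros e0)
    from LIMSEQ_D [OF this \<open>0 < \<epsilon>\<close>]
    obtain N where N: "\<And>n. N \<le> n \<Longrightarrow> norm (4 * \<mu> * e n - 4 * \<mu> * 0) < \<epsilon>" by blast
    have "dist (a m) (a n) < \<epsilon>" if "N \<le> m" "N \<le> n" for m n
    proof -
      have "4 * \<mu> * e m < \<epsilon>" "4 * \<mu> * e n < \<epsilon>" using N [OF that(1)] N [OF that(2)] by (simp_all add: abs_less_iff)
      then show ?thesis using dist [of m n] by (simp add: dist_norm algebra_simps)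
    qed
    then show "\<exists>N. \<forall>m\<ge>N. \<forall>n\<ge>N. dist (a m) (a n) < \<epsilon>" by blast
  qed
  then obtain c where c: "a \<longlonglongrightarrow> c" using Cauchy_convergent convergent_def by blast
  have "has_wintegral M (\<lambda>x. l x *\<^sub>R f x) c"
    unfolding has_wintegral_def
  proof (intro allI impI conjI)
    fix \<phi> :: "'a \<Rightarrow> complex" assume phi: "bounded_functional \<phi>"
    interpret bounded_linear \<phi> by (rule bounded_functional_linear [OF phi])
    show "integrable M (\<lambda>x. \<phi> (l x *\<^sub>R f x))"
      unfolding scaleR by (rule Bset_integrable [OF M l continuous_on [OF f]])
    obtain B where "0 \<le> B" "\<forall>x. cmod (\<phi> x) \<le> norm x * B" using nonneg_bounded by blast
    then have B: "0 \<le> B" "\<And>x. cmod (\<phi> x) \<le> B * norm x" by (simp_all add: mult.commute)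
    have "(\<lambda>n. B * e n * \<mu>) \<longlonglongrightarrow> B * 0 * \<mu>" by (intro tendsto_intros e0)
    then have lim0: "(\<lambda>n. B * e n * \<mu>) \<longlonglongrightarrow> 0" by simp
    have "(\<lambda>n. \<phi> (a n) - I \<phi>) \<longlonglongrightarrow> 0"
      by (rule Lim_null_comparison [OF always_eventually lim0]) (intro allI a [OF phi B])
    then have "(\<lambda>n. \<phi> (a n)) \<longlonglongrightarrow> I \<phi>" by (rule LIM_zero_cancel)
    then have "\<phi> c = I \<phi>" by (rule LIMSEQ_unique [OF tendsto [OF c]])
    then show "(LINT x|M. \<phi> (l x *\<^sub>R f x)) = \<phi> c" by (simp add: I_def scaleR)
  qed
  then show ?thesis by blast
qed

lemma wintegral_functional: "has_wintegral M g a \<Longrightarrow> bounded_functional \<phi> \<Longrightarrow> \<phi> a = (LINT x|M. \<phi> (g x))"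
  by (simp add: has_wintegral_def)

lemma p_lam_functional:
  fixes f :: "'x::t2_space \<Rightarrow> 'a::cstar_algebra"
  assumes M: "radon M" and f: "continuous_on UNIV f" and l: "l \<in> Bset M" and phi: "bounded_functional \<phi>"
  shows "\<phi> (p_lam M l f) = (LINT x|M. l x *\<^sub>R \<phi> (f x))"
proof -
  obtain a where a: "has_wintegral M (\<lambda>x. l x *\<^sub>R f x) a" using wintegral_exists [OF M f l] by blast
  have "b = a" if "has_wintegral M (\<lambda>x. l x *\<^sub>R f x) b" for b
  proof (rule bounded_functional_eqI)
    fix \<phi> :: "'a \<Rightarrow> complex" assume "bounded_functional \<phi>"
    from wintegral_functional [OF a this] wintegral_functional [OF that this]
    show "\<phi> b = \<phi> a" by simp
  qed
  then have "p_lam M l f = a" unfolding p_lam_def using a by (intro the_equality)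
  then have "\<phi> (p_lam M l f) = (LINT x|M. \<phi> (l x *\<^sub>R f x))" by (simp add: wintegral_functional [OF a phi])
  then show ?thesis by (simp add: linear_scale [OF bounded_linear.linear [OF bounded_functional_linear [OF phi]]])
qed

subsection \<open>Integrals of continuous functions against Radon measures\<close>

text \<open>The measure need not be \<open>\<sigma>\<close>-finite, so inner regularity is only available for the open level
  sets; hence the approximation from below by layers.\<close>

lemma card_nat_below:
  fixes y :: real assumes "0 \<le> y"
  shows "real (card {k \<in> {1..N}. real k < y}) \<le> y"
    and "y \<le> real N \<Longrightarrow> y - 1 \<le> real (card {k \<in> {1..N}. real k < y})"
proof -
  define c where "c = nat \<lceil>y\<rceil>"
  have c: "real k < y \<longleftrightarrow> k < c" for k
    using assms by (simp add: c_def zless_nat_eq_int_zless less_ceiling_iff)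
  have cy: "real c - 1 \<le> y" "y \<le> real c" using assms by (auto simp: c_def)
  have sub: "{k \<in> {1..N}. real k < y} \<subseteq> {1..<c}" by (auto simp: c)
  have "real (card {k \<in> {1..N}. real k < y}) \<le> real (c - 1)"
    using card_mono [OF _ sub] by simp
  also have "\<dots> \<le> y" using cy assms by (cases "c = 0") auto
  finally show "real (card {k \<in> {1..N}. real k < y}) \<le> y" .
  assume "y \<le> real N"
  then have "c \<le> N" by (simp add: c_def ceiling_le_iff)
  then have "{k \<in> {1..N}. real k < y} = {1..<c}" by (auto simp: c)
  then show "y - 1 \<le> real (card {k \<in> {1..N}. real k < y})" using cy by (simp add: of_nat_diff_if)
qed

text \<open>Each layer sum \<open>H n\<close> is a finite combination of indicators of open sets.
  Inner regularity computes its integral as a supremum over compact sets, which is bounded by the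
  hypothesis since \<open>H n\<close> lies below \<open>g\<close>.\<close>

lemma nn_integral_le_by_compacts:
  fixes g :: "'x::t2_space \<Rightarrow> real"
  assumes M: "radon M" and g: "continuous_on UNIV g" "\<And>x. 0 \<le> g x"
    and le: "\<And>K. compact K \<Longrightarrow> (\<integral>\<^sup>+ x. ennreal (g x) * indicator K x \<partial>M) \<le> C"
  shows "(\<integral>\<^sup>+ x. ennreal (g x) \<partial>M) \<le> C"
proof -
  define s where "s n = inverse (real (Suc n))" for n
  define U where "U n k = {x. real k < g x * real (Suc n)}" for n k
  \<comment> \<open>Steps of size \<open>s n\<close> up to height \<open>n + 1\<close>, so both the
    mesh and the truncation improve with \<open>n\<close>.\<close>
  define A where "A n = {1..Suc n * Suc n}" for n
  define H where "H n x = (\<Sum>k\<in>A n. ennreal (s n) * indicator (U n k) x)" for n x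
  define h where "h n x = s n * real (card {k \<in> A n. real k < g x * real (Suc n)})" for n x
  have s: "0 < s n" "s n * real (Suc n) = 1" for n by (simp_all add: s_def)
  have Hh: "H n x = ennreal (h n x)" for n x
  proof -
    have "H n x = ennreal (\<Sum>k\<in>A n. s n * indicator (U n k) x)"
      unfolding H_def using s(1) [of n] by (subst sum_ennreal [symmetric]) (auto simp: ennreal_mult' ennreal_indicator less_imp_le)
    also have "(\<Sum>k\<in>A n. s n * indicator (U n k) x) = s n * (\<Sum>k\<in>A n. if real k < g x * real (Suc n) then 1 else 0)"
      by (simp only: sum_distrib_left) (simp add: U_def indicator_def of_bool_def)
    also have "\<dots> = h n x"
      unfolding h_def by (subst sum.inter_filter [symmetric]) (auto simp: A_def)
    finally show ?thesis .
  qed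
  have h_le: "h n x \<le> g x" for n x
  proof -
    have "h n x \<le> s n * (g x * real (Suc n))"
      unfolding h_def A_def by (intro mult_left_mono card_nat_below) (use s(1) [of n] g(2) [of x] in auto)
    also have "\<dots> = g x * (s n * real (Suc n))" by (simp only: mult_ac)
    finally show ?thesis by (simp only: s mult_1_right)
  qed
  have lim: "(\<lambda>n. h n x) \<longlonglongrightarrow> g x" for x
  proof (rule tendsto_sandwich)
    have "(\<lambda>n. g x - s n) \<longlonglongrightarrow> g x - 0" unfolding s_def by (intro tendsto_intros LIMSEQ_inverse_real_of_nat)
    then show "(\<lambda>n. g x - s n) \<longlonglongrightarrow> g x" by simp
    obtain N where N: "g x \<le> real N" using real_arch_simple by blast
    show "\<forall>\<^sub>F n in sequentially. g x - s n \<le> h n x"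
    proof (rule eventually_sequentiallyI [of N])
      fix n assume "N \<le> n"
      then have "g x \<le> real (Suc n)" using N by simp
      then have "g x * real (Suc n) \<le> real (Suc n * Suc n)"
        by (simp only: of_nat_mult) (intro mult_right_mono, auto)
      then have "s n * (g x * real (Suc n) - 1) \<le> h n x"
        unfolding h_def A_def by (intro mult_left_mono card_nat_below) (use s(1) [of n] g(2) [of x] in auto)
      moreover have "s n * (g x * real (Suc n) - 1) = g x * (s n * real (Suc n)) - s n"
        by (simp only: right_diff_distrib mult_ac mult_1_right)
      ultimately show "g x - s n \<le> h n x" by (simp only: s mult_1_right)
    qed
  qed (use h_le in auto)
  have opn: "open (U n k)" for n k
    unfolding U_def by (intro open_Collect_less continuous_intros g)
  have Us: "U n k \<in> sets M" for n k using opn by (simp add: radon_sets [OF M])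
  have bound: "(\<integral>\<^sup>+ x. H n x \<partial>M) \<le> C" for n
  proof -
    let ?I = "{K :: 'x set. compact K}"
    \<comment> \<open>All compact sets instead of those inside \<open>U n k\<close>: every layer now
      has the same index set, directed by unions, so the suprema can be pulled out of the finite
      sum.\<close>
    have sup: "emeasure M (U n k) = (SUP K\<in>?I. emeasure M (K \<inter> U n k))" for k
    proof (rule antisym)
      show "emeasure M (U n k) \<le> (SUP K\<in>?I. emeasure M (K \<inter> U n k))"
        unfolding radon_inner [OF M opn]
        by (rule SUP_least) (auto intro!: SUP_upper2 simp: Int_absorb2)
      show "(SUP K\<in>?I. emeasure M (K \<inter> U n k)) \<le> emeasure M (U n k)"
        by (intro SUP_least emeasure_mono Us) auto
    qed
    have mono: "emeasure M (K \<inter> U n k) \<le> emeasure M (L \<inter> U n k)" if "K \<subseteq> L" "compact L" for K L k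
      using that Us radon_compact_sets [OF M] by (intro emeasure_mono) auto
    have dsum: "(\<Sum>k\<in>F. SUP K\<in>?I. ennreal (s n) * emeasure M (K \<inter> U n k)) =
      (SUP K\<in>?I. \<Sum>k\<in>F. ennreal (s n) * emeasure M (K \<inter> U n k))" if "finite F" for F
      using that
    proof induction
      case empty
      have "?I \<noteq> {}" using compact_empty by blast
      then show ?case by simp
    next
      case (insert k F)
      have "(SUP K\<in>?I. ennreal (s n) * emeasure M (K \<inter> U n k) + (\<Sum>k\<in>F. ennreal (s n) * emeasure M (K \<inter> U n k))) =
         (SUP K\<in>?I. ennreal (s n) * emeasure M (K \<inter> U n k)) + (SUP K\<in>?I. \<Sum>k\<in>F. ennreal (s n) * emeasure M (K \<inter> U n k))"
      proof (rule SUP_add_directed_ennreal)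
        fix K L :: "'x set" assume KL: "K \<in> ?I" "L \<in> ?I"
        then show "\<exists>J\<in>?I. ennreal (s n) * emeasure M (K \<inter> U n k) + (\<Sum>k\<in>F. ennreal (s n) * emeasure M (L \<inter> U n k))
          \<le> ennreal (s n) * emeasure M (J \<inter> U n k) + (\<Sum>k\<in>F. ennreal (s n) * emeasure M (J \<inter> U n k))"
          by (intro bexI [of _ "K \<union> L"] add_mono sum_mono mult_left_mono mono) (auto intro: compact_Un)
      qed
      then show ?case using insert by simp
    qed
    have "(\<integral>\<^sup>+ x. H n x \<partial>M) = (\<Sum>k\<in>A n. ennreal (s n) * emeasure M (U n k))"
      unfolding H_def using Us by (subst nn_integral_sum) (auto simp: nn_integral_cmult_indicator)
    also have "\<dots> = (\<Sum>k\<in>A n. SUP K\<in>?I. ennreal (s n) * emeasure M (K \<inter> U n k))"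
      unfolding sup by (simp add: SUP_mult_left_ennreal)
    also have "\<dots> = (SUP K\<in>?I. \<Sum>k\<in>A n. ennreal (s n) * emeasure M (K \<inter> U n k))"
      by (rule dsum) (simp add: A_def)
    also have "\<dots> \<le> C"
    proof (rule SUP_least)
      fix K :: "'x set" assume K: "K \<in> ?I"
      then have Ks: "K \<in> sets M" using radon_compact_sets [OF M] by simp
      have "(\<Sum>k\<in>A n. ennreal (s n) * emeasure M (K \<inter> U n k)) =
         (\<integral>\<^sup>+ x. (\<Sum>k\<in>A n. ennreal (s n) * indicator (K \<inter> U n k) x) \<partial>M)"
        using Us Ks by (subst nn_integral_sum) (auto simp: nn_integral_cmult_indicator)
      also have "\<dots> = (\<integral>\<^sup>+ x. H n x * indicator K x \<partial>M)"
        by (intro nn_integral_cong) (auto simp: H_def indicator_def sum_distrib_right)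
      also have "\<dots> \<le> (\<integral>\<^sup>+ x. ennreal (g x) * indicator K x \<partial>M)"
        unfolding Hh by (intro nn_integral_mono mult_right_mono ennreal_leI h_le) auto
      also have "\<dots> \<le> C" using le K by simp
      finally show "(\<Sum>k\<in>A n. ennreal (s n) * emeasure M (K \<inter> U n k)) \<le> C" .
    qed
    finally show ?thesis .
  qed
  \<comment> \<open>The grids for successive \<open>n\<close> do not refine one another, so Fatou's
    lemma is used instead of monotone convergence.\<close>
  have "(\<integral>\<^sup>+ x. ennreal (g x) \<partial>M) = (\<integral>\<^sup>+ x. liminf (\<lambda>n. H n x) \<partial>M)"
    unfolding Hh
    by (intro nn_integral_cong lim_imp_Liminf [symmetric] tendsto_ennrealI lim trivial_limit_sequentially)
  also have "\<dots> \<le> liminf (\<lambda>n. \<integral>\<^sup>+ x. H n x \<partial>M)"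
    by (rule nn_integral_liminf) (unfold H_def, use Us in measurable)
  also have "\<dots> \<le> limsup (\<lambda>n. \<integral>\<^sup>+ x. H n x \<partial>M)" by (rule Liminf_le_Limsup) simp
  also have "\<dots> \<le> C" by (rule Limsup_bounded) (simp add: bound)
  finally show ?thesis .
qed

subsection \<open>Strict limits and extensions as limits along filters\<close>

definition Bnet :: "'x::t2_space measure \<Rightarrow> ('x \<Rightarrow> real) filter" where
  "Bnet M = (INF l0\<in>Bset M. principal {l \<in> Bset M. \<forall>x. l0 x \<le> l x})"

definition unit_net :: "'a::cstar_algebra filter" where
  "unit_net = (INF e0\<in>approx_unit. principal {e \<in> approx_unit. cle e0 e})"

lemma Bset_zero: "(\<lambda>x. 0) \<in> Bset M"
  unfolding Bset_def by (auto intro!: exI [of _ "{}"])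

lemma Bset_max:
  assumes "l \<in> Bset M" "l' \<in> Bset M" shows "(\<lambda>x. max (l x) (l' x)) \<in> Bset M"
proof -
  obtain K K' where K: "compact K" "\<And>x. x \<notin> K \<Longrightarrow> l x = 0" "compact K'" "\<And>x. x \<notin> K' \<Longrightarrow> l' x = 0"
    using assms unfolding Bset_def by blast
  then have "\<exists>K. compact K \<and> (\<forall>x. x \<notin> K \<longrightarrow> max (l x) (l' x) = 0)"
    by (intro exI [of _ "K \<union> K'"]) (auto intro: compact_Un)
  moreover have "(\<lambda>x. max (l x) (l' x)) \<in> borel_measurable M"
    using BsetD(1) [OF assms(1)] BsetD(1) [OF assms(2)] by measurable
  moreover have "0 \<le> max (l x) (l' x) \<and> max (l x) (l' x) \<le> 1" for x
    using BsetD(2,3) [OF assms(1), of x] BsetD(2,3) [OF assms(2), of x] by auto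
  ultimately show ?thesis unfolding Bset_def by blast
qed

text \<open>Makes the set of compressed differences convex, as the separation argument
  requires.\<close>

lemma Bset_convex:
  assumes "l \<in> Bset M" "l' \<in> Bset M" "0 \<le> u" "0 \<le> v" "u + v = 1"
  shows "(\<lambda>x. u * l x + v * l' x) \<in> Bset M"
proof -
  obtain K K' where K: "compact K" "\<And>x. x \<notin> K \<Longrightarrow> l x = 0" "compact K'" "\<And>x. x \<notin> K' \<Longrightarrow> l' x = 0"
    using assms(1,2) unfolding Bset_def by blast
  then have "\<exists>K. compact K \<and> (\<forall>x. x \<notin> K \<longrightarrow> u * l x + v * l' x = 0)"
    by (intro exI [of _ "K \<union> K'"]) (auto intro: compact_Un)
  moreover have "(\<lambda>x. u * l x + v * l' x) \<in> borel_measurable M"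
    using BsetD(1) [OF assms(1)] BsetD(1) [OF assms(2)] by measurable
  moreover have "0 \<le> u * l x + v * l' x \<and> u * l x + v * l' x \<le> 1" for x
    using BsetD(2,3) [OF assms(1), of x] BsetD(2,3) [OF assms(2), of x] assms(3-5)
    by (auto intro: convex_bound_le)
  ultimately show ?thesis unfolding Bset_def by blast
qed

lemma Bset_indicator:
  assumes "radon M" "compact K" shows "indicator K \<in> Bset M"
proof -
  have "(indicator K :: _ \<Rightarrow> real) \<in> borel_measurable M"
    using radon_compact_sets [OF assms] by measurable
  with assms(2) show ?thesis unfolding Bset_def by (auto simp: indicator_def intro!: exI [of _ K])
qed

lemma eventually_Bnet:
  "eventually P (Bnet M) \<longleftrightarrow> (\<exists>l0\<in>Bset M. \<forall>l\<in>Bset M. (\<forall>x. l0 x \<le> l x) \<longrightarrow> P l)"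
proof -
  have "\<exists>l\<in>Bset M. principal {k \<in> Bset M. \<forall>x. l x \<le> k x} \<le>
    inf (principal {k \<in> Bset M. \<forall>x. a x \<le> k x}) (principal {k \<in> Bset M. \<forall>x. b x \<le> k x})"
    if "a \<in> Bset M" "b \<in> Bset M" for a b
    by (rule bexI [OF _ Bset_max [OF that]]) auto
  moreover have "Bset M \<noteq> {}" using Bset_zero by blast
  ultimately have "eventually P (Bnet M) \<longleftrightarrow> (\<exists>l0\<in>Bset M. eventually P (principal {l \<in> Bset M. \<forall>x. l0 x \<le> l x}))"
    unfolding Bnet_def by (intro eventually_INF_base)
  then show ?thesis unfolding eventually_principal by blast
qed

lemma Bnet_nontrivial: "Bnet M \<noteq> bot"
  unfolding trivial_limit_def eventually_Bnet by auto

lemma eventually_Bset: "eventually (\<lambda>l. l \<in> Bset M) (Bnet M)"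
  unfolding eventually_Bnet using Bset_zero by blast

lemma approx_unit_nonempty: "approx_unit \<noteq> {}"
  by (auto simp: approx_unit_def intro!: exI [of _ 0])

lemma eventually_unit_net:
  "eventually P unit_net \<longleftrightarrow> (\<exists>e0\<in>approx_unit. \<forall>e\<in>approx_unit. cle e0 e \<longrightarrow> P e)"
proof -
  have "\<exists>e\<in>approx_unit. principal {k \<in> approx_unit. cle e k} \<le>
    inf (principal {k \<in> approx_unit. cle a k}) (principal {k \<in> approx_unit. cle b k})"
    if ab: "a \<in> approx_unit" "b \<in> approx_unit" for a b :: 'a
  proof -
    obtain e where e: "e \<in> approx_unit" "cle a e" "cle b e" using approx_unit_directed [OF ab] by blast
    then show ?thesis by (intro bexI [of _ e]) (auto intro: cle_trans)
  qed
  then have "eventually P unit_net \<longleftrightarrow> (\<exists>e0\<in>approx_unit. eventually P (principal {e \<in> approx_unit. cle e0 e}))"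
    unfolding unit_net_def by (intro eventually_INF_base approx_unit_nonempty)
  then show ?thesis unfolding eventually_principal by blast
qed

lemma unit_net_nontrivial: "unit_net \<noteq> bot"
  unfolding trivial_limit_def eventually_unit_net using cle_refl by blast

lemma ext_value_iff: "ext_value \<omega> m c \<longleftrightarrow> ((\<lambda>e. \<omega> (fst m e)) \<longlongrightarrow> c) unit_net"
  unfolding ext_value_def tendsto_iff eventually_unit_net dist_norm ..

lemma unit_net_left: "((\<lambda>e. e * c) \<longlongrightarrow> c) unit_net" for c :: "'a::cstar_algebra"
  unfolding tendsto_iff eventually_unit_net dist_norm
  by (metis approx_unit_left norm_minus_commute)

lemma unit_net_right: "((\<lambda>e. c * e) \<longlongrightarrow> c) unit_net" for c :: "'a::cstar_algebra"
  unfolding tendsto_iff eventually_unit_net dist_norm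
  by (metis approx_unit_right norm_minus_commute)

lemma P_proper_iff:
  "P_proper M f \<longleftrightarrow> (\<exists>m\<in>multipliers. \<forall>a. ((\<lambda>l. p_lam M l f * a) \<longlongrightarrow> fst m a) (Bnet M) \<and>
     ((\<lambda>l. a * p_lam M l f) \<longlongrightarrow> snd m a) (Bnet M))"
proof -
  have "(\<forall>\<epsilon>>0. \<exists>l0\<in>Bset M. \<forall>l\<in>Bset M. (\<forall>x. l0 x \<le> l x) \<longrightarrow>
        norm (p_lam M l f * a - fst m a) < \<epsilon> \<and> norm (a * p_lam M l f - snd m a) < \<epsilon>) \<longleftrightarrow>
      ((\<lambda>l. p_lam M l f * a) \<longlongrightarrow> fst m a) (Bnet M) \<and> ((\<lambda>l. a * p_lam M l f) \<longlongrightarrow> snd m a) (Bnet M)" for m a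
    unfolding tendsto_iff dist_norm eventually_Bnet [symmetric] eventually_conj_iff by blast
  then show ?thesis unfolding P_proper_def by simp
qed

subsection \<open>Positive functionals\<close>

lemma pos_functional_cpos:
  "pos_functional \<omega> \<Longrightarrow> cpos a \<Longrightarrow> Im (\<omega> a) = 0" "pos_functional \<omega> \<Longrightarrow> cpos a \<Longrightarrow> 0 \<le> Re (\<omega> a)"
  by (simp_all add: pos_functional_def)

lemma pos_functional_of_real: "pos_functional \<omega> \<Longrightarrow> cpos a \<Longrightarrow> \<omega> a = complex_of_real (Re (\<omega> a))"
  by (simp add: complex_eq_iff pos_functional_cpos)

lemma pos_functional_mono:
  assumes "pos_functional \<omega>" "cle a b" shows "Re (\<omega> a) \<le> Re (\<omega> b)"
proof -
  interpret bounded_linear \<omega> by (rule pos_functional_linear [OF assms(1)])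
  show ?thesis using pos_functional_cpos(2) [OF assms(1), of "b - a"] assms(2) by (simp add: cle_def diff)
qed

lemma pos_functional_conj:
  assumes w: "pos_functional \<omega>" shows "pos_functional (\<lambda>x. \<omega> (cstar c * x * c))"
proof -
  interpret bounded_linear \<omega> by (rule pos_functional_linear [OF w])
  obtain K where K: "0 \<le> K" "\<And>x. cmod (\<omega> x) \<le> norm x * K" using nonneg_bounded by blast
  have "cmod (\<omega> (cstar c * x * c)) \<le> (norm c * norm c * K) * norm x" for x
  proof -
    have "norm (cstar c * x * c) \<le> norm (cstar c * x) * norm c" by (rule norm_mult_ineq)
    also have "\<dots> \<le> (norm (cstar c) * norm x) * norm c" by (intro mult_right_mono norm_mult_ineq) simp
    finally have "norm (cstar c * x * c) * K \<le> ((norm (cstar c) * norm x) * norm c) * K"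
      using K(1) by (rule mult_right_mono)
    with K(2) [of "cstar c * x * c"] show ?thesis by (simp add: mult_ac)
  qed
  moreover have "\<omega> (cscale z x) = z * \<omega> x" for z x using w by (simp add: pos_functional_def)
  moreover have "Im (\<omega> (cstar c * a * c)) = 0 \<and> 0 \<le> Re (\<omega> (cstar c * a * c))" if "cpos a" for a
    using pos_functional_cpos [OF w cpos_conj [OF that]] by simp
  moreover have "\<omega> (cstar c * (a + b) * c) = \<omega> (cstar c * a * c) + \<omega> (cstar c * b * c)" for a b
    by (simp add: distrib_left distrib_right add)
  ultimately show ?thesis unfolding pos_functional_def
    by (auto simp: mult_cscale_left mult_cscale_right)
qed

lemma cauchy_schwarz:
  fixes \<omega> :: "'a::cstar_algebra \<Rightarrow> complex"
  assumes w: "pos_functional \<omega>"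
  shows "(cmod (\<omega> (cstar x * y)))\<^sup>2 \<le> Re (\<omega> (cstar x * x)) * Re (\<omega> (cstar y * y))"
proof -
  interpret bounded_linear \<omega> by (rule pos_functional_linear [OF w])
  have sc: "\<omega> (cscale z x) = z * \<omega> x" for z x using w by (simp add: pos_functional_def)
  define A D h k where "A = Re (\<omega> (cstar x * x))" and "D = Re (\<omega> (cstar y * y))"
    and "h = \<omega> (cstar x * y)" and "k = \<omega> (cstar y * x)"
  have Ae: "\<omega> (cstar x * x) = of_real A" "\<omega> (cstar y * y) = of_real D"
    using pos_functional_of_real [OF w cpos_cstar_mult] by (simp_all add: A_def D_def)
  have nn: "0 \<le> A" "0 \<le> D" using pos_functional_cpos(2) [OF w cpos_cstar_mult] by (simp_all add: A_def D_def)
  have ex: "\<omega> (cstar (cscale c x + y) * (cscale c x + y)) = c * cnj c * of_real A + cnj c * h + c * k + of_real D" for c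
    by (simp add: cstar_simps distrib_left distrib_right add sc mult_cscale_left mult_cscale_right
        cscale_assoc Ae h_def k_def)
  have im: "Im (c * cnj c * of_real A + cnj c * h + c * k + of_real D) = 0"
    and re: "0 \<le> Re (c * cnj c * of_real A + cnj c * h + c * k + of_real D)" for c
    using pos_functional_cpos [OF w cpos_cstar_mult [of "cscale c x + y"]] by (simp_all add: ex)
  \<comment> \<open>Reality of the form at \<open>c = 1\<close> and \<open>c = i\<close> gives its
    hermitian symmetry.\<close>
  have kh: "k = cnj h" using im [of 1] im [of \<i>] by (simp add: complex_eq_iff)
  have q: "0 \<le> t\<^sup>2 * (cmod h)\<^sup>2 * A - 2 * t * (cmod h)\<^sup>2 + D" for t
  proof -
    \<comment> \<open>The factor \<open>h\<close> rotates both cross terms onto the real axis,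
      leaving a real quadratic in \<open>t\<close>, later taken at \<open>1 / A\<close>.\<close>
    let ?c = "- of_real t * h"
    have "?c * cnj ?c * of_real A + cnj ?c * h + ?c * k + of_real D =
       of_real (t\<^sup>2) * (h * cnj h) * of_real A - 2 * of_real t * (h * cnj h) + of_real D"
      by (simp add: kh power2_eq_square algebra_simps)
    also have "h * cnj h = of_real ((cmod h)\<^sup>2)" by (rule complex_norm_square [symmetric])
    also have "of_real (t\<^sup>2) * of_real ((cmod h)\<^sup>2) * of_real A - 2 * of_real t * of_real ((cmod h)\<^sup>2) + of_real D =
       complex_of_real (t\<^sup>2 * (cmod h)\<^sup>2 * A - 2 * t * (cmod h)\<^sup>2 + D)" by simp
    finally show ?thesis using re [of ?c] by simp
  qed
  show ?thesis
  proof (cases "A = 0")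
    case True
    have "h = 0"
    proof (rule ccontr)
      assume "h \<noteq> 0"
      \<comment> \<open>With \<open>A = 0\<close> the quadratic is affine; at this \<open>t\<close>
        its value is \<open>D - 2 (D + 1) < 0\<close>.\<close>
      then show False using q [of "(D + 1) / (cmod h)\<^sup>2"] nn by (simp add: True)
    qed
    then show ?thesis using nn by (simp flip: A_def D_def h_def)
  next
    case False
    then have "0 < A" using nn by simp
    then have "(cmod h)\<^sup>2 \<le> A * D" using q [of "1 / A"] by (simp add: field_simps power2_eq_square)
    then show ?thesis by (simp flip: A_def D_def h_def)
  qed
qed

text \<open>If \<open>\<omega> e\<close> is within \<open>\<delta>\<close> of its supremum, then for \<open>e' \<ge> e\<close> the Cauchy--Schwarz inequality and
  \<open>(e' - e)\<^sup>2 \<le> e' - e\<close> bound \<open>\<omega> (x * (e' - e))\<close>.\<close>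

lemma pos_functional_unit_net:
  fixes \<omega> :: "'a::cstar_algebra \<Rightarrow> complex"
  assumes w: "pos_functional \<omega>" and eps: "0 < \<epsilon>"
  shows "eventually (\<lambda>e. \<forall>x. cmod (\<omega> x - \<omega> (x * e)) \<le> \<epsilon> * norm x) unit_net"
proof -
  interpret bounded_linear \<omega> by (rule pos_functional_linear [OF w])
  obtain B where B: "0 < B" "\<And>x. cmod (\<omega> x) \<le> norm x * B" using pos_bounded by blast
  \<comment> \<open>Makes the Cauchy--Schwarz product
    \<open>(B * (norm x)\<^sup>2) * \<delta>\<close> equal to the square of
    \<open>\<epsilon> * norm x\<close>.\<close>
  define \<delta> where "\<delta> = \<epsilon>\<^sup>2 / B"
  have "0 < \<delta>" using B eps by (simp add: \<delta>_def)
  let ?S = "(\<lambda>e. Re (\<omega> e)) ` approx_unit"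
  have "Re (\<omega> e) \<le> B" if "e \<in> approx_unit" for e
  proof -
    have "Re (\<omega> e) \<le> norm e * B" using B(2) [of e] complex_Re_le_cmod [of "\<omega> e"] by linarith
    also have "\<dots> \<le> 1 * B" using that B(1) by (intro mult_right_mono) (auto simp: approx_unit_def)
    finally show ?thesis by simp
  qed
  then have bdd: "bdd_above ?S" by (auto simp: bdd_above_def)
  have ne: "?S \<noteq> {}" using approx_unit_nonempty by blast
  have "\<exists>y\<in>?S. Sup ?S - \<delta> < y"
    using less_cSup_iff [OF ne bdd, of "Sup ?S - \<delta>"] \<open>0 < \<delta>\<close> by simp
  then obtain e0 where e0: "e0 \<in> approx_unit" "Sup ?S - \<delta> < Re (\<omega> e0)" by blast
  have "cmod (\<omega> x - \<omega> (x * e)) \<le> \<epsilon> * norm x" if e: "e \<in> approx_unit" "cle e0 e" for e x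
  proof -
    have near: "cmod (\<omega> (x * e') - \<omega> (x * e)) \<le> \<epsilon> * norm x" if e': "e' \<in> approx_unit" "cle e e'" for e'
    proof -
      define d where "d = e' - e"
      have d: "cpos d" using e' by (simp add: d_def cle_def)
      have "norm d \<le> norm e'"
        using e(1) by (intro norm_mono d) (simp add: d_def approx_unit_def)
      then have "norm d \<le> 1" using e' by (simp add: approx_unit_def)
      then have dd: "cle (d * d) d" using cpos_diff_square [OF d] by (simp add: cle_def)
      have "Re (\<omega> e') \<le> Sup ?S" using e' bdd by (intro cSup_upper) auto
      moreover have "Re (\<omega> e0) \<le> Re (\<omega> e)" by (rule pos_functional_mono [OF w e(2)])
      ultimately have "Re (\<omega> d) \<le> \<delta>" using e0(2) by (simp add: d_def diff)
      then have d2: "Re (\<omega> (d * d)) \<le> \<delta>" using pos_functional_mono [OF w dd] by simp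
      have "Re (\<omega> (cstar (cstar x) * cstar x)) \<le> B * (norm x)\<^sup>2"
        using B(2) [of "x * cstar x"] complex_Re_le_cmod [of "\<omega> (x * cstar x)"] cstar_identity [of "cstar x"]
        by (simp add: power2_eq_square mult.commute)
      then have "Re (\<omega> (cstar (cstar x) * cstar x)) * Re (\<omega> (cstar d * d)) \<le> (B * (norm x)\<^sup>2) * \<delta>"
        using d2 B(1) pos_functional_cpos(2) [OF w cpos_cstar_mult [of d]]
        by (intro mult_mono) (simp_all add: cpos_cstar [OF d])
      also have "\<dots> = (\<epsilon> * norm x)\<^sup>2" using B(1) by (simp add: \<delta>_def power_mult_distrib)
      finally have "(cmod (\<omega> (x * d)))\<^sup>2 \<le> (\<epsilon> * norm x)\<^sup>2"
        using cauchy_schwarz [OF w, of "cstar x" d] by simp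
      then have "cmod (\<omega> (x * d)) \<le> \<epsilon> * norm x" by (rule power2_le_imp_le) (use eps in simp)
      then show ?thesis by (simp add: d_def right_diff_distrib diff)
    qed
    have "((\<lambda>e'. cmod (\<omega> (x * e') - \<omega> (x * e))) \<longlongrightarrow> cmod (\<omega> x - \<omega> (x * e))) unit_net"
      by (intro tendsto_intros tendsto unit_net_right)
    moreover have "eventually (\<lambda>e'. cmod (\<omega> (x * e') - \<omega> (x * e)) \<le> \<epsilon> * norm x) unit_net"
      unfolding eventually_unit_net using e(1) near by blast
    ultimately show ?thesis by (rule tendsto_upperbound) (rule unit_net_nontrivial)
  qed
  with e0(1) show ?thesis unfolding eventually_unit_net by blast
qed

subsection \<open>The net of weak integrals of a positive function\<close>

context
  fixes M :: "'x::t2_space measure" and f :: "'x \<Rightarrow> 'a::cstar_algebra"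
  assumes M: "radon M" and f: "continuous_on UNIV f" and pos: "\<And>x. cpos (f x)"
begin

text \<open>\<open>cnj (\<phi> (cstar x))\<close> is again a bounded functional of \<open>x\<close>,
  and it sends \<open>f x\<close> to the conjugate of \<open>\<phi> (f x)\<close>.\<close>

lemma p_lam_selfadjoint:
  assumes l: "l \<in> Bset M" shows "cstar (p_lam M l f) = p_lam M l f"
proof (rule bounded_functional_eqI)
  fix \<phi> :: "'a \<Rightarrow> complex" assume phi: "bounded_functional \<phi>"
  define \<psi> where "\<psi> x = cnj (\<phi> (cstar x))" for x
  have "bounded_functional \<psi>"
    using phi unfolding bounded_functional_def \<psi>_def by (simp add: cstar_add cstar_cscale) (metis norm_cstar)
  from p_lam_functional [OF M f l this] have "\<psi> (p_lam M l f) = (LINT x|M. cnj (l x *\<^sub>R \<phi> (f x)))"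
    by (simp add: \<psi>_def cpos_cstar [OF pos])
  also have "\<dots> = cnj (\<phi> (p_lam M l f))"
    unfolding p_lam_functional [OF M f l phi] by (rule Bochner_Integration.integral_cnj)
  finally show "\<phi> (cstar (p_lam M l f)) = \<phi> (p_lam M l f)" by (simp add: \<psi>_def)
qed

lemma functional_continuous: "bounded_functional \<phi> \<Longrightarrow> continuous_on UNIV (\<lambda>x. \<phi> (f x))"
  by (rule bounded_linear.continuous_on [OF bounded_functional_linear f])

lemma p_lam_Re:
  assumes l: "l \<in> Bset M" and phi: "bounded_functional \<phi>"
  shows "integrable M (\<lambda>x. l x * Re (\<phi> (f x)))" "Re (\<phi> (p_lam M l f)) = (LINT x|M. l x * Re (\<phi> (f x)))"
proof -
  have int: "integrable M (\<lambda>x. l x *\<^sub>R \<phi> (f x))"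
    by (rule Bset_integrable [OF M l functional_continuous [OF phi]])
  show "integrable M (\<lambda>x. l x * Re (\<phi> (f x)))" using integrable_Re [OF int] by simp
  show "Re (\<phi> (p_lam M l f)) = (LINT x|M. l x * Re (\<phi> (f x)))"
    using integral_Re [OF int] by (simp add: p_lam_functional [OF M f l phi])
qed

lemma p_lam_mono:
  assumes l: "l \<in> Bset M" "l' \<in> Bset M" "\<And>x. l x \<le> l' x"
  shows "cle (p_lam M l f) (p_lam M l' f)"
  unfolding cle_def
proof (rule cpos_by_functionals)
  show "cstar (p_lam M l' f - p_lam M l f) = p_lam M l' f - p_lam M l f"
    by (simp add: cstar_diff p_lam_selfadjoint l)
  fix \<omega> :: "'a \<Rightarrow> complex" assume w: "pos_functional \<omega>"
  interpret bounded_linear \<omega> by (rule pos_functional_linear [OF w])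
  note bw = pos_functional_bounded [OF w]
  have "(LINT x|M. l x * Re (\<omega> (f x))) \<le> (LINT x|M. l' x * Re (\<omega> (f x)))"
    by (intro integral_mono p_lam_Re bw l mult_right_mono pos_functional_cpos(2) [OF w pos])
  then show "0 \<le> Re (\<omega> (p_lam M l' f - p_lam M l f))"
    by (simp add: diff p_lam_Re(2) [OF _ bw] l)
qed

lemma p_lam_cpos:
  assumes l: "l \<in> Bset M" shows "cpos (p_lam M l f)"
proof -
  have "p_lam M (\<lambda>x. 0) f = 0"
  proof (rule bounded_functional_eqI)
    fix \<phi> :: "'a \<Rightarrow> complex" assume phi: "bounded_functional \<phi>"
    show "\<phi> (p_lam M (\<lambda>x. 0) f) = \<phi> 0"
      using linear_0 [OF bounded_linear.linear [OF bounded_functional_linear [OF phi]]]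
      by (simp add: p_lam_functional [OF M f Bset_zero phi])
  qed
  then show ?thesis using p_lam_mono [OF Bset_zero l BsetD(2) [OF l]] by (simp add: cle_def)
qed

lemma p_lam_convex:
  assumes l: "l \<in> Bset M" "l' \<in> Bset M" and uv: "0 \<le> u" "0 \<le> v" "u + v = 1"
  shows "p_lam M (\<lambda>x. u * l x + v * l' x) f = u *\<^sub>R p_lam M l f + v *\<^sub>R p_lam M l' f"
proof (rule bounded_functional_eqI)
  fix \<phi> :: "'a \<Rightarrow> complex" assume phi: "bounded_functional \<phi>"
  interpret bounded_linear \<phi> by (rule bounded_functional_linear [OF phi])
  have "\<phi> (p_lam M (\<lambda>x. u * l x + v * l' x) f) = (LINT x|M. u *\<^sub>R (l x *\<^sub>R \<phi> (f x)) + v *\<^sub>R (l' x *\<^sub>R \<phi> (f x)))"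
    by (simp add: p_lam_functional [OF M f Bset_convex [OF l uv] phi] scaleR_add_left)
  also have "\<dots> = (LINT x|M. u *\<^sub>R (l x *\<^sub>R \<phi> (f x))) + (LINT x|M. v *\<^sub>R (l' x *\<^sub>R \<phi> (f x)))"
    using Bset_integrable [OF M l(1) functional_continuous [OF phi]]
      Bset_integrable [OF M l(2) functional_continuous [OF phi]]
    by (intro Bochner_Integration.integral_add integrable_scaleR_right)
  also have "\<dots> = u *\<^sub>R (LINT x|M. l x *\<^sub>R \<phi> (f x)) + v *\<^sub>R (LINT x|M. l' x *\<^sub>R \<phi> (f x))"
    by (simp only: integral_scaleR_right)
  finally show "\<phi> (p_lam M (\<lambda>x. u * l x + v * l' x) f) = \<phi> (u *\<^sub>R p_lam M l f + v *\<^sub>R p_lam M l' f)"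
    by (simp add: add scaleR p_lam_functional [OF M f _ phi] l)
qed

lemma nn_integral_le_by_p_lam:
  assumes w: "pos_functional \<omega>" and le: "\<And>K. compact K \<Longrightarrow> Re (\<omega> (p_lam M (indicator K) f)) \<le> C"
  shows "(\<integral>\<^sup>+ x. ennreal (Re (\<omega> (f x))) \<partial>M) \<le> ennreal C"
proof (rule nn_integral_le_by_compacts [OF M])
  note bw = pos_functional_bounded [OF w]
  show "continuous_on UNIV (\<lambda>x. Re (\<omega> (f x)))" by (intro continuous_on_Re functional_continuous bw)
  show nn: "0 \<le> Re (\<omega> (f x))" for x by (rule pos_functional_cpos(2) [OF w pos])
  fix K :: "'x set" assume K: "compact K"
  note l = Bset_indicator [OF M K]
  have "(\<integral>\<^sup>+ x. ennreal (Re (\<omega> (f x))) * indicator K x \<partial>M) = (\<integral>\<^sup>+ x. ennreal (indicator K x * Re (\<omega> (f x))) \<partial>M)"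
    by (intro nn_integral_cong) (simp add: indicator_def)
  also have "\<dots> = ennreal (LINT x|M. indicator K x * Re (\<omega> (f x)))"
    using nn by (intro nn_integral_eq_integral p_lam_Re(1) [OF l bw]) simp
  also have "\<dots> \<le> ennreal C" by (simp flip: p_lam_Re(2) [OF l bw] add: ennreal_leI le [OF K])
  finally show "(\<integral>\<^sup>+ x. ennreal (Re (\<omega> (f x))) * indicator K x \<partial>M) \<le> ennreal C" .
qed

lemma integrable_by_p_lam:
  assumes w: "pos_functional \<omega>" and le: "\<And>l. l \<in> Bset M \<Longrightarrow> Re (\<omega> (p_lam M l f)) \<le> C"
  shows "integrable M (\<lambda>x. \<omega> (f x))"
proof -
  have "(\<integral>\<^sup>+ x. ennreal (Re (\<omega> (f x))) \<partial>M) \<le> ennreal C"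
    by (rule nn_integral_le_by_p_lam [OF w le [OF Bset_indicator [OF M]]])
  also have "\<dots> < \<infinity>" by simp
  finally have fin: "(\<integral>\<^sup>+ x. ennreal (Re (\<omega> (f x))) \<partial>M) < \<infinity>" .
  have eq: "norm (\<omega> (f x)) = Re (\<omega> (f x))" for x
    using pos_functional_of_real [OF w pos, of x] pos_functional_cpos(2) [OF w pos, of x]
    by (metis abs_of_nonneg norm_of_real)
  show ?thesis
  proof (rule integrableI_bounded)
    show "(\<lambda>x. \<omega> (f x)) \<in> borel_measurable M"
      by (intro radon_continuous_measurable [OF M] functional_continuous pos_functional_bounded w)
    show "(\<integral>\<^sup>+ x. ennreal (norm (\<omega> (f x))) \<partial>M) < \<infinity>" using fin by (simp add: eq)
  qed
qed

lemma p_lam_tendsto: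
  assumes w: "pos_functional \<omega>" and int: "integrable M (\<lambda>x. \<omega> (f x))"
  shows "((\<lambda>l. \<omega> (p_lam M l f)) \<longlongrightarrow> (LINT x|M. \<omega> (f x))) (Bnet M)"
    and "l \<in> Bset M \<Longrightarrow> Re (\<omega> (p_lam M l f)) \<le> Re (LINT x|M. \<omega> (f x))"
proof -
  note bw = pos_functional_bounded [OF w]
  have nn: "0 \<le> Re (\<omega> (f x))" for x by (rule pos_functional_cpos(2) [OF w pos])
  have intR: "integrable M (\<lambda>x. Re (\<omega> (f x)))" by (rule integrable_Re [OF int])
  define I where "I = (LINT x|M. Re (\<omega> (f x)))"
  have I: "(LINT x|M. \<omega> (f x)) = of_real I"
  proof -
    have "(LINT x|M. \<omega> (f x)) = (LINT x|M. complex_of_real (Re (\<omega> (f x))))"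
      using pos_functional_of_real [OF w pos] by (intro Bochner_Integration.integral_cong) auto
    then show ?thesis by (simp add: I_def)
  qed
  have upper: "Re (\<omega> (p_lam M l f)) \<le> I" if l: "l \<in> Bset M" for l
    unfolding p_lam_Re(2) [OF l bw] I_def
    using BsetD [OF l] nn by (intro integral_mono p_lam_Re(1) [OF l bw] intR mult_left_le_one_le)
  then show "l \<in> Bset M \<Longrightarrow> Re (\<omega> (p_lam M l f)) \<le> Re (LINT x|M. \<omega> (f x))" by (simp add: I)
  have "((\<lambda>l. Re (\<omega> (p_lam M l f))) \<longlongrightarrow> I) (Bnet M)"
  proof (rule order_tendstoI)
    fix c assume "c < I"
    have "\<exists>K. compact K \<and> c < Re (\<omega> (p_lam M (indicator K) f))"
    proof (rule ccontr)
      assume "\<nexists>K. compact K \<and> c < Re (\<omega> (p_lam M (indicator K) f))"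
      then have le: "Re (\<omega> (p_lam M (indicator K) f)) \<le> c" if "compact K" for K using that by (meson not_le)
      \<comment> \<open>\<open>ennreal\<close> sends negative reals to 0, so the sign of
        \<open>c\<close> must be known before \<open>ennreal I \<le> ennreal c\<close> can be read
        in the reals. The empty compact set supplies it.\<close>
      have "0 \<le> c"
        using le [OF compact_empty] pos_functional_cpos(2) [OF w p_lam_cpos [OF Bset_indicator [OF M compact_empty]]]
        by linarith
      moreover have "ennreal I \<le> ennreal c"
        using nn_integral_le_by_p_lam [OF w le] nn_integral_eq_integral [OF intR] nn by (simp add: I_def)
      ultimately show False using \<open>c < I\<close> by simp
    qed
    then obtain K where K: "compact K" "c < Re (\<omega> (p_lam M (indicator K) f))" by blast
    have "c < Re (\<omega> (p_lam M l f))" if "l \<in> Bset M" "\<forall>x. indicator K x \<le> l x" for l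
      using pos_functional_mono [OF w p_lam_mono [OF Bset_indicator [OF M K(1)] that(1)]] that(2) K(2)
      by fastforce
    then show "eventually (\<lambda>l. c < Re (\<omega> (p_lam M l f))) (Bnet M)"
      unfolding eventually_Bnet using Bset_indicator [OF M K(1)] by blast
  next
    fix c assume "I < c"
    then have "Re (\<omega> (p_lam M l f)) < c" if "l \<in> Bset M" for l using upper [OF that] by simp
    then show "eventually (\<lambda>l. Re (\<omega> (p_lam M l f)) < c) (Bnet M)"
      by (rule eventually_mono [OF eventually_Bset])
  qed
  then have "((\<lambda>l. complex_of_real (Re (\<omega> (p_lam M l f)))) \<longlongrightarrow> of_real I) (Bnet M)"
    by (rule tendsto_of_real)
  moreover have "eventually (\<lambda>l. complex_of_real (Re (\<omega> (p_lam M l f))) = \<omega> (p_lam M l f)) (Bnet M)"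
    using eventually_Bset by (rule eventually_mono) (simp add: pos_functional_of_real [OF w p_lam_cpos, symmetric])
  ultimately show "((\<lambda>l. \<omega> (p_lam M l f)) \<longlongrightarrow> (LINT x|M. \<omega> (f x))) (Bnet M)"
    unfolding I by (rule Lim_transform_eventually)
qed

end

subsection \<open>Strict limits of positive nets\<close>

lemma cpos_sqrt:
  fixes a :: "'a::cstar_algebra"
  assumes "cpos a" shows "\<exists>r. cstar r = r \<and> r * r = a"
proof -
  have t: "norm a \<le> norm a + 1" "0 < norm a + 1" by (simp_all add: add_nonneg_pos)
  show ?thesis using cpos_sqrt_sums [OF assms t] by blast
qed

text \<open>In the unitization the iterated map is multiplication by the contraction
  \<open>1 - a / t\<close>. The bound does not depend on \<open>a\<close>, which gives the summable
  majorant for \<open>sqrt_strict_limit\<close>.\<close>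

lemma cpos_contraction_power:
  fixes a :: "'a::cstar_algebra"
  assumes "cpos a" "norm a \<le> t" "0 < t"
  shows "norm (((\<lambda>c. c - (1 / t) *\<^sub>R (a * c)) ^^ k) c) \<le> norm c"
proof (induction k)
  case (Suc k)
  have bd: "norm (t *\<^sub>R 1 - embed a) \<le> t"
    using assms spos_norm_diff [of "embed a" t] by (simp flip: cpos_iff_spos)
  have step: "norm (x - (1 / t) *\<^sub>R (a * x)) \<le> norm x" for x
  proof -
    have "embed (x - (1 / t) *\<^sub>R (a * x)) = (1 - (1 / t) *\<^sub>R embed a) * embed x"
      by (simp add: embed_simps left_diff_distrib)
    then have "norm (x - (1 / t) *\<^sub>R (a * x)) = norm ((1 - (1 / t) *\<^sub>R embed a) * embed x)"
      by (metis norm_embed)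
    also have "\<dots> \<le> norm (1 - (1 / t) *\<^sub>R embed a) * norm (embed x)" by (rule norm_mult_ineq)
    also have "\<dots> \<le> 1 * norm (embed x)" by (intro mult_right_mono scaled_sqrt_arg assms bd norm_ge_zero)
    finally show ?thesis by simp
  qed
  show ?case using order_trans [OF step Suc] by simp
qed simp

text \<open>Strict continuity of the square root on bounded positive nets, by dominated convergence of the
  binomial series.\<close>

lemma sqrt_strict_limit:
  fixes a :: "'i \<Rightarrow> 'a::cstar_algebra"
  assumes F: "F \<noteq> bot" and t: "0 < t"
    and ev: "eventually (\<lambda>i. cpos (a i) \<and> norm (a i) \<le> t) F"
    and lim: "\<And>c. ((\<lambda>i. a i * c) \<longlongrightarrow> m c) F"
  obtains r n where "eventually (\<lambda>i. cstar (r i) = r i \<and> r i * r i = a i) F" "\<And>c. ((\<lambda>i. r i * c) \<longlongrightarrow> n c) F"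
proof -
  define T where "T b c = c - (1 / t) *\<^sub>R (b * c)" for b c :: 'a
  define T0 where "T0 c = c - (1 / t) *\<^sub>R m c" for c
  have "\<forall>i. \<exists>r. cpos (a i) \<and> norm (a i) \<le> t \<longrightarrow> cstar r = r \<and> r * r = a i \<and>
     (\<forall>c. (\<lambda>k. sqrt t *\<^sub>R sqrt_coeff k *\<^sub>R (T (a i) ^^ k) c) sums (r * c))"
    unfolding T_def using cpos_sqrt_sums [OF _ _ t] by metis
  from choice [OF this] obtain r where r: "\<forall>i. cpos (a i) \<and> norm (a i) \<le> t \<longrightarrow> cstar (r i) = r i \<and> r i * r i = a i \<and>
     (\<forall>c. (\<lambda>k. sqrt t *\<^sub>R sqrt_coeff k *\<^sub>R (T (a i) ^^ k) c) sums (r i * c))" ..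
  have Tlim: "((\<lambda>i. (T (a i) ^^ k) c) \<longlongrightarrow> (T0 ^^ k) c) F" for k c
  proof (induction k)
    case (Suc k)
    let ?x = "\<lambda>i. (T (a i) ^^ k) c" and ?y = "(T0 ^^ k) c"
    \<comment> \<open>Strict convergence controls \<open>a i\<close> only on fixed vectors; the
      uniform bound \<open>t\<close> lets the moving \<open>?x i\<close> be replaced by its
      limit.\<close>
    have "((\<lambda>i. a i * (?x i - ?y)) \<longlongrightarrow> 0) F"
    proof (rule Lim_null_comparison)
      show "eventually (\<lambda>i. norm (a i * (?x i - ?y)) \<le> t * norm (?x i - ?y)) F"
        using ev
      proof (rule eventually_mono)
        fix i assume "cpos (a i) \<and> norm (a i) \<le> t"
        then show "norm (a i * (?x i - ?y)) \<le> t * norm (?x i - ?y)"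
          by (intro order_trans [OF norm_mult_ineq] mult_right_mono) auto
      qed
      show "((\<lambda>i. t * norm (?x i - ?y)) \<longlongrightarrow> 0) F"
        using tendsto_mult_left [OF tendsto_norm_zero [OF LIM_zero [OF Suc]], of t] by simp
    qed
    from tendsto_add [OF this lim [of ?y]] have "((\<lambda>i. a i * ?x i) \<longlongrightarrow> m ?y) F"
      by (simp add: right_diff_distrib)
    then have "((\<lambda>i. ?x i - (1 / t) *\<^sub>R (a i * ?x i)) \<longlongrightarrow> ?y - (1 / t) *\<^sub>R m ?y) F"
      by (intro tendsto_intros Suc)
    moreover have "(T (a i) ^^ Suc k) c = ?x i - (1 / t) *\<^sub>R (a i * ?x i)" for i
      by (simp add: T_def [of "a i" "?x i"])
    moreover have "(T0 ^^ Suc k) c = ?y - (1 / t) *\<^sub>R m ?y" by (simp add: T0_def [of ?y])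
    ultimately show ?case by (simp only:)
  qed simp
  have "((\<lambda>i. r i * c) \<longlongrightarrow> (\<Sum>k. sqrt t *\<^sub>R sqrt_coeff k *\<^sub>R (T0 ^^ k) c)) F" for c
  proof -
    have bd: "norm (sqrt t *\<^sub>R sqrt_coeff k *\<^sub>R (T (a i) ^^ k) c) \<le> sqrt t * (\<bar>sqrt_coeff k\<bar> * norm c)"
      if "cpos (a i) \<and> norm (a i) \<le> t" for i k
    proof -
      have "norm ((T (a i) ^^ k) c) \<le> norm c"
        using cpos_contraction_power [of "a i" t k c] that t by (simp add: T_def [abs_def])
      then have "sqrt t * (\<bar>sqrt_coeff k\<bar> * norm ((T (a i) ^^ k) c)) \<le> sqrt t * (\<bar>sqrt_coeff k\<bar> * norm c)"
        using t by (intro mult_left_mono) auto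
      then show ?thesis using t by (simp add: abs_mult mult.assoc)
    qed
    have "((\<lambda>i. \<Sum>k. sqrt t *\<^sub>R sqrt_coeff k *\<^sub>R (T (a i) ^^ k) c) \<longlongrightarrow>
        (\<Sum>k. sqrt t *\<^sub>R sqrt_coeff k *\<^sub>R (T0 ^^ k) c)) F"
    proof (rule tannerys_theorem [THEN conjunct2, THEN conjunct2])
      show "((\<lambda>i. sqrt t *\<^sub>R sqrt_coeff k *\<^sub>R (T (a i) ^^ k) c) \<longlongrightarrow> sqrt t *\<^sub>R sqrt_coeff k *\<^sub>R (T0 ^^ k) c) F" for k
        by (intro tendsto_intros Tlim)
      show "eventually (\<lambda>(k, i). norm (sqrt t *\<^sub>R sqrt_coeff k *\<^sub>R (T (a i) ^^ k) c) \<le>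
          sqrt t * (\<bar>sqrt_coeff k\<bar> * norm c)) (at_top \<times>\<^sub>F F)"
        unfolding eventually_prod_filter
        by (rule exI [of _ "\<lambda>_. True"], rule exI [of _ "\<lambda>i. cpos (a i) \<and> norm (a i) \<le> t"])
           (use ev bd in auto)
      show "summable (\<lambda>k. sqrt t * (\<bar>sqrt_coeff k\<bar> * norm c))"
        by (intro summable_mult summable_mult2 summable_sqrt_coeff)
    qed (rule F)
    moreover have "eventually (\<lambda>i. (\<Sum>k. sqrt t *\<^sub>R sqrt_coeff k *\<^sub>R (T (a i) ^^ k) c) = r i * c) F"
      using ev
    proof (rule eventually_mono)
      fix i assume "cpos (a i) \<and> norm (a i) \<le> t"
      then show "(\<Sum>k. sqrt t *\<^sub>R sqrt_coeff k *\<^sub>R (T (a i) ^^ k) c) = r i * c"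
        using r by (intro sums_unique [symmetric]) blast
    qed
    ultimately show ?thesis by (rule Lim_transform_eventually)
  qed
  moreover have "eventually (\<lambda>i. cstar (r i) = r i \<and> r i * r i = a i) F"
    using ev by (rule eventually_mono) (use r in blast)
  ultimately show ?thesis by (intro that [of r "\<lambda>c. \<Sum>k. sqrt t *\<^sub>R sqrt_coeff k *\<^sub>R (T0 ^^ k) c"])
qed

lemma mpos_strict_limit:
  fixes a :: "'i \<Rightarrow> 'a::cstar_algebra"
  assumes F: "F \<noteq> bot" and t: "0 < t"
    and ev: "eventually (\<lambda>i. cpos (a i) \<and> norm (a i) \<le> t) F"
    and m: "m \<in> multipliers"
    and lim: "\<And>c. ((\<lambda>i. a i * c) \<longlongrightarrow> fst m c) F" "\<And>c. ((\<lambda>i. c * a i) \<longlongrightarrow> snd m c) F"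
  shows "mpos m"
proof -
  obtain r n where r: "eventually (\<lambda>i. cstar (r i) = r i \<and> r i * r i = a i) F"
    and n: "\<And>c. ((\<lambda>i. r i * c) \<longlongrightarrow> n c) F"
    using sqrt_strict_limit [OF F t ev lim(1)] by blast
  \<comment> \<open>The right action is the limit of \<open>c * r i\<close>, the adjoint of
    \<open>r i * cstar c\<close>; so \<open>N\<close> is self-adjoint by construction.\<close>
  define N where "N = (n, \<lambda>c. cstar (n (cstar c)))"
  have N: "N \<in> multipliers"
  proof -
    have "c * n d = cstar (n (cstar c)) * d" for c d
    proof (rule tendsto_unique [OF F])
      show "((\<lambda>i. c * (r i * d)) \<longlongrightarrow> c * n d) F" by (intro tendsto_intros n)
      have "((\<lambda>i. cstar (r i * cstar c) * d) \<longlongrightarrow> cstar (n (cstar c)) * d) F"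
        by (intro tendsto_intros tendsto_cstar n)
      moreover have "eventually (\<lambda>i. cstar (r i * cstar c) * d = c * (r i * d)) F"
        using r by (rule eventually_mono) (simp add: cstar_mult mult.assoc)
      ultimately show "((\<lambda>i. c * (r i * d)) \<longlongrightarrow> cstar (n (cstar c)) * d) F"
        by (rule Lim_transform_eventually)
    qed
    then show ?thesis by (simp add: N_def multipliers_def)
  qed
  have fst_m: "fst m c = n (n c)" for c
  proof (rule tendsto_unique [OF F lim(1)])
    have "((\<lambda>i. r i * (r i * c - n c)) \<longlongrightarrow> 0) F"
    proof (rule Lim_null_comparison)
      show "eventually (\<lambda>i. norm (r i * (r i * c - n c)) \<le> sqrt t * norm (r i * c - n c)) F"
        using eventually_conj [OF r ev]
      proof (rule eventually_mono)
        fix i assume i: "(cstar (r i) = r i \<and> r i * r i = a i) \<and> cpos (a i) \<and> norm (a i) \<le> t"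
        then have "(norm (r i))\<^sup>2 \<le> t" using cstar_self_mult [of "r i"] by (simp add: power2_eq_square)
        then have "norm (r i) \<le> sqrt t" by (rule real_le_rsqrt)
        then show "norm (r i * (r i * c - n c)) \<le> sqrt t * norm (r i * c - n c)"
          by (intro order_trans [OF norm_mult_ineq] mult_right_mono) auto
      qed
      show "((\<lambda>i. sqrt t * norm (r i * c - n c)) \<longlongrightarrow> 0) F"
        using tendsto_mult_left [OF tendsto_norm_zero [OF LIM_zero [OF n]], of "sqrt t"] by simp
    qed
    from tendsto_add [OF this n [of "n c"]] have "((\<lambda>i. r i * (r i * c)) \<longlongrightarrow> n (n c)) F"
      by (simp add: right_diff_distrib)
    moreover have "eventually (\<lambda>i. r i * (r i * c) = a i * c) F"
      using r by (rule eventually_mono) (simp flip: mult.assoc)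
    ultimately show "((\<lambda>i. a i * c) \<longlongrightarrow> n (n c)) F" by (rule Lim_transform_eventually)
  qed
  have snd_m: "snd m c = cstar (n (n (cstar c)))" for c
  proof (rule tendsto_unique [OF F lim(2)])
    have "((\<lambda>i. cstar (a i * cstar c)) \<longlongrightarrow> cstar (fst m (cstar c))) F"
      by (intro tendsto_cstar lim)
    moreover have "eventually (\<lambda>i. cstar (a i * cstar c) = c * a i) F"
      using ev by (rule eventually_mono) (simp add: cstar_mult cpos_cstar)
    ultimately show "((\<lambda>i. c * a i) \<longlongrightarrow> cstar (n (n (cstar c)))) F"
      unfolding fst_m by (rule Lim_transform_eventually)
  qed
  have "m = mmult (mstar N) N"
    by (rule prod_eqI) (auto simp: mmult_def mstar_def N_def fst_m snd_m)
  with m N show ?thesis by (auto simp: mpos_def)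
qed

text \<open>\<open>L\<close> is the left action of \<open>n\<close> where
  \<open>m = mmult (mstar n) n\<close>. The Gram form provides the hermitian symmetry used in the
  converse; the second property transfers left limits to right limits.\<close>

lemma mpos_form:
  assumes "mpos m"
  obtains L where "\<And>c d. cstar c * fst m d = cstar (L c) * L d" "\<And>c. snd m c = cstar (fst m (cstar c))"
proof -
  obtain n where n: "n \<in> multipliers" "m = mmult (mstar n) n" using assms by (auto simp: mpos_def)
  have fm: "fst m d = cstar (snd n (cstar (fst n d)))" for d by (simp add: n(2) mmult_def mstar_def)
  have "cstar c * fst m d = cstar (fst n c) * fst n d" for c d
  proof -
    have "cstar c * fst m d = cstar (snd n (cstar (fst n d)) * c)" by (simp add: fm cstar_mult)
    also have "snd n (cstar (fst n d)) * c = cstar (fst n d) * fst n c" by (simp add: multiplier_eq [OF n(1)])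
    finally show ?thesis by (simp add: cstar_mult)
  qed
  moreover have "snd m c = cstar (fst m (cstar c))" for c
    by (simp add: n(2) mmult_def mstar_def)
  ultimately show ?thesis by (rule that)
qed

subsection \<open>Integrability and strict convergence\<close>

context
  fixes M :: "'x::t2_space measure" and f :: "'x \<Rightarrow> 'a::cstar_algebra"
  assumes M: "radon M" and f: "continuous_on UNIV f" and pos: "\<And>x. cpos (f x)"
begin

text \<open>Strict convergence only bounds the net eventually and pointwise; monotonicity turns this into a
  bound on all of the net, and the square roots allow the uniform boundedness principle to be used.\<close>

lemma p_lam_bounded:
  assumes lim: "\<And>c. ((\<lambda>l. p_lam M l f * c) \<longlongrightarrow> m c) (Bnet M)"
  obtains C where "0 < C" "\<And>l. l \<in> Bset M \<Longrightarrow> norm (p_lam M l f) \<le> C"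
proof -
  have "\<exists>r. cstar r = r \<and> r * r = p_lam M l f" if "l \<in> Bset M" for l
    by (rule cpos_sqrt [OF p_lam_cpos [OF M f pos that]])
  then obtain r where r: "\<And>l. l \<in> Bset M \<Longrightarrow> cstar (r l) = r l" "\<And>l. l \<in> Bset M \<Longrightarrow> r l * r l = p_lam M l f"
    by metis
  have "\<exists>K\<ge>0. \<forall>l\<in>Bset M. \<forall>c. norm (r l * c) \<le> K * norm c"
  proof (rule uniform_boundedness)
    show "bounded_linear ((*) (r l))" for l by (rule bounded_linear_mult_right)
    fix c
    have "eventually (\<lambda>l. norm (p_lam M l f * c) < norm (m c) + 1) (Bnet M)"
      by (rule order_tendstoD(2) [OF tendsto_norm [OF lim]]) simp
    then obtain l0 where l0: "l0 \<in> Bset M"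
      "\<And>l. l \<in> Bset M \<Longrightarrow> (\<And>x. l0 x \<le> l x) \<Longrightarrow> norm (p_lam M l f * c) < norm (m c) + 1"
      unfolding eventually_Bnet by blast
    have "norm (r l * c) \<le> sqrt (norm c * (norm (m c) + 1))" if l: "l \<in> Bset M" for l
    proof -
      \<comment> \<open>Moves \<open>l\<close> into the tail where the bound from convergence holds;
        monotonicity brings the bound back to \<open>l\<close>.\<close>
      let ?l = "\<lambda>x. max (l x) (l0 x)"
      have l': "?l \<in> Bset M" by (rule Bset_max [OF l l0(1)])
      have "(norm (r l * c))\<^sup>2 = norm (cstar (r l * c) * (r l * c))"
        by (simp add: cstar_identity power2_eq_square)
      also have "cstar (r l * c) * (r l * c) = cstar c * p_lam M l f * c"
        by (simp add: cstar_mult r(1) [OF l] mult.assoc flip: r(2) [OF l])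
      also have "norm \<dots> \<le> norm (cstar c * p_lam M ?l f * c)"
      proof (rule norm_mono)
        show "cpos (cstar c * p_lam M l f * c)" by (intro cpos_conj p_lam_cpos [OF M f pos] l)
        have "cpos (cstar c * (p_lam M ?l f - p_lam M l f) * c)"
          using p_lam_mono [OF M f pos l l'] by (intro cpos_conj) (simp add: cle_def)
        then show "cpos (cstar c * p_lam M ?l f * c - cstar c * p_lam M l f * c)"
          by (simp add: right_diff_distrib left_diff_distrib)
      qed
      also have "\<dots> \<le> norm c * norm (p_lam M ?l f * c)"
        using norm_mult_ineq [of "cstar c" "p_lam M ?l f * c"] by (simp add: mult.assoc)
      also have "\<dots> \<le> norm c * (norm (m c) + 1)"
        by (rule mult_left_mono [OF less_imp_le [OF l0(2) [OF l']]]) simp_all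
      finally show ?thesis by (rule real_le_rsqrt)
    qed
    then show "\<exists>K. \<forall>l\<in>Bset M. norm (r l * c) \<le> K" by blast
  qed
  then obtain K where K: "0 \<le> K" "\<And>l c. l \<in> Bset M \<Longrightarrow> norm (r l * c) \<le> K * norm c" by blast
  \<comment> \<open>The added 1 makes the bound positive, since it will serve as the scale of a
    square root and as a divisor.\<close>
  have "norm (p_lam M l f) \<le> K * K + 1" if l: "l \<in> Bset M" for l
  proof -
    have "norm (r l) * norm (r l) \<le> K * norm (r l)"
      using K(2) [OF l, of "r l"] cstar_self_mult [OF r(1) [OF l]] by simp
    then have "norm (r l) \<le> K" using K(1) by (cases "r l = 0") auto
    then have "norm (r l) * norm (r l) \<le> K * K" by (intro mult_mono K) auto
    then show ?thesis using cstar_self_mult [OF r(1) [OF l]] by (simp add: r(2) [OF l])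
  qed
  moreover have "0 < K * K + 1" by (simp add: add_nonneg_pos)
  ultimately show ?thesis by (rule that [rotated])
qed

lemma proper_imp_integral:
  assumes m: "m \<in> multipliers"
    and lim: "\<And>c. ((\<lambda>l. p_lam M l f * c) \<longlongrightarrow> fst m c) (Bnet M)" "\<And>c. ((\<lambda>l. c * p_lam M l f) \<longlongrightarrow> snd m c) (Bnet M)"
  shows "mpos m"
    and "pos_functional \<omega> \<Longrightarrow> integrable M (\<lambda>x. \<omega> (f x))"
    and "pos_functional \<omega> \<Longrightarrow> ext_value \<omega> m (LINT x|M. \<omega> (f x))"
proof -
  obtain C where C: "0 < C" "\<And>l. l \<in> Bset M \<Longrightarrow> norm (p_lam M l f) \<le> C"
    using p_lam_bounded [OF lim(1)] by blast
  show "mpos m"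
  proof (rule mpos_strict_limit [OF Bnet_nontrivial C(1) _ m lim])
    show "eventually (\<lambda>l. cpos (p_lam M l f) \<and> norm (p_lam M l f) \<le> C) (Bnet M)"
      by (rule eventually_mono [OF eventually_Bset]) (use C(2) p_lam_cpos [OF M f pos] in blast)
  qed
  assume w: "pos_functional \<omega>"
  interpret bounded_linear \<omega> by (rule pos_functional_linear [OF w])
  obtain B where B: "0 \<le> B" "\<And>x. cmod (\<omega> x) \<le> norm x * B" using nonneg_bounded by blast
  have "Re (\<omega> (p_lam M l f)) \<le> C * B" if "l \<in> Bset M" for l
    using complex_Re_le_cmod [of "\<omega> (p_lam M l f)"] B(2) [of "p_lam M l f"] mult_right_mono [OF C(2) [OF that] B(1)]
    by linarith
  from integrable_by_p_lam [OF M f pos w this] show int: "integrable M (\<lambda>x. \<omega> (f x))" .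
  define I where "I = (LINT x|M. \<omega> (f x))"
  have limI: "((\<lambda>l. \<omega> (p_lam M l f)) \<longlongrightarrow> I) (Bnet M)"
    unfolding I_def by (rule p_lam_tendsto(1) [OF M f pos w int])
  have "((\<lambda>e. \<omega> (fst m e)) \<longlongrightarrow> I) unit_net"
    unfolding tendsto_iff
  proof (intro allI impI)
    fix \<epsilon> :: real assume eps: "0 < \<epsilon>"
    \<comment> \<open>With this \<open>\<delta>\<close> the error of replacing
      \<open>p_lam M l f\<close> by \<open>p_lam M l f * e\<close> is at most
      \<open>\<epsilon> / 2\<close> for all \<open>l\<close> at once, so the limit in
      \<open>l\<close> can be taken with \<open>e\<close> fixed.\<close>
    define \<delta> where "\<delta> = \<epsilon> / (2 * C)"
    have "0 < \<delta>" using eps C(1) by (simp add: \<delta>_def)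
    from pos_functional_unit_net [OF w this]
    show "eventually (\<lambda>e. dist (\<omega> (fst m e)) I < \<epsilon>) unit_net"
    proof (rule eventually_mono)
      fix e assume e: "\<forall>x. cmod (\<omega> x - \<omega> (x * e)) \<le> \<delta> * norm x"
      have "((\<lambda>l. cmod (\<omega> (p_lam M l f) - \<omega> (p_lam M l f * e))) \<longlongrightarrow> cmod (I - \<omega> (fst m e))) (Bnet M)"
        by (intro tendsto_intros limI tendsto lim)
      moreover have "eventually (\<lambda>l. cmod (\<omega> (p_lam M l f) - \<omega> (p_lam M l f * e)) \<le> \<epsilon> / 2) (Bnet M)"
      proof (rule eventually_mono [OF eventually_Bset])
        fix l assume "l \<in> Bset M"
        then have "\<delta> * norm (p_lam M l f) \<le> \<delta> * C" using \<open>0 < \<delta>\<close> C(2) by (intro mult_left_mono) auto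
        also have "\<dots> = \<epsilon> / 2" using C(1) by (simp add: \<delta>_def)
        finally show "cmod (\<omega> (p_lam M l f) - \<omega> (p_lam M l f * e)) \<le> \<epsilon> / 2" using e order_trans by blast
      qed
      ultimately have "cmod (I - \<omega> (fst m e)) \<le> \<epsilon> / 2" by (rule tendsto_upperbound) (rule Bnet_nontrivial)
      then show "dist (\<omega> (fst m e)) I < \<epsilon>" using eps by (simp add: dist_norm norm_minus_commute)
    qed
  qed
  then show "ext_value \<omega> m (LINT x|M. \<omega> (f x))" by (simp add: ext_value_iff I_def)
qed

text \<open>The elements \<open>cstar c * (m - p_lam M l f) * c\<close> form a decreasing net in a convex set and tend to
  zero under every positive functional. The separation theorem replaces Dini's theorem on the state
  space: it shows that they tend to zero in norm.\<close>

lemma integral_imp_strict_limit: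
  assumes m: "m \<in> multipliers" and mp: "mpos m"
    and int: "\<And>\<omega>. pos_functional \<omega> \<Longrightarrow> integrable M (\<lambda>x. \<omega> (f x))"
    and ext: "\<And>\<omega>. pos_functional \<omega> \<Longrightarrow> ext_value \<omega> m (LINT x|M. \<omega> (f x))"
  shows "((\<lambda>l. p_lam M l f * c) \<longlongrightarrow> fst m c) (Bnet M)"
proof -
  obtain L where L: "\<And>c d. cstar c * fst m d = cstar (L c) * L d" using mpos_form [OF mp] by metis
  interpret m: bounded_linear "fst m" by (rule multiplier_bounded [OF m])
  define D where "D l v = fst m v - p_lam M l f * v" for l v
  define F where "F l u v = cstar u * D l v" for l u v
  have F_eq: "F l v v = cstar v * fst m v - cstar v * p_lam M l f * v" for l v
    by (simp add: F_def D_def right_diff_distrib mult.assoc)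
  have Fpos: "cpos (F l v v)" and Flim: "pos_functional \<omega> \<Longrightarrow> ((\<lambda>l. \<omega> (F l v v)) \<longlongrightarrow> 0) (Bnet M)"
    if l: "l \<in> Bset M" for l v \<omega>
  proof -
    have main: "((\<lambda>l. \<omega> (cstar v * p_lam M l f * v)) \<longlongrightarrow> \<omega> (cstar v * fst m v)) (Bnet M)"
      "Re (\<omega> (cstar v * p_lam M l f * v)) \<le> Re (\<omega> (cstar v * fst m v))" if w: "pos_functional \<omega>" for \<omega>
    proof -
      interpret w: bounded_linear \<omega> by (rule pos_functional_linear [OF w])
      note wc = pos_functional_conj [OF w, of v]
      \<comment> \<open>At a compressed functional the extension to M(A) is an honest value:
        \<open>fst m e * v = fst m (e * v)\<close> tends to \<open>fst m v\<close> by continuity of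
        the multiplier.\<close>
      have "(LINT x|M. \<omega> (cstar v * f x * v)) = \<omega> (cstar v * fst m v)"
      proof (rule tendsto_unique [OF unit_net_nontrivial])
        show "((\<lambda>e. \<omega> (cstar v * fst m e * v)) \<longlongrightarrow> (LINT x|M. \<omega> (cstar v * f x * v))) unit_net"
          using ext [OF wc] by (simp add: ext_value_iff)
        have "((\<lambda>e. \<omega> (cstar v * fst m (e * v))) \<longlongrightarrow> \<omega> (cstar v * fst m v)) unit_net"
          by (intro w.tendsto m.tendsto tendsto_mult tendsto_const unit_net_left)
        then show "((\<lambda>e. \<omega> (cstar v * fst m e * v)) \<longlongrightarrow> \<omega> (cstar v * fst m v)) unit_net"
          by (simp add: multiplier_mult [OF m] mult.assoc)
      qed
      then show "((\<lambda>l. \<omega> (cstar v * p_lam M l f * v)) \<longlongrightarrow> \<omega> (cstar v * fst m v)) (Bnet M)"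
        "Re (\<omega> (cstar v * p_lam M l f * v)) \<le> Re (\<omega> (cstar v * fst m v))"
        using p_lam_tendsto [OF M f pos wc int [OF wc]] l by simp_all
    qed
    show "cpos (F l v v)"
    proof (rule cpos_by_functionals)
      show "cstar (F l v v) = F l v v"
        unfolding F_eq L by (simp add: cstar_simps p_lam_selfadjoint [OF M f pos l] mult.assoc)
      fix \<omega> :: "'a \<Rightarrow> complex" assume w: "pos_functional \<omega>"
      interpret w: bounded_linear \<omega> by (rule pos_functional_linear [OF w])
      show "0 \<le> Re (\<omega> (F l v v))" using main(2) [OF w] by (simp add: F_eq w.diff)
    qed
    assume w: "pos_functional \<omega>"
    interpret w: bounded_linear \<omega> by (rule pos_functional_linear [OF w])
    show "((\<lambda>l. \<omega> (F l v v)) \<longlongrightarrow> 0) (Bnet M)"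
      using tendsto_diff [OF tendsto_const main(1) [OF w], of "\<omega> (cstar v * fst m v)"]
      by (simp add: F_eq w.diff)
  qed
  have Fanti: "cpos (F l v v - F l' v v)" if l: "l \<in> Bset M" "l' \<in> Bset M" "\<And>x. l x \<le> l' x" for l l' v
  proof -
    have "cpos (cstar v * (p_lam M l' f - p_lam M l f) * v)"
      using p_lam_mono [OF M f pos l] by (intro cpos_conj) (simp add: cle_def)
    then show ?thesis by (simp add: F_eq right_diff_distrib left_diff_distrib)
  qed
  have Fsmall: "eventually (\<lambda>l. norm (F l v v) < \<epsilon>) (Bnet M)" if eps: "0 < \<epsilon>" for v \<epsilon>
  proof -
    let ?S = "(\<lambda>l. F l v v) ` Bset M"
    have "\<exists>l\<in>Bset M. norm (F l v v) < \<epsilon>"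
    proof (rule ccontr)
      assume "\<not> ?thesis"
      then have ge: "\<epsilon> \<le> norm (F l v v)" if "l \<in> Bset M" for l using that by force
      have "convex ?S"
      proof (rule convexI)
        fix x y and s t :: real assume xy: "x \<in> ?S" "y \<in> ?S" and st: "0 \<le> s" "0 \<le> t" "s + t = 1"
        obtain l l' where l: "x = F l v v" "l \<in> Bset M" "y = F l' v v" "l' \<in> Bset M" using xy by blast
        have "s *\<^sub>R x + t *\<^sub>R y = F (\<lambda>x. s * l x + t * l' x) v v"
        proof -
          have "cstar v * fst m v = s *\<^sub>R (cstar v * fst m v) + t *\<^sub>R (cstar v * fst m v)"
            by (simp add: st flip: scaleR_add_left)
          then show ?thesis
            by (simp add: l F_eq p_lam_convex [OF M f pos l(2,4) st] algebra_simps)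
        qed
        then show "s *\<^sub>R x + t *\<^sub>R y \<in> ?S" using Bset_convex [OF l(2,4) st] by blast
      qed
      moreover have "?S \<noteq> {}" using Bset_zero by blast
      moreover have "cstar s = s" if "s \<in> ?S" for s using that Fpos cpos_cstar by blast
      \<comment> \<open>All elements of \<open>?S\<close> are positive, so adding \<open>p\<close>
        cannot decrease the norm.\<close>
      moreover have "\<epsilon> \<le> norm (s + p)" if s: "s \<in> ?S" and p: "cpos p" for s p
      proof -
        obtain l where l: "s = F l v v" "l \<in> Bset M" using s by blast
        have "norm s \<le> norm (s + p)" using p Fpos [OF l(2)] by (intro norm_mono) (simp_all add: l)
        then show ?thesis using ge [OF l(2)] by (simp add: l)
      qed
      ultimately obtain \<omega> where w: "pos_functional \<omega>" "\<And>s. s \<in> ?S \<Longrightarrow> \<epsilon> \<le> Re (\<omega> s)"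
        using separate_positive [of ?S \<epsilon>] by blast
      have "((\<lambda>l. Re (\<omega> (F l v v))) \<longlongrightarrow> Re 0) (Bnet M)"
        by (intro tendsto_Re Flim [OF Bset_zero] w)
      moreover have "eventually (\<lambda>l. \<epsilon> \<le> Re (\<omega> (F l v v))) (Bnet M)"
        by (rule eventually_mono [OF eventually_Bset]) (simp add: w)
      ultimately have "\<epsilon> \<le> Re 0" by (rule tendsto_lowerbound) (rule Bnet_nontrivial)
      then show False using eps by simp
    qed
    then obtain l0 where l0: "l0 \<in> Bset M" "norm (F l0 v v) < \<epsilon>" by blast
    have "norm (F l v v) < \<epsilon>" if "l \<in> Bset M" "\<forall>x. l0 x \<le> l x" for l
    proof -
      have "norm (F l v v) \<le> norm (F l0 v v)"
        using that l0(1) by (intro norm_mono Fpos Fanti) auto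
      then show ?thesis using l0(2) by simp
    qed
    then show ?thesis unfolding eventually_Bnet using l0(1) by blast
  qed
  obtain K where K: "0 < K" "\<And>v. norm (fst m v) \<le> norm v * K" using m.pos_bounded by blast
  \<comment> \<open>The algebra-valued Cauchy--Schwarz estimate. Expand
    \<open>F l w w \<ge> 0\<close> for \<open>w = c - (1 / N) d z\<close>. The cross terms give
    \<open>- (2 / N) z\<^sup>2\<close> and the last term is at most
    \<open>(1 / N) z\<^sup>2\<close>, so \<open>(1 / N) z\<^sup>2 \<le> F l c c\<close>; then take
    norms.\<close>
  have key: "(norm (D l c))\<^sup>2 \<le> K * norm (F l c c)" if l: "l \<in> Bset M" for l
  proof (cases "D l c = 0")
    case True
    then show ?thesis using K(1) by simp
  next
    case False
    define d where "d = D l c"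
    \<comment> \<open>The direction \<open>d * z\<close> is chosen so that both cross terms
      \<open>F l (d * z) c\<close> and \<open>F l c (d * z)\<close> equal
      \<open>z * z\<close>.\<close>
    define z where "z = cstar d * d"
    \<comment> \<open>A bound for \<open>norm (F l d d)\<close>, because \<open>F l d d\<close> lies
      between 0 and \<open>cstar d * fst m d\<close>.\<close>
    define N where "N = K * (norm d)\<^sup>2"
    have N: "0 < N" using K(1) False by (simp add: N_def d_def)
    have z: "cstar z = z" by (simp add: z_def cstar_mult)
    have D_diff: "D l (u - v) = D l u - D l v" and D_scale: "D l (t *\<^sub>R u) = t *\<^sub>R D l u"
      and D_mult: "D l (u * v) = D l u * v" for u v t
      by (simp_all add: D_def m.diff m.scaleR multiplier_mult [OF m] algebra_simps)
    have herm: "cstar (F l u v) = F l v u" for u v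
    proof -
      have "cstar (F l u v) = cstar (cstar u * fst m v) - cstar (cstar u * (p_lam M l f * v))"
        by (simp add: F_def D_def right_diff_distrib cstar_diff)
      also have "\<dots> = cstar v * fst m u - cstar v * (p_lam M l f * u)"
        by (simp add: L) (simp add: cstar_mult p_lam_selfadjoint [OF M f pos l] mult.assoc)
      finally show ?thesis by (simp add: F_def D_def right_diff_distrib)
    qed
    have F1: "F l (d * z) c = z * z" by (simp add: F_def cstar_mult z flip: d_def) (simp add: z_def mult.assoc)
    have F2: "F l c (d * z) = z * z" using herm [of "d * z" c] by (simp add: F1 cstar_mult z)
    have F3: "F l (d * z) (d * z) = cstar z * F l d d * z" by (simp add: F_def cstar_mult D_mult mult.assoc)
    have "norm (F l d d) \<le> norm (cstar d * fst m d)"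
    proof (rule norm_mono [OF Fpos [OF l]])
      have "cpos (cstar d * p_lam M l f * d)" by (intro cpos_conj p_lam_cpos [OF M f pos l])
      then show "cpos (cstar d * fst m d - F l d d)" by (simp add: F_eq)
    qed
    also have "\<dots> \<le> norm (cstar d) * norm (fst m d)" by (rule norm_mult_ineq)
    also have "\<dots> \<le> norm d * (norm d * K)" using K(2) by (simp add: mult_left_mono)
    finally have "norm (F l d d) \<le> N" by (simp add: N_def power2_eq_square mult_ac)
    then have c1: "cpos ((1 / N\<^sup>2) *\<^sub>R (N *\<^sub>R (cstar z * z) - cstar z * F l d d * z))"
      by (intro cpos_scaleR cpos_conj_le Fpos l) auto
    let ?w = "c - (1 / N) *\<^sub>R (d * z)"
    have "F l ?w ?w = F l c c - (1 / N) *\<^sub>R F l c (d * z) - (1 / N) *\<^sub>R F l (d * z) c + (1 / N\<^sup>2) *\<^sub>R F l (d * z) (d * z)"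
      by (simp add: F_def cstar_diff D_diff D_scale algebra_simps power2_eq_square)
    then have "cpos (F l c c - (1 / N) *\<^sub>R (z * z) - (1 / N) *\<^sub>R (z * z) + (1 / N\<^sup>2) *\<^sub>R (cstar z * F l d d * z))"
      using Fpos [OF l, of ?w] by (simp only: F1 F2 F3)
    from cpos_add [OF this c1] have "cpos (F l c c - (1 / N) *\<^sub>R (z * z))"
      using N by (simp add: z algebra_simps power2_eq_square)
    moreover have "cpos ((1 / N) *\<^sub>R (z * z))"
      using cpos_cstar_mult [of z] N by (intro cpos_scaleR) (simp_all add: z)
    ultimately have "norm ((1 / N) *\<^sub>R (z * z)) \<le> norm (F l c c)" by (intro norm_mono)
    moreover have "norm (z * z) = (norm d)\<^sup>2 * (norm d)\<^sup>2"
      using cstar_self_mult [OF z] by (simp add: z_def cstar_identity power2_eq_square)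
    ultimately have "(norm d)\<^sup>2 * (norm d)\<^sup>2 \<le> N * norm (F l c c)" using N by (simp add: field_simps)
    also have "\<dots> = (norm d)\<^sup>2 * (K * norm (F l c c))" by (simp add: N_def)
    finally have "(norm d)\<^sup>2 \<le> K * norm (F l c c)"
      by (rule mult_left_le_imp_le) (use False in \<open>simp add: d_def\<close>)
    then show ?thesis by (simp only: d_def)
  qed
  show ?thesis
    unfolding tendsto_iff
  proof (intro allI impI)
    fix \<epsilon> :: real assume "0 < \<epsilon>"
    then have "0 < \<epsilon>\<^sup>2 / K" using K(1) by simp
    from eventually_conj [OF eventually_Bset Fsmall [OF this, of c]]
    show "eventually (\<lambda>l. dist (p_lam M l f * c) (fst m c) < \<epsilon>) (Bnet M)"
    proof (rule eventually_mono)
      fix l assume l: "l \<in> Bset M \<and> norm (F l c c) < \<epsilon>\<^sup>2 / K"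
      then have "K * norm (F l c c) < \<epsilon>\<^sup>2" using K(1) by (simp add: field_simps)
      then have "(norm (D l c))\<^sup>2 < \<epsilon>\<^sup>2" using key l by (meson le_less_trans)
      then have "norm (D l c) < \<epsilon>" by (rule power2_less_imp_less) (use \<open>0 < \<epsilon>\<close> in simp)
      then show "dist (p_lam M l f * c) (fst m c) < \<epsilon>" by (simp add: D_def dist_norm norm_minus_commute)
    qed
  qed
qed

end

theorem theorem3p4:
  fixes M :: "'x::t2_space measure" and f :: "'x \<Rightarrow> 'a::cstar_algebra"
  assumes "locally_compact_space (euclidean :: 'x topology)"
    and "radon M"
    and "continuous_on UNIV f" and "bounded (range f)"
    and "Cb_pos f"
  shows "P_proper M f \<longleftrightarrow>
           (\<exists>m\<in>multipliers. mpos m \<and>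
              (\<forall>\<omega>. pos_functional \<omega> \<longrightarrow>
                 integrable M (\<lambda>x. \<omega> (f x)) \<and> ext_value \<omega> m (LINT x|M. \<omega> (f x))))"
proof -
  note M = assms(2) and f = assms(3)
  have pos: "cpos (f x)" for x using assms(5) unfolding Cb_pos_def cpos_def by blast
  show ?thesis
  proof
    assume "P_proper M f"
    then obtain m where m: "m \<in> multipliers"
      "\<And>c. ((\<lambda>l. p_lam M l f * c) \<longlongrightarrow> fst m c) (Bnet M)" "\<And>c. ((\<lambda>l. c * p_lam M l f) \<longlongrightarrow> snd m c) (Bnet M)"
      unfolding P_proper_iff by blast
    from proper_imp_integral [OF M f pos m] m(1)
    show "\<exists>m\<in>multipliers. mpos m \<and> (\<forall>\<omega>. pos_functional \<omega> \<longrightarrow>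
       integrable M (\<lambda>x. \<omega> (f x)) \<and> ext_value \<omega> m (LINT x|M. \<omega> (f x)))" by blast
  next
    assume "\<exists>m\<in>multipliers. mpos m \<and> (\<forall>\<omega>. pos_functional \<omega> \<longrightarrow>
       integrable M (\<lambda>x. \<omega> (f x)) \<and> ext_value \<omega> m (LINT x|M. \<omega> (f x)))"
    then obtain m where m: "m \<in> multipliers" "mpos m"
      "\<And>\<omega>. pos_functional \<omega> \<Longrightarrow> integrable M (\<lambda>x. \<omega> (f x))"
      "\<And>\<omega>. pos_functional \<omega> \<Longrightarrow> ext_value \<omega> m (LINT x|M. \<omega> (f x))" by blast
    note left = integral_imp_strict_limit [OF M f pos m]
    \<comment> \<open>The right limits are the adjoints of the left ones, as the positive
      \<open>m\<close> and all elements of the net are self-adjoint.\<close>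
    have "((\<lambda>l. c * p_lam M l f) \<longlongrightarrow> snd m c) (Bnet M)" for c
    proof -
      have "snd m c = cstar (fst m (cstar c))" using mpos_form [OF m(2)] by metis
      moreover have "((\<lambda>l. cstar (p_lam M l f * cstar c)) \<longlongrightarrow> cstar (fst m (cstar c))) (Bnet M)"
        by (intro tendsto_cstar left)
      moreover have "eventually (\<lambda>l. cstar (p_lam M l f * cstar c) = c * p_lam M l f) (Bnet M)"
        by (rule eventually_mono [OF eventually_Bset]) (simp add: cstar_mult p_lam_selfadjoint [OF M f pos])
      ultimately show ?thesis by (simp add: Lim_transform_eventually)
    qed
    with left m(1) show "P_proper M f" unfolding P_proper_iff by blast
  qed
qed

end
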